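(* Let $M\subseteq\mathcal B(H_M)$ and $N\subseteq\mathcal B(H_N)$ be von Neumann algebras, and let $\theta:M\to N$ be a normal completely positive map with Kraus form $\theta(x)=\sum_{i\in I}b_i^*xb_i$, where $b_i\in\mathcal B(H_N,H_M)$. Let $S\subseteq\mathcal B(H_M)$ be a quantum relation over $M$, and let $\overleftarrow S$ be the pullback of $S$ along $\theta$, that is, the weak$^*$-closed $N'$-operator bimodule generated by the elements $b_i^*xb_j$ for $x\in S$, $i,j\in I$. Then: (1) already the weak$^*$-closed linear subspace generated by the elements $b_i^*xb_j$, for $x\in S$, $i,j\in I$, is an $N'$-operator bimodule; (2) if $V,\pi,K$ is any Stinespring dilation of $\theta$, then $\overleftarrow S$ is the weak$^*$-closure of $V^*S_\pi V$.
   Context: Hilbert spaces may be infinite-dimensional; $\bar\otimes$ denotes the weak$^*$-closed (von Neumann) tensor product. A quantum relation over a von Neumann algebra $M\subseteq\mathcal B(H_M)$ is a weak$^*$-closed subspace $S\subseteq\mathcal B(H_M)$ with $xsy\in S$ for $x,y\in M'$, $s\in S$; an $N'$-operator bimodule in $\mathcal B(H_N)$ is a subspace closed under left and right multiplication by $N'$. A Stinespring dilation of $\theta$ consists of a Hilbert space $K$, a normal unital $*$-homomorphism $\pi:M\to\mathcal B(K)$, and a bounded operator $V:H_N\to K$ with $\theta(x)=V^*\pi(x)V$ for $x\in M$; no minimality is assumed. A Kraus form $\theta(x)=\sum_{i\in I}b_i^*xb_i$ is the same as a Stinespring dilation with $K=H_M\otimes\ell^2(I)$, $\pi(x)=x\otimes1$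 and $V\xi=\sum_ib_i\xi\otimes\delta_i$. For a normal unital $*$-homomorphism $\pi:M\to\mathcal B(K)$ there are a Hilbert space $L$ and an isometry $u:K\to H_M\otimes L$ with $(x\otimes1)u=u\pi(x)$ for all $x\in M$; define $S_\pi=u^*(S\bar\otimes\mathcal B(L))u\subseteq\mathcal B(K)$, where $S\bar\otimes\mathcal B(L)$ is the weak$^*$-closed linear span of $\{s\otimes a:s\in S,a\in\mathcal B(L)\}$. $S_\pi$ does not depend on the choice of $u,L$. *)

theory Defs
  imports "HOL-Analysis.Analysis"
begin

text \<open>
  A complex Hilbert space is a complete real inner product space (as in the library) together with
  a complex scalar multiplication extending the real one and a complex inner product, conjugate
  linear in the first argument, whose real part is the real inner product.  In particular the norm
  is the one induced by the complex inner product.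
\<close>

class chilbert_space = real_inner + complete_space +
  fixes scaleC :: "complex \<Rightarrow> 'a \<Rightarrow> 'a"  (infixr "*\<^sub>C" 75)
    and cinner :: "'a \<Rightarrow> 'a \<Rightarrow> complex"
  assumes scaleC_add_right: "a *\<^sub>C (x + y) = a *\<^sub>C x + a *\<^sub>C y"
    and scaleC_add_left: "(a + b) *\<^sub>C x = a *\<^sub>C x + b *\<^sub>C x"
    and scaleC_scaleC: "a *\<^sub>C (b *\<^sub>C x) = (a * b) *\<^sub>C x"
    and scaleC_one: "1 *\<^sub>C x = x"
    and scaleR_scaleC: "r *\<^sub>R x = complex_of_real r *\<^sub>C x"
    and cinner_commute: "cinner x y = cnj (cinner y x)"
    and cinner_add_right: "cinner x (y + z) = cinner x y + cinner x z"
    and cinner_scaleC_right: "cinner x (a *\<^sub>C y) = a * cinner x y"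
    and inner_eq_Re_cinner: "inner x y = Re (cinner x y)"

global_interpretation chilbert: vector_space "scaleC :: complex \<Rightarrow> 'a \<Rightarrow> 'a::chilbert_space"
  defines cvec_span = chilbert.span
  by unfold_locales (simp_all add: scaleC_add_right scaleC_add_left scaleC_scaleC scaleC_one)

instantiation complex :: chilbert_space
begin

definition "scaleC_complex = (\<lambda>(a::complex) (x::complex). a * x)"
definition "cinner_complex = (\<lambda>(x::complex) (y::complex). cnj x * y)"

instance
  by standard
    (auto simp: scaleC_complex_def cinner_complex_def inner_complex_def algebra_simps
      scaleR_conv_of_real)

end


subsection \<open>Bounded operators\<close>

typedef (overloaded) ('a, 'b) cblinfun =
  "{f :: 'a::chilbert_space \<Rightarrow> 'b::chilbert_space. bounded_linear f \<and> (\<forall>c x. f (c *\<^sub>C x) = c *\<^sub>C f x)}"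
  morphisms cblinfun_apply Cblinfun
  by (rule exI[of _ "\<lambda>_. 0"]) auto

setup_lifting type_definition_cblinfun

notation cblinfun_apply (infixr "*\<^sub>V" 70)

type_synonym 'a cbop = "('a, 'a) cblinfun"

instantiation cblinfun :: (chilbert_space, chilbert_space) ab_group_add
begin

lift_definition zero_cblinfun :: "('a, 'b) cblinfun" is "\<lambda>_. 0"
  by auto

lift_definition plus_cblinfun :: "('a, 'b) cblinfun \<Rightarrow> ('a, 'b) cblinfun \<Rightarrow> ('a, 'b) cblinfun"
  is "\<lambda>f g x. f x + g x"
  by (auto intro: bounded_linear_add simp: scaleC_add_right)

lift_definition uminus_cblinfun :: "('a, 'b) cblinfun \<Rightarrow> ('a, 'b) cblinfun"
  is "\<lambda>f x. - f x"
  by (auto intro: bounded_linear_minus)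

lift_definition minus_cblinfun :: "('a, 'b) cblinfun \<Rightarrow> ('a, 'b) cblinfun \<Rightarrow> ('a, 'b) cblinfun"
  is "\<lambda>f g x. f x - g x"
  by (auto intro: bounded_linear_sub simp: chilbert.scale_right_diff_distrib)

instance
  by standard (transfer; simp add: fun_eq_iff)+

end

lemma bounded_linear_scaleC: "bounded_linear (\<lambda>x::'a::chilbert_space. c *\<^sub>C x)"
proof -
  have "norm (c *\<^sub>C x) = norm c * norm x" for x :: 'a
  proof -
    have "cinner (c *\<^sub>C x) (c *\<^sub>C x) = c * cnj c * cinner x x"
      by (metis cinner_scaleC_right cinner_commute complex_cnj_cnj complex_cnj_mult mult.assoc)
    then have "inner (c *\<^sub>C x) (c *\<^sub>C x) = (norm c)\<^sup>2 * inner x x"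
      by (simp add: inner_eq_Re_cinner complex_norm_square[symmetric] flip: of_real_power)
    then show ?thesis
      by (simp add: norm_eq_sqrt_inner real_sqrt_mult)
  qed
  then show ?thesis
    by (intro bounded_linear_intro[where K = "norm c"])
      (simp_all add: scaleC_add_right scaleR_scaleC scaleC_scaleC mult.commute)
qed

lift_definition cblinfun_scale ::
    "complex \<Rightarrow> ('a::chilbert_space, 'b::chilbert_space) cblinfun \<Rightarrow> ('a, 'b) cblinfun"
  is "\<lambda>c f x. c *\<^sub>C f x"
  by (auto intro: bounded_linear_compose[OF bounded_linear_scaleC] simp: scaleC_scaleC mult.commute)

global_interpretation cblinfun: vector_space
    "cblinfun_scale :: complex \<Rightarrow> ('a::chilbert_space, 'b::chilbert_space) cblinfun \<Rightarrow> _"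
  defines cblinfun_span = cblinfun.span
    and cblinfun_subspace = cblinfun.subspace
  by unfold_locales
    (transfer; simp add: fun_eq_iff scaleC_add_right scaleC_add_left scaleC_scaleC scaleC_one)+

lift_definition cblinfun_id :: "'a::chilbert_space cbop" is "\<lambda>x. x"
  by auto

lift_definition cblinfun_compose ::
    "('b::chilbert_space, 'c::chilbert_space) cblinfun \<Rightarrow> ('a::chilbert_space, 'b) cblinfun
      \<Rightarrow> ('a, 'c) cblinfun"  (infixl "o\<^sub>C" 67)
  is "\<lambda>f g x. f (g x)"
  by (auto intro: bounded_linear_compose)

definition cadjoint ::
    "('a::chilbert_space, 'b::chilbert_space) cblinfun \<Rightarrow> ('b, 'a) cblinfun" where
  "cadjoint a = (THE b. \<forall>x y. cinner (b *\<^sub>V y) x = cinner y (a *\<^sub>V x))"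

definition cisometry :: "('a::chilbert_space, 'b::chilbert_space) cblinfun \<Rightarrow> bool" where
  "cisometry u \<longleftrightarrow> (\<forall>x. norm (u *\<^sub>V x) = norm x)"


subsection \<open>The weak* topology\<close>

text \<open>
  The predual of \<open>B(H)\<close>, the trace class operators, acts on \<open>B(H)\<close> by exactly the functionals
  \<open>a \<mapsto> (\<Sum>n. \<langle>\<xi>\<^sub>n, a \<eta>\<^sub>n\<rangle>)\<close> with square summable sequences of vectors \<open>\<xi>\<close>, \<open>\<eta>\<close>.
\<close>

definition predual_functionals :: "('a::chilbert_space cbop \<Rightarrow> complex) set" where
  "predual_functionals = {(\<lambda>a. \<Sum>n. cinner (\<xi> n) (a *\<^sub>V \<eta> n)) | \<xi> \<eta> :: nat \<Rightarrow> 'a.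
     summable (\<lambda>n. (norm (\<xi> n))\<^sup>2) \<and> summable (\<lambda>n. (norm (\<eta> n))\<^sup>2)}"

definition weakstar :: "'a::chilbert_space cbop topology" where
  "weakstar = topology_generated_by {\<phi> -` U | \<phi> U. \<phi> \<in> predual_functionals \<and> open U}"

definition weakstar_span :: "'a::chilbert_space cbop set \<Rightarrow> 'a cbop set" where
  "weakstar_span G = weakstar closure_of cblinfun_span G"


subsection \<open>Von Neumann algebras and quantum relations\<close>

definition von_neumann_algebra :: "'a::chilbert_space cbop set \<Rightarrow> bool" where
  "von_neumann_algebra M \<longleftrightarrow>
     cblinfun_subspace M \<and> cblinfun_id \<in> M \<and>
     (\<forall>x\<in>M. \<forall>y\<in>M. x o\<^sub>C y \<in> M) \<and> (\<forall>x\<in>M. cadjoint x \<in> M) \<and>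
     closedin weakstar M"

definition commutant :: "'a::chilbert_space cbop set \<Rightarrow> 'a cbop set" where
  "commutant M = {y. \<forall>x\<in>M. x o\<^sub>C y = y o\<^sub>C x}"

definition quantum_relation :: "'a::chilbert_space cbop set \<Rightarrow> 'a cbop set \<Rightarrow> bool" where
  "quantum_relation M S \<longleftrightarrow>
     cblinfun_subspace S \<and> closedin weakstar S \<and>
     (\<forall>x\<in>commutant M. \<forall>y\<in>commutant M. \<forall>s\<in>S. x o\<^sub>C s o\<^sub>C y \<in> S)"

definition operator_bimodule :: "'a::chilbert_space cbop set \<Rightarrow> 'a cbop set \<Rightarrow> bool" where
  "operator_bimodule A T \<longleftrightarrow>
     cblinfun_subspace T \<and> (\<forall>y\<in>A. \<forall>t\<in>T. y o\<^sub>C t \<in> T \<and> t o\<^sub>C y \<in> T)"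


subsection \<open>Normal completely positive maps\<close>

text \<open>
  Maps on a von Neumann algebra \<open>M\<close> are total functions of which only the values on \<open>M\<close> matter.
\<close>

definition clinear_on ::
    "'a::chilbert_space cbop set \<Rightarrow> ('a cbop \<Rightarrow> 'b::chilbert_space cbop) \<Rightarrow> bool" where
  "clinear_on M f \<longleftrightarrow>
     (\<forall>x\<in>M. \<forall>y\<in>M. f (x + y) = f x + f y) \<and>
     (\<forall>c. \<forall>x\<in>M. f (cblinfun_scale c x) = cblinfun_scale c (f x))"

definition normal_on ::
    "'a::chilbert_space cbop set \<Rightarrow> ('a cbop \<Rightarrow> 'b::chilbert_space cbop) \<Rightarrow> bool" where
  "normal_on M f \<longleftrightarrow> continuous_map (subtopology weakstar M) weakstar f"

text \<open>Positivity of an \<open>n \<times> n\<close> operator matrix, as an operator on the \<open>n\<close>-fold direct sum of \<open>H\<close>.\<close>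

definition positive_matrix :: "nat \<Rightarrow> (nat \<Rightarrow> nat \<Rightarrow> 'a::chilbert_space cbop) \<Rightarrow> bool" where
  "positive_matrix n X \<longleftrightarrow>
     (\<forall>\<xi>. (\<Sum>i<n. \<Sum>j<n. cinner (\<xi> i) (X i j *\<^sub>V \<xi> j)) \<in> \<real>\<^sub>\<ge>\<^sub>0)"

definition completely_positive_on ::
    "'a::chilbert_space cbop set \<Rightarrow> ('a cbop \<Rightarrow> 'b::chilbert_space cbop) \<Rightarrow> bool" where
  "completely_positive_on M f \<longleftrightarrow>
     clinear_on M f \<and>
     (\<forall>n X. (\<forall>i<n. \<forall>j<n. X i j \<in> M) \<and> positive_matrix n X \<longrightarrow>
        positive_matrix n (\<lambda>i j. f (X i j)))"

definition normal_cp_map ::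
    "'a::chilbert_space cbop set \<Rightarrow> 'b::chilbert_space cbop set \<Rightarrow> ('a cbop \<Rightarrow> 'b cbop) \<Rightarrow> bool" where
  "normal_cp_map M N f \<longleftrightarrow> f \<in> M \<rightarrow> N \<and> completely_positive_on M f \<and> normal_on M f"

definition kraus_form ::
    "'a::chilbert_space cbop set \<Rightarrow> ('a cbop \<Rightarrow> 'b::chilbert_space cbop) \<Rightarrow>
      'i set \<Rightarrow> ('i \<Rightarrow> ('b, 'a) cblinfun) \<Rightarrow> bool" where
  "kraus_form M f I b \<longleftrightarrow>
     (\<forall>x\<in>M. limitin weakstar (\<lambda>F. \<Sum>i\<in>F. cadjoint (b i) o\<^sub>C x o\<^sub>C b i) (f x)
        (finite_subsets_at_top I))"


subsection \<open>The pullback of a quantum relation\<close>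

definition pullback_generators ::
    "'i set \<Rightarrow> ('i \<Rightarrow> ('b::chilbert_space, 'a::chilbert_space) cblinfun) \<Rightarrow> 'a cbop set \<Rightarrow> 'b cbop set"
  where
  "pullback_generators I b S = {cadjoint (b i) o\<^sub>C x o\<^sub>C b j | i x j. i \<in> I \<and> x \<in> S \<and> j \<in> I}"

definition pullback ::
    "'b::chilbert_space cbop set \<Rightarrow> 'i set \<Rightarrow> ('i \<Rightarrow> ('b, 'a::chilbert_space) cblinfun) \<Rightarrow>
      'a cbop set \<Rightarrow> 'b cbop set" where
  "pullback N I b S =
     (\<lambda>T. operator_bimodule (commutant N) T \<and> closedin weakstar T) hull pullback_generators I b S"


subsection \<open>Stinespring dilations\<close>

definition normal_unital_star_hom ::
    "'a::chilbert_space cbop set \<Rightarrow> ('a cbop \<Rightarrow> 'k::chilbert_space cbop) \<Rightarrow> bool" where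
  "normal_unital_star_hom M \<pi> \<longleftrightarrow>
     clinear_on M \<pi> \<and> (\<forall>x\<in>M. \<forall>y\<in>M. \<pi> (x o\<^sub>C y) = \<pi> x o\<^sub>C \<pi> y) \<and>
     (\<forall>x\<in>M. \<pi> (cadjoint x) = cadjoint (\<pi> x)) \<and> \<pi> cblinfun_id = cblinfun_id \<and> normal_on M \<pi>"

definition stinespring_dilation ::
    "'a::chilbert_space cbop set \<Rightarrow> ('a cbop \<Rightarrow> 'b::chilbert_space cbop) \<Rightarrow>
      ('a cbop \<Rightarrow> 'k::chilbert_space cbop) \<Rightarrow> ('b, 'k) cblinfun \<Rightarrow> bool" where
  "stinespring_dilation M f \<pi> V \<longleftrightarrow>
     normal_unital_star_hom M \<pi> \<and> (\<forall>x\<in>M. f x = cadjoint V o\<^sub>C \<pi> x o\<^sub>C V)"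


subsection \<open>Tensor products and the relation induced by a representation\<close>

text \<open>
  A Hilbert space tensor product of \<open>H\<close> and \<open>L\<close> is a Hilbert space, the type \<open>'t\<close>, with a bilinear
  map \<open>tens\<close> from \<open>H \<times> L\<close> satisfying the usual formula for inner products of elementary tensors and
  such that these span a dense subspace.  This determines the pair up to a unique unitary
  isomorphism.
\<close>

definition hilbert_tensor ::
    "('h::chilbert_space \<Rightarrow> 'l::chilbert_space \<Rightarrow> 't::chilbert_space) \<Rightarrow> bool" where
  "hilbert_tensor tens \<longleftrightarrow>
     (\<forall>h h' l. tens (h + h') l = tens h l + tens h' l) \<and>
     (\<forall>h l l'. tens h (l + l') = tens h l + tens h l') \<and>
     (\<forall>c h l. tens (c *\<^sub>C h) l = c *\<^sub>C tens h l \<and> tens h (c *\<^sub>C l) = c *\<^sub>C tens h l) \<and>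
     (\<forall>h l h' l'. cinner (tens h l) (tens h' l') = cinner h h' * cinner l l') \<and>
     closure (cvec_span {tens h l | h l. True}) = UNIV"

definition tensor_op ::
    "('h::chilbert_space \<Rightarrow> 'l::chilbert_space \<Rightarrow> 't::chilbert_space) \<Rightarrow>
      'h cbop \<Rightarrow> 'l cbop \<Rightarrow> 't cbop" where
  "tensor_op tens s a = (THE t. \<forall>h l. t *\<^sub>V tens h l = tens (s *\<^sub>V h) (a *\<^sub>V l))"

definition tensor_full ::
    "('h::chilbert_space \<Rightarrow> 'l::chilbert_space \<Rightarrow> 't::chilbert_space) \<Rightarrow> 'h cbop set \<Rightarrow> 't cbop set" where
  "tensor_full tens S = weakstar_span {tensor_op tens s a | s a. s \<in> S}"

definition intertwining_isometry ::
    "'h::chilbert_space cbop set \<Rightarrow> ('h cbop \<Rightarrow> 'k::chilbert_space cbop) \<Rightarrow>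
      ('h \<Rightarrow> 'l::chilbert_space \<Rightarrow> 't::chilbert_space) \<Rightarrow> ('k, 't) cblinfun \<Rightarrow> bool" where
  "intertwining_isometry M \<pi> tens u \<longleftrightarrow>
     cisometry u \<and> (\<forall>x\<in>M. tensor_op tens x cblinfun_id o\<^sub>C u = u o\<^sub>C \<pi> x)"

text \<open>
  The set \<open>S\<^sub>\<pi> = u\<^sup>* (S \<otimes> B(L)) u\<close>, which depends on \<open>\<pi>\<close> only, not on the intertwining isometry \<open>u\<close>.
\<close>

definition rep_relation ::
    "('h::chilbert_space \<Rightarrow> 'l::chilbert_space \<Rightarrow> 't::chilbert_space) \<Rightarrow>
      ('k::chilbert_space, 't) cblinfun \<Rightarrow> 'h cbop set \<Rightarrow> 'k cbop set" where
  "rep_relation tens u S = {cadjoint u o\<^sub>C t o\<^sub>C u | t. t \<in> tensor_full tens S}"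

end

(*
  Let V be the operator xi |-> (b_i xi)_i into the square summable families, so that
  theta(x) = V* (x (x) 1) V. Call c dominated if |sum x_k c xi_k| <= C |sum (x_k (x) 1) V xi_k|
  for all finite families of x_k in M and vectors xi_k. Then (x (x) 1) V xi |-> x c xi extends to a
  bounded operator commuting with M, so that c = sum_i a_i b_i with coefficients a_i in M'.
  Since S is an M'-bimodule, c'* s c lies in the weak* closed span T of all b_i* s b_j whenever
  c and c' are dominated and s is in S.

  For (1), b_j y is dominated for y in N': the operator matrix (theta(x_k* x_l)) is positive and
  commutes with y, and an iterated Cauchy-Schwarz argument gives the bound without square roots of
  operators. For (2), the slices of uV in an orthonormal basis of the second tensor factor form
  another Kraus family of theta; its members are dominated by the first family and conversely, so
  both families have the same T, and compressing S (x) B(L) by the basis identifies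
  T with the closure of V* S_pi V.

  All weak* closures are computed by duality: x lies in the closed span of G if and only if every
  predual functional vanishing on G vanishes at x.
*)
theory Submission
  imports Defs
begin

section \<open>Complex Hilbert spaces\<close>

text \<open>An element \<open>y\<close> of the commutant of \<open>N\<close> need not act on the
  dilation space, so \<open>b j o\<^sub>C y\<close> cannot be rewritten directly in terms of the
  family \<open>b\<close>. The usual remedy lifts \<open>y\<close> to the commutant of the image of
  \<open>M\<close> in a minimal dilation. Here the lifting is replaced by an inequality, and the
  coefficients a_i are extracted from it in the manner of a Radon-Nikodym theorem for completely
  positive maps. The right side of the inequality is a Gram form that contains \<open>b\<close> only
  through \<open>\<theta>\<close>; this is why one notion serves both for multiplication by the
  commutant of \<open>N\<close> and for the comparison of two Kraus families. The expansion of a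
  dominated operator converges only weakly, with bounded partial sums. A predual functional can
  still be applied term by term, and it vanishes in the limit if it vanishes on all terms. Duality
  thus lets the two outer factors be treated one after the other, without double limits.\<close>

lemma cinner_add_left: "cinner (x + y) z = cinner x z + cinner y z"
  for x :: "'a::chilbert_space"
  by (metis cinner_add_right cinner_commute complex_cnj_add)

lemma cinner_scaleC_left: "cinner (c *\<^sub>C x) y = cnj c * cinner x y"
  for x :: "'a::chilbert_space"
  by (metis cinner_scaleC_right cinner_commute complex_cnj_mult)

lemma cinner_self: "cinner x x = complex_of_real ((norm x)\<^sup>2)"
  for x :: "'a::chilbert_space"
proof -
  have "Im (cinner x x) = 0"
    using cinner_commute[of x x] by (metis cnj.sel(2) neg_equal_zero)
  moreover have "Re (cinner x x) = (norm x)\<^sup>2"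
    by (simp add: power2_norm_eq_inner flip: inner_eq_Re_cinner)
  ultimately show ?thesis
    by (simp add: complex_eq_iff)
qed

lemma norm_scaleC: "norm (c *\<^sub>C x) = cmod c * norm x"
  for x :: "'a::chilbert_space"
proof -
  have "complex_of_real ((norm (c *\<^sub>C x))\<^sup>2) = (c * cnj c) * cinner x x"
    by (simp only: cinner_scaleC_left cinner_scaleC_right mult.assoc cinner_self[symmetric])
  also have "\<dots> = complex_of_real ((cmod c * norm x)\<^sup>2)"
    by (simp add: cinner_self power_mult_distrib flip: complex_norm_square)
  finally have "(norm (c *\<^sub>C x))\<^sup>2 = (cmod c * norm x)\<^sup>2"
    using of_real_eq_iff by blast
  then show ?thesis
    by (simp add: power2_eq_iff_nonneg)
qed

text \<open>Rotating \<open>y\<close> by a phase makes the inner product real and nonnegative, where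
  the real Cauchy-Schwarz inequality applies.\<close>

lemma cmod_cinner_le: "cmod (cinner x y) \<le> norm x * norm y"
  for x :: "'a::chilbert_space"
proof -
  define c where "c = cnj (sgn (cinner x y))"
  have inner0: "cinner x 0 = 0"
    using cinner_add_right[of x 0 0] by simp
  have "cinner x (c *\<^sub>C y) = complex_of_real (cmod (cinner x y))"
    by (cases "cinner x y = 0")
      (simp_all add: c_def inner0 cinner_scaleC_right sgn_eq mult.commute complex_norm_square[symmetric]
        power2_eq_square)
  then have "cmod (cinner x y) = inner x (c *\<^sub>C y)"
    by (simp add: inner_eq_Re_cinner)
  also have "\<dots> \<le> norm x * norm (c *\<^sub>C y)"
    by (rule norm_cauchy_schwarz)
  also have "\<dots> \<le> norm x * norm y"
    by (auto simp: norm_scaleC c_def norm_sgn intro: mult_left_mono)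
  finally show ?thesis .
qed

lemma bounded_bilinear_cinner: "bounded_bilinear (cinner :: 'a::chilbert_space \<Rightarrow> _)"
proof
  fix r :: real and x x' y y' :: 'a
  show "cinner (x + x') y = cinner x y + cinner x' y"
    by (rule cinner_add_left)
  show "cinner x (y + y') = cinner x y + cinner x y'"
    by (rule cinner_add_right)
  show "cinner (r *\<^sub>R x) y = r *\<^sub>R cinner x y"
    unfolding scaleR_conv_of_real by (simp add: scaleR_scaleC cinner_scaleC_left)
  show "cinner x (r *\<^sub>R y) = r *\<^sub>R cinner x y"
    unfolding scaleR_conv_of_real by (simp add: scaleR_scaleC cinner_scaleC_right)
  show "\<exists>K. \<forall>a b :: 'a. cmod (cinner a b) \<le> norm a * norm b * K"
    by (intro exI[of _ 1]) (simp add: cmod_cinner_le)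
qed

interpretation cinner: bounded_bilinear "cinner :: 'a::chilbert_space \<Rightarrow> _"
  by (rule bounded_bilinear_cinner)

lemma cinner_right_eqI:
  assumes "\<And>z. cinner z x = cinner z y"
  shows "x = (y :: 'a::chilbert_space)"
proof -
  have "cinner (x - y) (x - y) = 0"
    by (simp add: cinner.diff_right assms)
  then show ?thesis
    by (simp add: cinner_self)
qed

lemma cinner_left_eqI:
  assumes "\<And>z. cinner x z = cinner y z"
  shows "x = (y :: 'a::chilbert_space)"
  by (metis assms cinner_right_eqI cinner_commute)


section \<open>Riesz representation on graphs\<close>

text \<open>
  The functional is given by its graph \<open>G\<close>, so that it need not be shown to be well defined
  beforehand; the vector minimizes \<open>norm d ^ 2 - 2 * g\<close> over \<open>(d, g) \<in> G\<close>.
\<close>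

lemma riesz_graph:
  fixes G :: "('a::{real_inner, complete_space} \<times> real) set"
  assumes G: "subspace G" and bound: "\<And>d g. (d, g) \<in> G \<Longrightarrow> \<bar>g\<bar> \<le> C * norm d"
  shows "\<exists>z. (\<forall>d g. (d, g) \<in> G \<longrightarrow> inner z d = g) \<and> (norm z \<le> C \<or> z = 0) \<and>
    (\<forall>y. (\<forall>d g. (d, g) \<in> G \<longrightarrow> inner y d = 0) \<longrightarrow> inner y z = 0)"
proof -
  define F where "F = (\<lambda>(d :: 'a, g). (norm d)\<^sup>2 - 2 * g)"
  define m where "m = Inf (F ` G)"
  have zero: "(0, 0) \<in> G"
    using subspace_0[OF G] by (simp add: zero_prod_def)
  have add: "(d + d', g + g') \<in> G" if "(d, g) \<in> G" "(d', g') \<in> G" for d d' g g'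
    using subspace_add[OF G that] by simp
  have scale: "(r *\<^sub>R d, r * g) \<in> G" if "(d, g) \<in> G" for r d g
    using subspace_scale[OF G that, of r] by simp
  \<comment> \<open>Completing the square: on \<open>G\<close> the value of \<open>F\<close> is at
    least \<open>(norm d)\<^sup>2 - 2 * C * norm d\<close>.\<close>
  have Fge: "F p \<ge> - C\<^sup>2" if "p \<in> G" for p
  proof -
    obtain d g where p: "p = (d, g)"
      by force
    have "g \<le> C * norm d"
      using bound[of d g] that p by auto
    moreover have "0 \<le> (norm d - C)\<^sup>2"
      by simp
    ultimately show ?thesis
      by (simp add: p F_def power2_diff algebra_simps)
  qed
  then have bdd: "bdd_below (F ` G)"
    by (meson bdd_below.I2)
  have m_le: "m \<le> F p" if "p \<in> G" for p
    unfolding m_def using that bdd by (simp add: cInf_lower)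
  have "\<exists>p\<in>G. F p < m + 1 / real (Suc n)" for n
  proof -
    have "F ` G \<noteq> {}" "m < m + 1 / real (Suc n)"
      using zero by auto
    then show ?thesis
      using cInf_lessD[of "F ` G" "m + 1 / real (Suc n)"] unfolding m_def[symmetric] by auto
  qed
  then obtain P where PG: "\<And>n. P n \<in> G" and PF: "\<And>n. F (P n) < m + 1 / real (Suc n)"
    by metis
  define D where "D = (\<lambda>n. fst (P n))"
  define H where "H = (\<lambda>n. snd (P n))"
  have DH: "(D n, H n) \<in> G" for n
    using PG by (simp add: D_def H_def)
  have FDH: "(norm (D n))\<^sup>2 - 2 * H n < m + 1 / real (Suc n)" for n
    using PF[of n] by (simp add: F_def D_def H_def case_prod_beta)
  \<comment> \<open>The midpoint of two members of the minimizing sequence lies in \<open>G\<close>,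
    so \<open>F\<close> is at least \<open>m\<close> there; the parallelogram law turns this into a
    Cauchy estimate.\<close>
  have close: "(norm (D n - D k))\<^sup>2 \<le> 2 * (1 / real (Suc n) + 1 / real (Suc k))" for n k
  proof -
    have "((1/2) *\<^sub>R (D n + D k), (1/2) * (H n + H k)) \<in> G"
      by (intro scale add DH)
    then have "m \<le> (norm ((1/2) *\<^sub>R (D n + D k)))\<^sup>2 - (H n + H k)"
      using m_le[of "((1/2) *\<^sub>R (D n + D k), (1/2) * (H n + H k))"] by (simp add: F_def field_simps)
    also have "(norm ((1/2) *\<^sub>R (D n + D k)))\<^sup>2 = (norm (D n + D k))\<^sup>2 / 4"
      by (simp add: power_divide)
    finally have "4 * m \<le> (norm (D n + D k))\<^sup>2 - 4 * (H n + H k)"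
      by simp
    moreover have "(norm (D n - D k))\<^sup>2 + (norm (D n + D k))\<^sup>2 = 2 * (norm (D n))\<^sup>2 + 2 * (norm (D k))\<^sup>2"
      by (simp add: power2_norm_eq_inner algebra_simps inner_commute)
    ultimately show ?thesis
      using FDH[of n] FDH[of k] by (simp add: algebra_simps)
  qed
  have inv0: "(\<lambda>n. 1 / real (Suc n)) \<longlonglongrightarrow> 0"
    using LIMSEQ_Suc[OF lim_1_over_n] by simp
  have "Cauchy D"
  proof (rule metric_CauchyI)
    fix e :: real assume e: "e > 0"
    then have "eventually (\<lambda>n. 1 / real (Suc n) < e\<^sup>2 / 4) sequentially"
      using order_tendstoD(2)[OF inv0, of "e\<^sup>2 / 4"] by simp
    then obtain N where N: "\<And>n. n \<ge> N \<Longrightarrow> 1 / real (Suc n) < e\<^sup>2 / 4"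
      by (auto simp: eventually_sequentially)
    show "\<exists>M. \<forall>m\<ge>M. \<forall>n\<ge>M. dist (D m) (D n) < e"
    proof (intro exI[of _ N] allI impI)
      fix i j assume "i \<ge> N" "j \<ge> N"
      have "x < c" if "x \<le> 2 * (a + b)" "a < c / 4" "b < c / 4" for x a b c :: real
        using that by (simp add: field_simps)
      from this[OF close N N, OF \<open>i \<ge> N\<close> \<open>j \<ge> N\<close>] have "(norm (D i - D j))\<^sup>2 < e\<^sup>2" .
      then show "dist (D i) (D j) < e"
        using e by (simp add: dist_norm power_less_imp_less_base)
    qed
  qed
  then obtain z where z: "D \<longlonglongrightarrow> z"
    using Cauchy_convergent_iff convergent_def by blast
  have eq: "inner z d = g" if dg: "(d, g) \<in> G" for d g
  proof -
    \<comment> \<open>First variation: moving \<open>D n\<close> by \<open>r *\<^sub>R d\<close>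
      cannot push \<open>F\<close> below \<open>m\<close>, and the excess
      \<open>1 / real (Suc n)\<close> disappears in the limit.\<close>
    have *: "0 \<le> 2 * r * (inner z d - g) + r\<^sup>2 * (norm d)\<^sup>2" for r
    proof (rule tendsto_lowerbound)
      have "(\<lambda>n. 2 * r * (inner (D n) d - g) + r\<^sup>2 * (norm d)\<^sup>2)
          \<longlonglongrightarrow> 2 * r * (inner z d - g) + r\<^sup>2 * (norm d)\<^sup>2"
        by (intro tendsto_intros z)
      from tendsto_add[OF this inv0]
      show "((\<lambda>n. 2 * r * (inner (D n) d - g) + r\<^sup>2 * (norm d)\<^sup>2 + 1 / real (Suc n))
          \<longlongrightarrow> 2 * r * (inner z d - g) + r\<^sup>2 * (norm d)\<^sup>2) sequentially"
        by simp
      have "0 \<le> 2 * r * (inner (D n) d - g) + r\<^sup>2 * (norm d)\<^sup>2 + 1 / real (Suc n)" for n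
      proof -
        have "(D n + r *\<^sub>R d, H n + r * g) \<in> G"
          by (intro add scale DH dg)
        then have "m \<le> (norm (D n + r *\<^sub>R d))\<^sup>2 - 2 * (H n + r * g)"
          using m_le[of "(D n + r *\<^sub>R d, H n + r * g)"] by (simp add: F_def)
        also have "(norm (D n + r *\<^sub>R d))\<^sup>2
            = (norm (D n))\<^sup>2 + 2 * r * inner (D n) d + r\<^sup>2 * (norm d)\<^sup>2"
          by (simp only: power2_norm_eq_inner) (simp add: algebra_simps inner_commute power2_eq_square)
        finally show ?thesis
          using FDH[of n] by (simp add: algebra_simps)
      qed
      then show "\<forall>\<^sub>F n in sequentially. 0 \<le> 2 * r * (inner (D n) d - g) + r\<^sup>2 * (norm d)\<^sup>2 + 1 / real (Suc n)"
        by simp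
    qed simp
    show ?thesis
    proof (cases "d = 0")
      case True
      then show ?thesis using bound[OF dg] by simp
    next
      case False
      then have d: "(norm d)\<^sup>2 > 0" by simp
      define t where "t = inner z d - g"
      \<comment> \<open>This \<open>r\<close> minimizes the quadratic polynomial in
        \<open>*\<close>, and even the minimum has to be nonnegative.\<close>
      have "0 \<le> 2 * (- t / (norm d)\<^sup>2) * t + (- t / (norm d)\<^sup>2)\<^sup>2 * (norm d)\<^sup>2"
        using *[of "- t / (norm d)\<^sup>2"] by (simp add: t_def)
      also have "\<dots> = - (t\<^sup>2 / (norm d)\<^sup>2)"
        using d by (simp add: power2_eq_square field_simps)
      finally have "t\<^sup>2 \<le> 0"
        using d by (simp add: zero_le_divide_iff divide_le_0_iff)
      then show ?thesis by (simp add: t_def)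
    qed
  qed
  \<comment> \<open>The bound along \<open>D n\<close> passes to the limit as
    \<open>inner z z \<le> C * norm z\<close>; the alternative \<open>z = 0\<close> accounts for
    negative \<open>C\<close>.\<close>
  have "norm z \<le> C \<or> z = 0"
  proof -
    have "inner z (D n) \<le> C * norm (D n)" for n
      using eq[OF DH[of n]] bound[OF DH[of n]] by auto
    then have "inner z z \<le> C * norm z"
      by (intro tendsto_le[OF _ tendsto_mult_left[OF tendsto_norm[OF z]] tendsto_inner[OF tendsto_const z]])
        auto
    then show ?thesis
      by (cases "z = 0") (auto simp: power2_norm_eq_inner[symmetric] power2_eq_square)
  qed
  moreover have "inner y z = 0" if "\<And>d g. (d, g) \<in> G \<Longrightarrow> inner y d = 0" for y
  proof -
    have "(\<lambda>n. inner y (D n)) \<longlonglongrightarrow> inner y z"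
      by (intro tendsto_intros z)
    moreover have "inner y (D n) = 0" for n
      using that[OF DH] .
    ultimately show ?thesis
      by (simp add: LIMSEQ_const_iff)
  qed
  ultimately show ?thesis
    using eq by blast
qed


section \<open>Bounded operators\<close>

lemma cblinfun_bounded_linear [simp]: "bounded_linear (cblinfun_apply a)"
  using cblinfun_apply[of a] by simp

lemma cblinfun_apply_scaleC: "a *\<^sub>V (c *\<^sub>C x) = c *\<^sub>C (a *\<^sub>V x)"
  using cblinfun_apply[of a] by simp

lemma cblinfun_apply_add: "a *\<^sub>V (x + y) = a *\<^sub>V x + a *\<^sub>V y"
  by (simp add: bounded_linear.linear linear_add)

lemma cblinfun_apply_zero [simp]: "a *\<^sub>V 0 = 0"
  by (simp add: bounded_linear.linear linear_0)

lemma cblinfun_eqI: "(\<And>x. a *\<^sub>V x = b *\<^sub>V x) \<Longrightarrow> a = b"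
  by (metis cblinfun_apply_inject ext)

lemma cblinfun_eqI_cinner: "(\<And>x y. cinner y (a *\<^sub>V x) = cinner y (b *\<^sub>V x)) \<Longrightarrow> a = b"
  by (rule cblinfun_eqI, rule cinner_right_eqI)

lemma cblinfun_bound:
  obtains K where "K > 0" "\<And>x. norm (a *\<^sub>V x) \<le> K * norm x"
  using bounded_linear.pos_bounded[OF cblinfun_bounded_linear[of a]] by (metis mult.commute)

lemma cblinfun_exists:
  fixes f :: "'a::chilbert_space \<Rightarrow> 'b::chilbert_space"
  assumes "\<And>x y. f (x + y) = f x + f y" "\<And>c x. f (c *\<^sub>C x) = c *\<^sub>C f x"
    "\<And>x. norm (f x) \<le> K * norm x"
  shows "\<exists>a. \<forall>x. a *\<^sub>V x = f x"
proof -
  have "bounded_linear f"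
    using assms by (intro bounded_linear_intro[where K = K]) (auto simp: scaleR_scaleC mult.commute)
  then have "Cblinfun f *\<^sub>V x = f x" for x
    using assms by (subst Cblinfun_inverse) auto
  then show ?thesis
    by blast
qed

lemma cblinfun_apply_simps [simp]:
  "0 *\<^sub>V x = 0" "(a + b) *\<^sub>V x = a *\<^sub>V x + b *\<^sub>V x" "(a - b) *\<^sub>V x = a *\<^sub>V x - b *\<^sub>V x"
  "(- a) *\<^sub>V x = - (a *\<^sub>V x)" "cblinfun_scale c a *\<^sub>V x = c *\<^sub>C (a *\<^sub>V x)"
  "cblinfun_id *\<^sub>V x = x" "(a' o\<^sub>C a) *\<^sub>V x = a' *\<^sub>V (a *\<^sub>V x)"
  by (transfer; simp)+

lemma cblinfun_sum_apply: "(\<Sum>i\<in>F. a i) *\<^sub>V x = (\<Sum>i\<in>F. a i *\<^sub>V x)"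
  by (induction F rule: infinite_finite_induct) simp_all

lemma cblinfun_compose_assoc: "a o\<^sub>C b o\<^sub>C c = a o\<^sub>C (b o\<^sub>C c)"
  by (rule cblinfun_eqI) simp

lemma cblinfun_compose_id [simp]: "cblinfun_id o\<^sub>C a = a" "a o\<^sub>C cblinfun_id = a"
  by (rule cblinfun_eqI, simp)+

section \<open>Adjoints of bounded graphs\<close>

text \<open>
  The condition on the range of \<open>Q\<close> says that it lies in the closure of the domain of \<open>G\<close>; this makes
  \<open>Q\<close> unique, and being a linear condition it needs no closure argument.
\<close>

lemma adjoint_of_graph:
  fixes G :: "('a::chilbert_space \<times> 'b::chilbert_space) set"
  assumes zero: "(0, 0) \<in> G"
    and add: "\<And>v w v' w'. (v, w) \<in> G \<Longrightarrow> (v', w') \<in> G \<Longrightarrow> (v + v', w + w') \<in> G"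
    and scale: "\<And>c v w. (v, w) \<in> G \<Longrightarrow> (c *\<^sub>C v, c *\<^sub>C w) \<in> G"
    and bound: "\<And>v w. (v, w) \<in> G \<Longrightarrow> norm w \<le> C * norm v"
  obtains Q :: "('b, 'a) cblinfun" where
    "\<And>\<zeta> v w. (v, w) \<in> G \<Longrightarrow> cinner (Q *\<^sub>V \<zeta>) v = cinner \<zeta> w"
    "\<And>\<zeta> y. (\<And>v w. (v, w) \<in> G \<Longrightarrow> cinner y v = 0) \<Longrightarrow> cinner y (Q *\<^sub>V \<zeta>) = 0"
proof -
  \<comment> \<open>With a nonnegative constant, the alternative \<open>z = 0\<close> in
    \<open>riesz_graph\<close> satisfies the norm bound as well.\<close>
  define C' where "C' = max C 0"
  have bound': "norm w \<le> C' * norm v" if "(v, w) \<in> G" for v w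
    using bound[OF that] mult_right_mono[of C C' "norm v"] by (simp add: C'_def)
  define P where "P \<zeta> z \<longleftrightarrow> (\<forall>v w. (v, w) \<in> G \<longrightarrow> cinner z v = cinner \<zeta> w) \<and>
    (\<forall>y. (\<forall>v w. (v, w) \<in> G \<longrightarrow> cinner y v = 0) \<longrightarrow> cinner y z = 0)" for \<zeta> z
  have PI: "P \<zeta> z" if "\<And>v w. (v, w) \<in> G \<Longrightarrow> cinner z v = cinner \<zeta> w"
    "\<And>y. (\<And>v w. (v, w) \<in> G \<Longrightarrow> cinner y v = 0) \<Longrightarrow> cinner y z = 0" for \<zeta> z
    using that unfolding P_def by blast
  have PD: "cinner z v = cinner \<zeta> w" if "P \<zeta> z" "(v, w) \<in> G" for \<zeta> z v w
    using that unfolding P_def by blast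
  have PO: "cinner y z = 0" if "P \<zeta> z" "\<And>v w. (v, w) \<in> G \<Longrightarrow> cinner y v = 0" for \<zeta> z y
    using that unfolding P_def by blast
  have ex: "\<exists>z. P \<zeta> z \<and> norm z \<le> C' * norm \<zeta>" for \<zeta>
  proof -
    \<comment> \<open>The real part of the functional to be represented, as a graph; the imaginary
      part is recovered by scaling with \<open>\<i>\<close>.\<close>
    define R where "R = (\<lambda>(v, w). (v, inner \<zeta> w)) ` G"
    have RI: "(v, inner \<zeta> w) \<in> R" if "(v, w) \<in> G" for v w
      using that by (force simp: R_def)
    have "subspace R"
    proof (rule subspaceI)
      show "0 \<in> R"
        using RI[OF zero] by (simp add: zero_prod_def)
      show "x + y \<in> R" if "x \<in> R" "y \<in> R" for x y
      proof -
        from that obtain v w v' w' where vw: "(v, w) \<in> G" "x = (v, inner \<zeta> w)"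
          and vw': "(v', w') \<in> G" "y = (v', inner \<zeta> w')"
          by (auto simp: R_def)
        from RI[OF add[OF vw(1) vw'(1)]] show ?thesis
          by (simp add: vw vw' inner_add_right)
      qed
      show "r *\<^sub>R x \<in> R" if "x \<in> R" for r x
      proof -
        from that obtain v w where vw: "(v, w) \<in> G" "x = (v, inner \<zeta> w)"
          by (auto simp: R_def)
        have "(r *\<^sub>R v, r *\<^sub>R w) \<in> G"
          using scale[OF vw(1), of "complex_of_real r"] by (simp add: scaleR_scaleC)
        from RI[OF this] show ?thesis
          by (simp add: vw)
      qed
    qed
    moreover have "\<bar>g\<bar> \<le> (C' * norm \<zeta>) * norm d" if "(d, g) \<in> R" for d g
    proof -
      from that obtain w where w: "(d, w) \<in> G" "g = inner \<zeta> w"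
        by (auto simp: R_def)
      have "\<bar>g\<bar> \<le> norm \<zeta> * norm w"
        by (simp add: w Cauchy_Schwarz_ineq2)
      also have "\<dots> \<le> norm \<zeta> * (C' * norm d)"
        by (intro mult_left_mono bound' w) simp
      finally show ?thesis by (simp add: mult_ac)
    qed
    ultimately obtain z where z: "\<And>d g. (d, g) \<in> R \<Longrightarrow> inner z d = g"
      "norm z \<le> C' * norm \<zeta> \<or> z = 0"
      "\<And>y. (\<And>d g. (d, g) \<in> R \<Longrightarrow> inner y d = 0) \<Longrightarrow> inner y z = 0"
      using riesz_graph[of R "C' * norm \<zeta>"] by blast
    have "cinner z v = cinner \<zeta> w" if vw: "(v, w) \<in> G" for v w
    proof (rule complex_eqI)
      show "Re (cinner z v) = Re (cinner \<zeta> w)"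
        using z(1)[OF RI[OF vw]] by (simp add: inner_eq_Re_cinner)
      show "Im (cinner z v) = Im (cinner \<zeta> w)"
        using z(1)[OF RI[OF scale[OF vw, of \<i>]]]
        by (simp add: inner_eq_Re_cinner cinner_scaleC_right)
    qed
    moreover have "cinner y z = 0" if y: "\<And>v w. (v, w) \<in> G \<Longrightarrow> cinner y v = 0" for y
    proof (rule complex_eqI)
      show "Re (cinner y z) = Re 0"
        using z(3)[of y] y by (fastforce simp: inner_eq_Re_cinner R_def)
      show "Im (cinner y z) = Im 0"
        using z(3)[of "\<i> *\<^sub>C y"] y
        by (fastforce simp: inner_eq_Re_cinner R_def cinner_scaleC_left)
    qed
    moreover have "norm z \<le> C' * norm \<zeta>"
      using z(2) by (auto simp: C'_def)
    ultimately show ?thesis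
      unfolding P_def by blast
  qed
  then obtain q where q: "\<And>\<zeta>. P \<zeta> (q \<zeta>)" and q_bound: "\<And>\<zeta>. norm (q \<zeta>) \<le> C' * norm \<zeta>"
    by metis
  \<comment> \<open>The difference of two solutions is orthogonal to the domain of \<open>G\<close>,
    hence by the range condition to both solutions and so to itself. Linearity of \<open>q\<close>
    follows from this uniqueness.\<close>
  have uniq: "z = z'" if "P \<zeta> z" "P \<zeta> z'" for \<zeta> z z'
  proof -
    have "cinner (z - z') v = 0" if "(v, w) \<in> G" for v w
      using PD[OF \<open>P \<zeta> z\<close> that] PD[OF \<open>P \<zeta> z'\<close> that] by (simp add: cinner.diff_left)
    then have "cinner (z - z') z = 0" "cinner (z - z') z' = 0"
      using PO \<open>P \<zeta> z\<close> \<open>P \<zeta> z'\<close> by blast+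
    then have "cinner (z - z') (z - z') = 0"
      by (simp add: cinner.diff_right)
    then show ?thesis
      by (simp add: cinner_self)
  qed
  have "P (\<zeta> + \<zeta>') (q \<zeta> + q \<zeta>')" for \<zeta> \<zeta>'
    by (rule PI) (simp_all add: cinner_add_left cinner_add_right PD[OF q] PO[OF q])
  then have q_add: "q (\<zeta> + \<zeta>') = q \<zeta> + q \<zeta>'" for \<zeta> \<zeta>'
    using uniq q by blast
  have "P (c *\<^sub>C \<zeta>) (c *\<^sub>C q \<zeta>)" for c \<zeta>
    by (rule PI) (simp_all add: cinner_scaleC_left cinner_scaleC_right PD[OF q] PO[OF q])
  then have q_scale: "q (c *\<^sub>C \<zeta>) = c *\<^sub>C q \<zeta>" for c \<zeta>
    using uniq q by blast
  obtain Q where Q: "\<And>\<zeta>. Q *\<^sub>V \<zeta> = q \<zeta>"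
    using cblinfun_exists[OF q_add q_scale q_bound] by blast
  show ?thesis
    using that[of Q] PD[OF q] PO[OF q] unfolding Q by blast
qed

lemma cadjoint_exists:
  fixes a :: "('a::chilbert_space, 'b::chilbert_space) cblinfun"
  shows "\<exists>b. \<forall>x y. cinner (b *\<^sub>V y) x = cinner y (a *\<^sub>V x)"
proof -
  obtain K where K: "\<And>x. norm (a *\<^sub>V x) \<le> K * norm x"
    using cblinfun_bound by blast
  obtain Q where "\<And>\<zeta> v w. (v, w) \<in> range (\<lambda>x. (x, a *\<^sub>V x)) \<Longrightarrow> cinner (Q *\<^sub>V \<zeta>) v = cinner \<zeta> w"
  proof (rule adjoint_of_graph)
    show "(0, 0) \<in> range (\<lambda>x. (x, a *\<^sub>V x))"
      by (auto intro: image_eqI[of _ _ 0])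
  qed (use K in \<open>auto simp: cblinfun_apply_add cblinfun_apply_scaleC\<close>)
  then show ?thesis
    by blast
qed

lemma cinner_cadjoint_left: "cinner (cadjoint a *\<^sub>V y) x = cinner y (a *\<^sub>V x)"
proof -
  obtain c where c: "\<forall>x y. cinner (c *\<^sub>V y) x = cinner y (a *\<^sub>V x)"
    using cadjoint_exists by blast
  have "b = c" if "\<forall>x y. cinner (b *\<^sub>V y) x = cinner y (a *\<^sub>V x)" for b
    by (rule cblinfun_eqI, rule cinner_left_eqI) (simp only: that c)
  then have "cadjoint a = c"
    unfolding cadjoint_def using c by (intro the_equality)
  then show ?thesis
    using c by simp
qed

lemma cinner_cadjoint_right: "cinner x (cadjoint a *\<^sub>V y) = cinner (a *\<^sub>V x) y"
  by (metis cinner_cadjoint_left cinner_commute)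

lemma cadjoint_eqI: "(\<And>x y. cinner (b *\<^sub>V y) x = cinner y (a *\<^sub>V x)) \<Longrightarrow> cadjoint a = b"
  by (rule cblinfun_eqI, rule cinner_left_eqI) (simp add: cinner_cadjoint_left)

lemma cadjoint_cadjoint [simp]: "cadjoint (cadjoint a) = a"
  by (rule cadjoint_eqI) (simp add: cinner_cadjoint_right)

lemma cadjoint_compose: "cadjoint (a o\<^sub>C b) = cadjoint b o\<^sub>C cadjoint a"
  by (rule cadjoint_eqI) (simp add: cinner_cadjoint_left)

lemma cadjoint_zero [simp]: "cadjoint 0 = 0"
  by (rule cadjoint_eqI) (simp add: cinner.zero_left cinner.zero_right)


section \<open>The predual and the weak* topology\<close>

definition predual_form :: "(nat \<Rightarrow> 'a::chilbert_space) \<Rightarrow> (nat \<Rightarrow> 'a) \<Rightarrow> 'a cbop \<Rightarrow> complex" where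
  "predual_form \<xi> \<eta> a = (\<Sum>n. cinner (\<xi> n) (a *\<^sub>V \<eta> n))"

definition square_summable :: "(nat \<Rightarrow> 'a::chilbert_space) \<Rightarrow> bool" where
  "square_summable \<xi> \<longleftrightarrow> summable (\<lambda>n. (norm (\<xi> n))\<^sup>2)"

lemma predual_functionals_iff:
  "\<phi> \<in> predual_functionals \<longleftrightarrow>
    (\<exists>\<xi> \<eta>. square_summable \<xi> \<and> square_summable \<eta> \<and> \<phi> = predual_form \<xi> \<eta>)"
  by (auto simp: predual_functionals_def square_summable_def predual_form_def fun_eq_iff)

lemma square_summable_apply:
  assumes "square_summable \<xi>"
  shows "square_summable (\<lambda>n. a *\<^sub>V \<xi> n)"
proof -
  obtain K where K: "\<And>x. norm (a *\<^sub>V x) \<le> K * norm x"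
    using cblinfun_bound by blast
  have "summable (\<lambda>n. K\<^sup>2 * (norm (\<xi> n))\<^sup>2)"
    using assms by (intro summable_mult) (simp add: square_summable_def)
  then show ?thesis
    unfolding square_summable_def
  proof (rule summable_comparison_test'[where N = 0])
    show "norm ((norm (a *\<^sub>V \<xi> n))\<^sup>2) \<le> K\<^sup>2 * (norm (\<xi> n))\<^sup>2" for n
      using power_mono[OF K[of "\<xi> n"], of 2] by (simp add: power_mult_distrib)
  qed
qed

lemma square_summable_scaleC:
  assumes "square_summable \<xi>"
  shows "square_summable (\<lambda>n. c *\<^sub>C \<xi> n)"
  using square_summable_apply[OF assms, of "cblinfun_scale c cblinfun_id"] by simp

lemma square_summable_norm_mult:
  assumes "square_summable \<xi>" "square_summable \<eta>"
  shows "summable (\<lambda>n. norm (\<xi> n) * norm (\<eta> n))"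
proof (rule summable_comparison_test'[where N = 0])
  show "summable (\<lambda>n. (norm (\<xi> n))\<^sup>2 + (norm (\<eta> n))\<^sup>2)"
    using assms by (intro summable_add) (simp_all add: square_summable_def)
  show "norm (norm (\<xi> n) * norm (\<eta> n)) \<le> (norm (\<xi> n))\<^sup>2 + (norm (\<eta> n))\<^sup>2" for n
  proof -
    have "2 * (norm (\<xi> n) * norm (\<eta> n)) \<le> (norm (\<xi> n))\<^sup>2 + (norm (\<eta> n))\<^sup>2"
      using sum_squares_bound[of "norm (\<xi> n)" "norm (\<eta> n)"] by simp
    then show ?thesis by (simp add: abs_mult) (smt (verit) mult_nonneg_nonneg norm_ge_zero)
  qed
qed

lemma predual_form_abs_summable:
  assumes "square_summable \<xi>" "square_summable \<eta>"
  shows "summable (\<lambda>n. cmod (cinner (\<xi> n) (a *\<^sub>V \<eta> n)))"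
  by (rule summable_comparison_test'[where N = 0,
        OF square_summable_norm_mult[OF assms(1) square_summable_apply[OF assms(2), of a]]])
    (simp add: cmod_cinner_le)

lemmas predual_form_summable = summable_norm_cancel[OF predual_form_abs_summable]

lemma predual_add: "\<phi> \<in> predual_functionals \<Longrightarrow> \<phi> (a + b) = \<phi> a + \<phi> b"
  by (auto simp: predual_functionals_iff predual_form_def cinner_add_right
      suminf_add predual_form_summable)

lemma predual_scale: "\<phi> \<in> predual_functionals \<Longrightarrow> \<phi> (cblinfun_scale c a) = c * \<phi> a"
  by (auto simp: predual_functionals_iff predual_form_def cinner_scaleC_right
      suminf_mult predual_form_summable)

lemma predual_zero: "\<phi> \<in> predual_functionals \<Longrightarrow> \<phi> 0 = 0"
  using predual_add[of \<phi> 0 0] by simp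

lemma predual_minus: "\<phi> \<in> predual_functionals \<Longrightarrow> \<phi> (a - b) = \<phi> a - \<phi> b"
  using predual_add[of \<phi> "a - b" b] by simp

lemma predual_sum: "\<phi> \<in> predual_functionals \<Longrightarrow> \<phi> (\<Sum>i\<in>F. a i) = (\<Sum>i\<in>F. \<phi> (a i))"
  by (induction F rule: infinite_finite_induct) (simp_all add: predual_zero predual_add)

text \<open>Dual form of the separate weak* continuity of multiplication; \<open>c\<close> and
  \<open>d\<close> may lead to a different space.\<close>

lemma predual_compose:
  assumes "\<phi> \<in> predual_functionals"
  shows "(\<lambda>a. \<phi> (c o\<^sub>C a o\<^sub>C d)) \<in> predual_functionals"
proof -
  obtain \<xi> \<eta> where *: "square_summable \<xi>" "square_summable \<eta>" "\<phi> = predual_form \<xi> \<eta>"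
    using assms by (auto simp: predual_functionals_iff)
  then have "(\<lambda>a. \<phi> (c o\<^sub>C a o\<^sub>C d)) = predual_form (\<lambda>n. cadjoint c *\<^sub>V \<xi> n) (\<lambda>n. d *\<^sub>V \<eta> n)"
    by (simp add: predual_form_def fun_eq_iff cinner_cadjoint_left)
  then show ?thesis
    using * square_summable_apply by (auto simp: predual_functionals_iff)
qed

text \<open>Passing to adjoints exchanges the two sequences. It transfers statements about right
  factors to left factors.\<close>

lemma predual_cnj_cadjoint:
  assumes "\<phi> \<in> predual_functionals"
  shows "(\<lambda>a. cnj (\<phi> (cadjoint a))) \<in> predual_functionals"
proof -
  obtain \<xi> \<eta> where *: "square_summable \<xi>" "square_summable \<eta>" "\<phi> = predual_form \<xi> \<eta>"
    using assms by (auto simp: predual_functionals_iff)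
  have "cnj (\<phi> (cadjoint a)) = predual_form \<eta> \<xi> a" for a
  proof -
    have "(\<lambda>n. cinner (\<xi> n) (cadjoint a *\<^sub>V \<eta> n)) sums \<phi> (cadjoint a)"
      using predual_form_summable[OF *(1,2)] by (simp add: *(3) predual_form_def summable_sums)
    then have "(\<lambda>n. cnj (cinner (\<xi> n) (cadjoint a *\<^sub>V \<eta> n))) sums cnj (\<phi> (cadjoint a))"
      by (simp only: sums_cnj)
    moreover have "cnj (cinner (\<xi> n) (cadjoint a *\<^sub>V \<eta> n)) = cinner (\<eta> n) (a *\<^sub>V \<xi> n)" for n
      by (simp add: cinner_cadjoint_left flip: cinner_commute)
    ultimately show ?thesis
      by (simp add: predual_form_def sums_unique)
  qed
  then show ?thesis
    using * by (auto simp: predual_functionals_iff fun_eq_iff)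
qed

lemma vector_functional_predual: "(\<lambda>a. cinner \<xi> (a *\<^sub>V \<eta>)) \<in> predual_functionals"
proof -
  have "(\<lambda>a. cinner \<xi> (a *\<^sub>V \<eta>)) =
    predual_form (\<lambda>n. if n = 0 then \<xi> else 0) (\<lambda>n. if n = 0 then \<eta> else 0)"
  proof
    fix a :: "'a cbop"
    have "predual_form (\<lambda>n. if n = 0 then \<xi> else 0) (\<lambda>n. if n = 0 then \<eta> else 0) a =
      (\<Sum>n\<in>{0::nat}. cinner (if n = 0 then \<xi> else 0) (a *\<^sub>V (if n = 0 then \<eta> else 0)))"
      unfolding predual_form_def by (intro suminf_finite) (simp_all add: cinner.zero_left)
    then show "cinner \<xi> (a *\<^sub>V \<eta>) =
        predual_form (\<lambda>n. if n = 0 then \<xi> else 0) (\<lambda>n. if n = 0 then \<eta> else 0) a"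
      by simp
  qed
  moreover have "square_summable (\<lambda>n. if n = 0 then \<xi> else 0)" for \<xi> :: 'a
  proof -
    have "summable (\<lambda>n::nat. (norm (if n = 0 then \<xi> else 0))\<^sup>2)"
      by (rule summable_finite[of "{0}"]) auto
    then show ?thesis
      by (simp add: square_summable_def)
  qed
  ultimately show ?thesis
    by (auto simp: predual_functionals_iff)
qed

text \<open>A sum of two predual functionals has to be given by a single pair of sequences; in it
  the terms of the two series alternate.\<close>

definition interleave :: "(nat \<Rightarrow> 'a) \<Rightarrow> (nat \<Rightarrow> 'a) \<Rightarrow> nat \<Rightarrow> 'a" where
  "interleave f g n = (if even n then f (n div 2) else g (n div 2))"

lemma sums_interleave:
  fixes f g :: "nat \<Rightarrow> 'a::banach"
  assumes "summable (\<lambda>n. norm (f n))" "summable (\<lambda>n. norm (g n))"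
  shows "interleave f g sums (suminf f + suminf g)"
proof -
  \<comment> \<open>Absolute convergence makes both sums unconditional, so they can be placed on the
    even and on the odd indices.\<close>
  have f: "(f has_sum suminf f) UNIV" and g: "(g has_sum suminf g) UNIV"
    using assms by (simp_all add: norm_summable_imp_has_sum summable_norm_cancel summable_sums)
  have inj: "inj (\<lambda>n::nat. 2 * n)" "inj (\<lambda>n::nat. 2 * n + 1)"
    by (auto simp: inj_on_def)
  have "(interleave f g has_sum suminf f) (range (\<lambda>n::nat. 2 * n))"
    using f by (subst has_sum_reindex[OF inj(1)]) (simp add: o_def interleave_def)
  moreover have "(interleave f g has_sum suminf g) (range (\<lambda>n::nat. 2 * n + 1))"
    using g by (subst has_sum_reindex[OF inj(2)]) (simp add: o_def interleave_def)
  moreover have "range (\<lambda>n::nat. 2 * n) = {n. even n}"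
    by (auto elim: evenE)
  moreover have "range (\<lambda>n::nat. 2 * n + 1) = {n. odd n}"
    by (auto elim: oddE)
  moreover have "{n::nat. even n} \<inter> {n. odd n} = {}" "{n::nat. even n} \<union> {n. odd n} = UNIV"
    by auto
  ultimately have "(interleave f g has_sum (suminf f + suminf g)) UNIV"
    using has_sum_Un_disjoint by metis
  then show ?thesis
    by (rule has_sum_imp_sums)
qed

lemma square_summable_interleave:
  assumes "square_summable \<xi>" "square_summable \<eta>"
  shows "square_summable (interleave \<xi> \<eta>)"
proof -
  have "(\<lambda>n. (norm (interleave \<xi> \<eta> n))\<^sup>2)
      = interleave (\<lambda>n. (norm (\<xi> n))\<^sup>2) (\<lambda>n. (norm (\<eta> n))\<^sup>2)"
    by (auto simp: interleave_def)
  then show ?thesis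
    using assms unfolding square_summable_def
    by (simp add: sums_summable[OF sums_interleave])
qed

text \<open>The scalar is absorbed into the second sequence before interleaving. This combination
  eliminates one functional in \<open>finite_interpolation\<close>.\<close>

lemma predual_diff_scale:
  assumes "\<phi> \<in> predual_functionals" "\<psi> \<in> predual_functionals"
  shows "(\<lambda>a. \<phi> a - c * \<psi> a) \<in> predual_functionals"
proof -
  obtain \<xi> \<eta> where 1: "square_summable \<xi>" "square_summable \<eta>" "\<phi> = predual_form \<xi> \<eta>"
    using assms by (auto simp: predual_functionals_iff)
  obtain \<xi>' \<eta>' where 2: "square_summable \<xi>'" "square_summable \<eta>'" "\<psi> = predual_form \<xi>' \<eta>'"
    using assms by (auto simp: predual_functionals_iff)
  have 3: "square_summable (\<lambda>n. (- c) *\<^sub>C \<eta>' n)"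
    by (rule square_summable_scaleC[OF 2(2)])
  have "\<phi> a - c * \<psi> a = predual_form (interleave \<xi> \<xi>') (interleave \<eta> (\<lambda>n. (- c) *\<^sub>C \<eta>' n)) a" for a
  proof -
    have "(\<lambda>n. - c * cinner (\<xi>' n) (a *\<^sub>V \<eta>' n)) sums (- c * \<psi> a)"
      unfolding 2(3) predual_form_def
      by (intro sums_mult summable_sums predual_form_summable 2)
    then have "- c * \<psi> a = (\<Sum>n. cinner (\<xi>' n) (a *\<^sub>V ((- c) *\<^sub>C \<eta>' n)))"
      by (simp only: cblinfun_apply_scaleC cinner_scaleC_right sums_unique)
    moreover have "\<phi> a = (\<Sum>n. cinner (\<xi> n) (a *\<^sub>V \<eta> n))"
      by (simp add: 1(3) predual_form_def)
    ultimately have "interleave (\<lambda>n. cinner (\<xi> n) (a *\<^sub>V \<eta> n))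
        (\<lambda>n. cinner (\<xi>' n) (a *\<^sub>V ((- c) *\<^sub>C \<eta>' n))) sums (\<phi> a + - c * \<psi> a)"
      using sums_interleave[OF predual_form_abs_summable[OF 1(1,2)]
          predual_form_abs_summable[OF 2(1) 3], of a a] by simp
    moreover have "interleave (\<lambda>n. cinner (\<xi> n) (a *\<^sub>V \<eta> n))
        (\<lambda>n. cinner (\<xi>' n) (a *\<^sub>V ((- c) *\<^sub>C \<eta>' n))) =
      (\<lambda>n. cinner (interleave \<xi> \<xi>' n) (a *\<^sub>V interleave \<eta> (\<lambda>n. (- c) *\<^sub>C \<eta>' n) n))"
      by (auto simp: interleave_def)
    ultimately show ?thesis
      by (simp add: predual_form_def sums_unique)
  qed
  then have "(\<lambda>a. \<phi> a - c * \<psi> a) =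
      predual_form (interleave \<xi> \<xi>') (interleave \<eta> (\<lambda>n. (- c) *\<^sub>C \<eta>' n))"
    by blast
  then show ?thesis
    using square_summable_interleave 1 2 3 by (auto simp: predual_functionals_iff)
qed

text \<open>On bounded families, weak operator convergence implies weak* convergence: the square
  summable sequences supply a summable majorant, and Tannery's theorem exchanges limit and
  series.\<close>

lemma predual_tendsto:
  fixes X :: "'c \<Rightarrow> 'a::chilbert_space cbop"
  assumes \<phi>: "\<phi> \<in> predual_functionals" and F: "F \<noteq> bot"
    and bound: "\<And>i \<xi> \<eta>. cmod (cinner \<xi> (X i *\<^sub>V \<eta>)) \<le> C * (norm \<xi> * norm \<eta>)"
    and lim: "\<And>\<xi> \<eta>. ((\<lambda>i. cinner \<xi> (X i *\<^sub>V \<eta>)) \<longlongrightarrow> cinner \<xi> (a *\<^sub>V \<eta>)) F"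
  shows "((\<lambda>i. \<phi> (X i)) \<longlongrightarrow> \<phi> a) F"
proof -
  obtain \<xi> \<eta> where *: "square_summable \<xi>" "square_summable \<eta>" "\<phi> = predual_form \<xi> \<eta>"
    using \<phi> by (auto simp: predual_functionals_iff)
  show ?thesis
    unfolding *(3) predual_form_def
  proof (rule tannerys_theorem[THEN conjunct2, THEN conjunct2])
    show "summable (\<lambda>n. C * (norm (\<xi> n) * norm (\<eta> n)))"
      by (intro summable_mult square_summable_norm_mult *)
    show "\<forall>\<^sub>F (k, n) in at_top \<times>\<^sub>F F. cmod (cinner (\<xi> k) (X n *\<^sub>V \<eta> k)) \<le> C * (norm (\<xi> k) * norm (\<eta> k))"
      by (rule always_eventually) (use bound in auto)
  qed (use lim F in auto)
qed

section \<open>Weak* neighbourhoods and duality\<close>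

lemma topspace_weakstar [simp]: "topspace weakstar = UNIV"
proof -
  have "(\<lambda>a. cinner 0 (a *\<^sub>V 0)) -` UNIV \<in>
      {\<phi> -` U | \<phi> U. (\<phi> :: 'a cbop \<Rightarrow> complex) \<in> predual_functionals \<and> open U}"
    using vector_functional_predual open_UNIV by blast
  then have "UNIV \<subseteq> \<Union> {\<phi> -` U | \<phi> U. (\<phi> :: 'a cbop \<Rightarrow> complex) \<in> predual_functionals \<and> open U}"
    unfolding vimage_UNIV by (rule Union_upper)
  then show ?thesis
    unfolding weakstar_def topology_generated_by_topspace by (rule top_le[unfolded top_set_def])
qed

lemma openin_weakstar_vimage:
  "\<phi> \<in> predual_functionals \<Longrightarrow> open U \<Longrightarrow> openin weakstar (\<phi> -` U)"
  unfolding weakstar_def by (rule topology_generated_by_Basis) blast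

lemma limitin_weakstar_predual:
  assumes "limitin weakstar f l F" "\<phi> \<in> predual_functionals"
  shows "((\<lambda>x. \<phi> (f x)) \<longlongrightarrow> \<phi> l) F"
proof (rule topological_tendstoI)
  fix U :: "complex set" assume "open U" "\<phi> l \<in> U"
  then show "\<forall>\<^sub>F x in F. \<phi> (f x) \<in> U"
    using assms openin_weakstar_vimage[OF assms(2) \<open>open U\<close>] unfolding limitin_def by auto
qed

lemma closedin_weakstar_kernel:
  assumes "\<phi> \<in> predual_functionals"
  shows "closedin weakstar {a. \<phi> a = 0}"
proof -
  have "{a. \<phi> a = 0} = topspace weakstar - \<phi> -` (- {0})"
    by auto
  moreover have "openin weakstar (\<phi> -` (- {0}))"
    by (rule openin_weakstar_vimage[OF assms]) (simp add: open_Compl)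
  ultimately show ?thesis
    by (metis closedin_diff closedin_topspace)
qed

text \<open>A subbasic open set is a union of level sets of one functional, so a neighbourhood
  contains a common level set of finitely many. Approximation is thereby reduced to exact
  interpolation.\<close>

lemma openin_weakstar_finite:
  assumes "openin weakstar U" "x \<in> U"
  shows "\<exists>\<Phi>. finite \<Phi> \<and> \<Phi> \<subseteq> predual_functionals \<and> (\<forall>y. (\<forall>\<phi>\<in>\<Phi>. \<phi> y = \<phi> x) \<longrightarrow> y \<in> U)"
proof -
  have "generate_topology_on {\<phi> -` U | \<phi> U. \<phi> \<in> predual_functionals \<and> open U} U"
    using assms(1) by (simp add: weakstar_def openin_topology_generated_by_iff)
  then show ?thesis
    using assms(2)
  proof (induction rule: generate_topology_on.induct)
    case (Int A B)
    then have "x \<in> A" "x \<in> B"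
      by auto
    from Int.IH(1)[OF this(1)] Int.IH(2)[OF this(2)] obtain \<Phi> \<Psi>
      where 1: "finite \<Phi>" "\<Phi> \<subseteq> predual_functionals" "\<forall>y. (\<forall>\<phi>\<in>\<Phi>. \<phi> y = \<phi> x) \<longrightarrow> y \<in> A"
        and 2: "finite \<Psi>" "\<Psi> \<subseteq> predual_functionals" "\<forall>y. (\<forall>\<phi>\<in>\<Psi>. \<phi> y = \<phi> x) \<longrightarrow> y \<in> B"
      by (elim exE conjE) blast
    have "\<forall>y. (\<forall>\<phi>\<in>\<Phi> \<union> \<Psi>. \<phi> y = \<phi> x) \<longrightarrow> y \<in> A \<inter> B"
      using 1(3) 2(3) by blast
    with 1(1,2) 2(1,2) show ?case
      by (intro exI[of _ "\<Phi> \<union> \<Psi>"]) simp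
  next
    case (UN K)
    then show ?case
      by (elim UnionE) (meson UnionI)
  next
    case (Basis s)
    then obtain \<phi> V where "s = \<phi> -` V" "\<phi> \<in> predual_functionals"
      by blast
    with Basis(2) show ?case
      by (intro exI[of _ "{\<phi>}"]) simp
  qed simp
qed

text \<open>The algebraic core of the duality, in place of a Hahn-Banach argument: the functionals
  are treated one by one, each time passing to the kernel inside \<open>Y\<close>.\<close>

lemma finite_interpolation:
  assumes "finite \<Phi>" "\<Phi> \<subseteq> predual_functionals" "cblinfun_subspace Y"
    and "\<And>\<phi>. \<phi> \<in> predual_functionals \<Longrightarrow> (\<And>y. y \<in> Y \<Longrightarrow> \<phi> y = 0) \<Longrightarrow> \<phi> x = 0"
  shows "\<exists>y\<in>Y. \<forall>\<phi>\<in>\<Phi>. \<phi> y = \<phi> x"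
  using assms
proof (induction \<Phi> arbitrary: Y x rule: finite_induct)
  case empty
  then show ?case
    using cblinfun.subspace_0 by auto
next
  case (insert \<phi> \<Phi>)
  then have \<phi>: "\<phi> \<in> predual_functionals"
    by auto
  note sub = insert.prems(2)
  show ?case
  proof (cases "\<forall>y\<in>Y. \<phi> y = 0")
    case True
    then have "\<phi> x = 0"
      using insert.prems(3) \<phi> by blast
    moreover have "\<exists>y\<in>Y. \<forall>\<psi>\<in>\<Phi>. \<psi> y = \<psi> x"
      using insert.prems by (intro insert.IH) auto
    ultimately show ?thesis
      using True by auto
  next
    case False
    then obtain y1 where y1: "y1 \<in> Y" "\<phi> y1 \<noteq> 0"
      by auto
    define y0 where "y0 = cblinfun_scale (1 / \<phi> y1) y1"
    have y0: "y0 \<in> Y" "\<phi> y0 = 1"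
      using y1 \<phi> cblinfun.subspace_scale[OF sub] by (simp_all add: y0_def predual_scale)
    \<comment> \<open>A multiple of \<open>y0\<close> adjusts the value of \<open>\<phi>\<close>;
      corrections from \<open>Y'\<close> leave it unchanged and serve the remaining
      functionals.\<close>
    define Y' where "Y' = {y \<in> Y. \<phi> y = 0}"
    have "cblinfun_subspace Y'"
      using sub \<phi> by (auto simp: Y'_def cblinfun.subspace_def predual_zero predual_add predual_scale)
    moreover have "\<psi> (x - cblinfun_scale (\<phi> x) y0) = 0"
      if \<psi>: "\<psi> \<in> predual_functionals" and 0: "\<And>y. y \<in> Y' \<Longrightarrow> \<psi> y = 0" for \<psi>
    proof -
      \<comment> \<open>A functional that kills \<open>Y'\<close> is a multiple of
        \<open>\<phi>\<close> on \<open>Y\<close>, with factor \<open>\<psi> y0\<close>, so the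
        assumption on \<open>x\<close> applies to the difference.\<close>
      have "\<psi> x - \<psi> y0 * \<phi> x = 0"
      proof (rule insert.prems(3)[OF predual_diff_scale[OF \<psi> \<phi>, of "\<psi> y0"]])
        fix y assume "y \<in> Y"
        then have "y - cblinfun_scale (\<phi> y) y0 \<in> Y'"
          using y0 sub \<phi> by (auto simp: Y'_def predual_minus predual_scale
              intro!: cblinfun.subspace_diff cblinfun.subspace_scale)
        from 0[OF this] show "\<psi> y - \<psi> y0 * \<phi> y = 0"
          using \<psi> by (simp add: predual_minus predual_scale mult.commute)
      qed
      then show ?thesis
        using \<psi> by (simp add: predual_minus predual_scale mult.commute)
    qed
    ultimately obtain y' where y': "y' \<in> Y'"
      "\<forall>\<psi>\<in>\<Phi>. \<psi> y' = \<psi> (x - cblinfun_scale (\<phi> x) y0)"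
      using insert.IH[of Y' "x - cblinfun_scale (\<phi> x) y0"] insert.prems(1) by blast
    have "y' + cblinfun_scale (\<phi> x) y0 \<in> Y"
      using y' y0 sub by (auto simp: Y'_def intro!: cblinfun.subspace_add cblinfun.subspace_scale)
    moreover have "\<psi> (y' + cblinfun_scale (\<phi> x) y0) = \<psi> x" if "\<psi> \<in> insert \<phi> \<Phi>" for \<psi>
    proof -
      have "\<psi> \<in> predual_functionals"
        using that insert.prems(1) by auto
      then show ?thesis
        using that y' y0 \<phi> by (auto simp: Y'_def predual_add predual_scale predual_minus)
    qed
    ultimately show ?thesis
      by blast
  qed
qed

text \<open>The bipolar theorem for subspaces. From functionals to the closure, a neighbourhood
  imposes only finitely many values, and these are attained in the span.\<close>

lemma weakstar_span_iff:
  "x \<in> weakstar_span G \<longleftrightarrow>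
    (\<forall>\<phi>\<in>predual_functionals. (\<forall>g\<in>G. \<phi> g = 0) \<longrightarrow> \<phi> x = 0)"
proof
  assume x: "x \<in> weakstar_span G"
  show "\<forall>\<phi>\<in>predual_functionals. (\<forall>g\<in>G. \<phi> g = 0) \<longrightarrow> \<phi> x = 0"
  proof (intro ballI impI)
    fix \<phi> :: "'a cbop \<Rightarrow> complex"
    assume \<phi>: "\<phi> \<in> predual_functionals" and 0: "\<forall>g\<in>G. \<phi> g = 0"
    have "cblinfun_subspace {a. \<phi> a = 0}"
      using \<phi> by (auto simp: cblinfun.subspace_def predual_zero predual_add predual_scale)
    then have "cblinfun_span G \<subseteq> {a. \<phi> a = 0}"
      using 0 by (intro cblinfun.span_minimal) auto
    then have "weakstar_span G \<subseteq> {a. \<phi> a = 0}"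
      unfolding weakstar_span_def by (rule closure_of_minimal[OF _ closedin_weakstar_kernel[OF \<phi>]])
    then show "\<phi> x = 0"
      using x by blast
  qed
next
  assume x: "\<forall>\<phi>\<in>predual_functionals. (\<forall>g\<in>G. \<phi> g = 0) \<longrightarrow> \<phi> x = 0"
  show "x \<in> weakstar_span G"
    unfolding weakstar_span_def in_closure_of
  proof (intro conjI allI impI)
    fix U assume "x \<in> U \<and> openin weakstar U"
    then obtain \<Phi> where \<Phi>: "finite \<Phi>" "\<Phi> \<subseteq> predual_functionals"
      "\<And>y. (\<forall>\<phi>\<in>\<Phi>. \<phi> y = \<phi> x) \<Longrightarrow> y \<in> U"
      using openin_weakstar_finite by metis
    have "\<exists>y\<in>cblinfun_span G. \<forall>\<phi>\<in>\<Phi>. \<phi> y = \<phi> x"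
      by (intro finite_interpolation \<Phi> cblinfun.subspace_span) (meson x cblinfun.span_base)
    then show "\<exists>y. y \<in> cblinfun_span G \<and> y \<in> U"
      using \<Phi>(3) by blast
  qed simp
qed

lemma weakstar_span_base: "g \<in> G \<Longrightarrow> g \<in> weakstar_span G"
  by (simp add: weakstar_span_iff)

lemma subspace_weakstar_span: "cblinfun_subspace (weakstar_span G)"
proof (rule cblinfun.subspaceI)
  show "0 \<in> weakstar_span G"
    by (simp add: weakstar_span_iff predual_zero)
next
  fix x y assume "x \<in> weakstar_span G" "y \<in> weakstar_span G"
  then have "\<phi> (x + y) = 0" if "\<phi> \<in> predual_functionals" "\<forall>g\<in>G. \<phi> g = 0" for \<phi>
    using that predual_add[OF that(1), of x y] unfolding weakstar_span_iff
    by (metis add_0)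
  then show "x + y \<in> weakstar_span G"
    unfolding weakstar_span_iff by blast
next
  fix c x assume "x \<in> weakstar_span G"
  then show "cblinfun_scale c x \<in> weakstar_span G"
    by (simp add: weakstar_span_iff predual_scale)
qed

lemma closedin_weakstar_span: "closedin weakstar (weakstar_span G)"
  by (simp add: weakstar_span_def)

lemma weakstar_span_minimal:
  assumes "G \<subseteq> T" "cblinfun_subspace T" "closedin weakstar T"
  shows "weakstar_span G \<subseteq> T"
  unfolding weakstar_span_def
  using assms by (intro closure_of_minimal cblinfun.span_minimal)

lemma weakstar_span_compose:
  assumes "\<And>g. g \<in> G \<Longrightarrow> c o\<^sub>C g o\<^sub>C d \<in> weakstar_span G'" "x \<in> weakstar_span G"
  shows "c o\<^sub>C x o\<^sub>C d \<in> weakstar_span G'"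
  unfolding weakstar_span_iff
proof (intro ballI impI)
  fix \<phi> :: "'b cbop \<Rightarrow> complex"
  assume \<phi>: "\<phi> \<in> predual_functionals" and 0: "\<forall>g\<in>G'. \<phi> g = 0"
  have "\<phi> (c o\<^sub>C g o\<^sub>C d) = 0" if "g \<in> G" for g
    using assms(1)[OF that] \<phi> 0 unfolding weakstar_span_iff by simp
  then show "\<phi> (c o\<^sub>C x o\<^sub>C d) = 0"
    using assms(2)[unfolded weakstar_span_iff, rule_format, OF predual_compose[OF \<phi>]] by simp
qed


section \<open>Square summable families of vectors\<close>

lemma norm_add_square_le: "(norm (x + y))\<^sup>2 \<le> 2 * (norm x)\<^sup>2 + 2 * (norm y)\<^sup>2"
  for x :: "'a::real_inner"
proof -
  have "(norm (x + y))\<^sup>2 + (norm (x - y))\<^sup>2 = 2 * (norm x)\<^sup>2 + 2 * (norm y)\<^sup>2"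
    by (simp add: power2_norm_eq_inner algebra_simps inner_commute)
  moreover have "0 \<le> (norm (x - y))\<^sup>2"
    by simp
  ultimately show ?thesis
    by linarith
qed

text \<open>A model of the Hilbert tensor product of \<open>'h\<close> with the square summable
  scalar families on \<open>'i\<close>. It is indexed by a whole type; a family on a set is padded
  with zeros.\<close>

typedef (overloaded) ('i, 'h) ell2 =
  "{f :: 'i \<Rightarrow> 'h::chilbert_space. (\<lambda>i. (norm (f i))\<^sup>2) summable_on UNIV}"
  morphisms ell2_apply Ell2
  by (rule exI[of _ "\<lambda>_. 0"]) simp

setup_lifting type_definition_ell2

lemma ell2_summable: "(\<lambda>i. (norm (ell2_apply f i))\<^sup>2) summable_on UNIV"
  using ell2_apply[of f] by simp

lemma ell2_eqI: "(\<And>i. ell2_apply f i = ell2_apply g i) \<Longrightarrow> f = g"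
  by (metis ell2_apply_inject ext)

lemma ell2_norm_mult_summable:
  "(\<lambda>i. norm (ell2_apply f i) * norm (ell2_apply g i)) summable_on UNIV"
proof (rule summable_on_comparison_test)
  show "(\<lambda>i. (norm (ell2_apply f i))\<^sup>2 + (norm (ell2_apply g i))\<^sup>2) summable_on UNIV"
    by (intro summable_on_add ell2_summable)
  show "norm (ell2_apply f i) * norm (ell2_apply g i)
      \<le> (norm (ell2_apply f i))\<^sup>2 + (norm (ell2_apply g i))\<^sup>2" for i
  proof -
    have "b \<le> c" if "2 * b \<le> c" "0 \<le> b" for b c :: real
      using that by linarith
    from this[OF sum_squares_bound[folded mult.assoc, unfolded mult.assoc]] show ?thesis
      by simp
  qed
qed simp

lemma ell2_cinner_abs_summable:
  "(\<lambda>i. norm (cinner (ell2_apply f i) (ell2_apply g i))) summable_on UNIV"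
  by (rule Infinite_Sum.abs_summable_on_comparison_test'[OF ell2_norm_mult_summable[of f g]])
    (simp add: cmod_cinner_le)

lemmas ell2_cinner_summable = abs_summable_summable[OF ell2_cinner_abs_summable]

lemma ell2_inner_summable: "(\<lambda>i. inner (ell2_apply f i) (ell2_apply g i)) summable_on UNIV"
  unfolding inner_eq_Re_cinner by (rule summable_on_Re[OF ell2_cinner_summable])

instantiation ell2 :: (type, chilbert_space) real_inner
begin

lift_definition zero_ell2 :: "('a, 'b) ell2" is "\<lambda>_. 0"
  by simp

lift_definition plus_ell2 :: "('a, 'b) ell2 \<Rightarrow> ('a, 'b) ell2 \<Rightarrow> ('a, 'b) ell2"
  is "\<lambda>f g i. f i + g i"
proof -
  fix f g :: "'a \<Rightarrow> 'b"
  assume "(\<lambda>i. (norm (f i))\<^sup>2) summable_on UNIV" "(\<lambda>i. (norm (g i))\<^sup>2) summable_on UNIV"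
  then have "(\<lambda>i. 2 * (norm (f i))\<^sup>2 + 2 * (norm (g i))\<^sup>2) summable_on UNIV"
    by (intro summable_on_add summable_on_cmult_right)
  then show "(\<lambda>i. (norm (f i + g i))\<^sup>2) summable_on UNIV"
    by (rule summable_on_comparison_test) (simp_all add: norm_add_square_le)
qed

lift_definition uminus_ell2 :: "('a, 'b) ell2 \<Rightarrow> ('a, 'b) ell2" is "\<lambda>f i. - f i"
  by simp

lift_definition minus_ell2 :: "('a, 'b) ell2 \<Rightarrow> ('a, 'b) ell2 \<Rightarrow> ('a, 'b) ell2"
  is "\<lambda>f g i. f i - g i"
proof -
  fix f g :: "'a \<Rightarrow> 'b"
  assume "(\<lambda>i. (norm (f i))\<^sup>2) summable_on UNIV" "(\<lambda>i. (norm (g i))\<^sup>2) summable_on UNIV"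
  then have "(\<lambda>i. 2 * (norm (f i))\<^sup>2 + 2 * (norm (- g i))\<^sup>2) summable_on UNIV"
    by (intro summable_on_add summable_on_cmult_right) simp_all
  then show "(\<lambda>i. (norm (f i - g i))\<^sup>2) summable_on UNIV"
  proof (rule summable_on_comparison_test)
    show "(norm (f i - g i))\<^sup>2 \<le> 2 * (norm (f i))\<^sup>2 + 2 * (norm (- g i))\<^sup>2" for i
      using norm_add_square_le[of "f i" "- g i"] by simp
  qed simp
qed

lift_definition scaleR_ell2 :: "real \<Rightarrow> ('a, 'b) ell2 \<Rightarrow> ('a, 'b) ell2" is "\<lambda>r f i. r *\<^sub>R f i"
  by (simp add: power_mult_distrib summable_on_cmult_right)

definition inner_ell2 :: "('a, 'b) ell2 \<Rightarrow> ('a, 'b) ell2 \<Rightarrow> real" where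
  "inner_ell2 f g = (\<Sum>\<^sub>\<infinity>i. inner (ell2_apply f i) (ell2_apply g i))"

definition norm_ell2 :: "('a, 'b) ell2 \<Rightarrow> real" where
  "norm_ell2 f = sqrt (inner f f)"

definition sgn_ell2 :: "('a, 'b) ell2 \<Rightarrow> ('a, 'b) ell2" where
  "sgn_ell2 f = inverse (norm f) *\<^sub>R f"

definition dist_ell2 :: "('a, 'b) ell2 \<Rightarrow> ('a, 'b) ell2 \<Rightarrow> real" where
  "dist_ell2 f g = norm (f - g)"

definition uniformity_ell2 :: "(('a, 'b) ell2 \<times> ('a, 'b) ell2) filter" where
  "uniformity_ell2 = (INF e\<in>{0<..}. principal {(f, g). dist f g < e})"

definition open_ell2 :: "('a, 'b) ell2 set \<Rightarrow> bool" where
  "open_ell2 U \<longleftrightarrow> (\<forall>x\<in>U. \<forall>\<^sub>F (x', y) in uniformity. x' = x \<longrightarrow> y \<in> U)"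

instance
proof
  fix f g h :: "('a, 'b) ell2" and r s :: real
  show "f + g + h = f + (g + h)" "f + g = g + f" "0 + f = f" "- f + f = 0" "f - g = f + - g"
    "r *\<^sub>R (f + g) = r *\<^sub>R f + r *\<^sub>R g" "(r + s) *\<^sub>R f = r *\<^sub>R f + s *\<^sub>R f"
    "r *\<^sub>R s *\<^sub>R f = (r * s) *\<^sub>R f" "1 *\<^sub>R f = f"
    by (transfer; simp add: fun_eq_iff algebra_simps)+
  show "inner f g = inner g f"
    by (simp add: inner_ell2_def inner_commute)
  show "inner (f + g) h = inner f h + inner g h"
    unfolding inner_ell2_def
    by (simp add: plus_ell2.rep_eq inner_add_left infsum_add ell2_inner_summable)
  show "inner (r *\<^sub>R f) g = r * inner f g"
    unfolding inner_ell2_def by (simp add: scaleR_ell2.rep_eq infsum_cmult_right')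
  show "0 \<le> inner f f"
    unfolding inner_ell2_def by (rule infsum_nonneg) simp
  show "inner f f = 0 \<longleftrightarrow> f = 0"
  proof
    assume "inner f f = 0"
    then have "inner (ell2_apply f i) (ell2_apply f i) = 0" for i
      using nonneg_infsum_le_0D[OF _ ell2_inner_summable[of f f], of i] by (simp add: inner_ell2_def)
    then show "f = 0"
      by (intro ell2_eqI) (simp add: zero_ell2.rep_eq)
  qed (simp add: inner_ell2_def zero_ell2.rep_eq)
qed (simp_all add: norm_ell2_def sgn_ell2_def dist_ell2_def uniformity_ell2_def open_ell2_def)

end

lemma ell2_apply_simps [simp]:
  "ell2_apply 0 i = 0" "ell2_apply (f + g) i = ell2_apply f i + ell2_apply g i"
  "ell2_apply (- f) i = - ell2_apply f i" "ell2_apply (f - g) i = ell2_apply f i - ell2_apply g i"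
  by (simp_all add: zero_ell2.rep_eq plus_ell2.rep_eq uminus_ell2.rep_eq minus_ell2.rep_eq)

lemma ell2_norm_square: "(norm f)\<^sup>2 = (\<Sum>\<^sub>\<infinity>i. (norm (ell2_apply f i))\<^sup>2)"
  unfolding power2_norm_eq_inner inner_ell2_def ..

lemma ell2_finite_sum_le:
  assumes "finite F"
  shows "(\<Sum>i\<in>F. (norm (ell2_apply f i))\<^sup>2) \<le> (norm f)\<^sup>2"
  unfolding ell2_norm_square using assms ell2_summable by (intro finite_sum_le_infsum) auto

lemma norm_ell2_apply_le: "norm (ell2_apply f i) \<le> norm f"
  using ell2_finite_sum_le[of "{i}" f] by (simp add: power2_le_iff_abs_le)

lemma ell2_exists:
  fixes f :: "'i \<Rightarrow> 'h::chilbert_space"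
  assumes "\<And>F. finite F \<Longrightarrow> (\<Sum>i\<in>F. (norm (f i))\<^sup>2) \<le> B\<^sup>2" "B \<ge> 0"
  shows "\<exists>g. (\<forall>i. ell2_apply g i = f i) \<and> norm g \<le> B"
proof -
  have sm: "(\<lambda>i. (norm (f i))\<^sup>2) summable_on UNIV"
    using assms by (intro nonneg_bdd_above_summable_on bdd_aboveI[of _ "B\<^sup>2"]) auto
  then have app: "ell2_apply (Ell2 f) i = f i" for i
    by (simp add: Ell2_inverse)
  have "(norm (Ell2 f))\<^sup>2 \<le> B\<^sup>2"
    unfolding ell2_norm_square app using sm assms by (intro infsum_le_finite_sums) auto
  then have "norm (Ell2 f) \<le> B"
    using assms(2) by (rule power2_le_imp_le)
  with app show ?thesis
    by (intro exI[of _ "Ell2 f"]) simp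
qed

instance ell2 :: (type, chilbert_space) complete_space
proof
  fix X :: "nat \<Rightarrow> ('a, 'b) ell2"
  assume X: "Cauchy X"
  have "Cauchy (\<lambda>n. ell2_apply (X n) i)" for i
  proof (rule metric_CauchyI)
    fix e :: real assume "e > 0"
    then obtain N where "\<forall>m\<ge>N. \<forall>n\<ge>N. dist (X m) (X n) < e"
      using X metric_CauchyD by blast
    then show "\<exists>N. \<forall>m\<ge>N. \<forall>n\<ge>N. dist (ell2_apply (X m) i) (ell2_apply (X n) i) < e"
      using norm_ell2_apply_le[of "X m - X n" i for m n]
      by (simp add: dist_norm) (meson le_less_trans)
  qed
  then obtain f where f: "\<And>i. (\<lambda>n. ell2_apply (X n) i) \<longlonglongrightarrow> f i"
    unfolding Cauchy_convergent_iff convergent_def by metis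
  \<comment> \<open>Finite partial sums for \<open>X m - X n\<close> converge as \<open>n\<close>
    grows; the bound left in the limit makes the coordinatewise difference of \<open>X m\<close> and
    \<open>f\<close> square summable.\<close>
  have tail: "(\<Sum>i\<in>F. (norm (ell2_apply (X m) i - f i))\<^sup>2) \<le> e\<^sup>2"
    if N: "\<forall>m\<ge>N. \<forall>n\<ge>N. dist (X m) (X n) < e" and "m \<ge> N" "finite F" for N m e F
  proof (rule tendsto_upperbound)
    show "(\<lambda>n. \<Sum>i\<in>F. (norm (ell2_apply (X m) i - ell2_apply (X n) i))\<^sup>2)
        \<longlonglongrightarrow> (\<Sum>i\<in>F. (norm (ell2_apply (X m) i - f i))\<^sup>2)"
      by (intro tendsto_intros f)
    have "(\<Sum>i\<in>F. (norm (ell2_apply (X m) i - ell2_apply (X n) i))\<^sup>2) \<le> e\<^sup>2" if "n \<ge> N" for n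
    proof -
      have "(norm (X m - X n))\<^sup>2 \<le> e\<^sup>2"
        using N \<open>m \<ge> N\<close> that by (intro power_mono) (auto simp: dist_norm less_imp_le)
      then show ?thesis
        using ell2_finite_sum_le[OF \<open>finite F\<close>, of "X m - X n"] by simp
    qed
    then show "\<forall>\<^sub>F n in sequentially. (\<Sum>i\<in>F. (norm (ell2_apply (X m) i - ell2_apply (X n) i))\<^sup>2) \<le> e\<^sup>2"
      by (auto simp: eventually_sequentially)
  qed simp
  have diff: "\<exists>g. (\<forall>i. ell2_apply g i = ell2_apply (X m) i - f i) \<and> norm g \<le> e"
    if "\<forall>m\<ge>N. \<forall>n\<ge>N. dist (X m) (X n) < e" "m \<ge> N" "e > 0" for N m e
    using ell2_exists[OF tail[OF that(1,2)]] that(3) by simp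
  obtain N0 where "\<forall>m\<ge>N0. \<forall>n\<ge>N0. dist (X m) (X n) < 1"
    using X metric_CauchyD zero_less_one by blast
  \<comment> \<open>Square summability of \<open>f\<close> is not yet known; the limit is reached as
    the difference \<open>X N0 - g0\<close> of two members of the space.\<close>
  from diff[OF this order_refl] obtain g0 where "\<And>i. ell2_apply g0 i = ell2_apply (X N0) i - f i"
    by auto
  then have g: "ell2_apply (X N0 - g0) i = f i" for i
    by simp
  have "X \<longlonglongrightarrow> X N0 - g0"
  proof (rule metric_LIMSEQ_I)
    fix e :: real assume e: "e > 0"
    then obtain N where N: "\<forall>m\<ge>N. \<forall>n\<ge>N. dist (X m) (X n) < e / 2"
      using X metric_CauchyD half_gt_zero by blast
    have "dist (X m) (X N0 - g0) < e" if m: "m \<ge> N" for m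
    proof -
      obtain g' where g': "\<forall>i. ell2_apply g' i = ell2_apply (X m) i - f i" "norm g' \<le> e / 2"
        using diff[OF N m] e by auto
      have "X m - (X N0 - g0) = g'"
        by (rule ell2_eqI) (simp add: g' g[simplified])
      then show ?thesis
        using g' e by (simp add: dist_norm)
    qed
    then show "\<exists>N. \<forall>m\<ge>N. dist (X m) (X N0 - g0) < e"
      by blast
  qed
  then show "convergent X"
    by (auto simp: convergent_def)
qed

instantiation ell2 :: (type, chilbert_space) chilbert_space
begin

lift_definition scaleC_ell2 :: "complex \<Rightarrow> ('a, 'b) ell2 \<Rightarrow> ('a, 'b) ell2" is "\<lambda>c f i. c *\<^sub>C f i"
  by (simp add: norm_scaleC power_mult_distrib summable_on_cmult_right)

definition cinner_ell2 :: "('a, 'b) ell2 \<Rightarrow> ('a, 'b) ell2 \<Rightarrow> complex" where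
  "cinner_ell2 f g = (\<Sum>\<^sub>\<infinity>i. cinner (ell2_apply f i) (ell2_apply g i))"

instance
proof
  fix f g h :: "('a, 'b) ell2" and a b :: complex and r :: real
  show "a *\<^sub>C (f + g) = a *\<^sub>C f + a *\<^sub>C g" "(a + b) *\<^sub>C f = a *\<^sub>C f + b *\<^sub>C f"
    "a *\<^sub>C b *\<^sub>C f = (a * b) *\<^sub>C f" "1 *\<^sub>C f = f" "r *\<^sub>R f = complex_of_real r *\<^sub>C f"
    by (transfer; simp add: scaleC_add_right scaleC_add_left scaleC_scaleC scaleC_one scaleR_scaleC)+
  show "cinner f g = cnj (cinner g f)"
    unfolding cinner_ell2_def infsum_cnj[symmetric]
    by (intro infsum_cong) (rule cinner_commute)
  show "cinner f (g + h) = cinner f g + cinner f h"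
    unfolding cinner_ell2_def by (simp add: cinner_add_right infsum_add ell2_cinner_summable)
  show "cinner f (a *\<^sub>C g) = a * cinner f g"
    unfolding cinner_ell2_def
    by (simp add: scaleC_ell2.rep_eq cinner_scaleC_right infsum_cmult_right')
  show "inner f g = Re (cinner f g)"
    unfolding cinner_ell2_def inner_ell2_def inner_eq_Re_cinner
    by (rule infsum_Re[OF ell2_cinner_summable])
qed

end

lemma ell2_apply_scaleC [simp]: "ell2_apply (c *\<^sub>C f) i = c *\<^sub>C ell2_apply f i"
  by (simp add: scaleC_ell2.rep_eq)

lemma ell2_cinner_has_sum:
  "((\<lambda>i. cinner (ell2_apply f i) (ell2_apply g i)) has_sum cinner f g) UNIV"
  unfolding cinner_ell2_def by (rule has_sum_infsum[OF ell2_cinner_summable])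

lemma ell2_apply_cblinfun:
  obtains p :: "(('i, 'h::chilbert_space) ell2, 'h) cblinfun" where "\<And>f. p *\<^sub>V f = ell2_apply f i"
proof -
  have "norm (ell2_apply f i) \<le> 1 * norm f" for f :: "('i, 'h) ell2"
    by (simp add: norm_ell2_apply_le)
  from cblinfun_exists[of "\<lambda>f :: ('i, 'h) ell2. ell2_apply f i", OF _ _ this]
  obtain p where "\<forall>f :: ('i, 'h) ell2. p *\<^sub>V f = ell2_apply f i"
    by auto
  then show ?thesis
    using that[of p] by simp
qed

text \<open>The amplification \<open>x \<otimes> 1\<close>.\<close>

definition ell2_diag :: "'h::chilbert_space cbop \<Rightarrow> ('i, 'h) ell2 cbop" where
  "ell2_diag x = (SOME X. \<forall>f i. ell2_apply (X *\<^sub>V f) i = x *\<^sub>V ell2_apply f i)"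

lemma ell2_diag_apply [simp]:
  "ell2_apply (ell2_diag x *\<^sub>V (f :: ('i, 'h::chilbert_space) ell2)) i = x *\<^sub>V ell2_apply f i"
proof -
  obtain K where K: "K > 0" "\<And>h. norm (x *\<^sub>V h) \<le> K * norm h"
    using cblinfun_bound[of x] by metis
  have "\<exists>g. (\<forall>i. ell2_apply g i = x *\<^sub>V ell2_apply f i) \<and> norm g \<le> K * norm f"
    for f :: "('i, 'h) ell2"
  proof -
    have "(\<Sum>i\<in>F. (norm (x *\<^sub>V ell2_apply f i))\<^sup>2) \<le> (K * norm f)\<^sup>2" if "finite F" for F
    proof -
      have "(\<Sum>i\<in>F. (norm (x *\<^sub>V ell2_apply f i))\<^sup>2) \<le> (\<Sum>i\<in>F. K\<^sup>2 * (norm (ell2_apply f i))\<^sup>2)"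
      proof (rule sum_mono)
        show "(norm (x *\<^sub>V ell2_apply f i))\<^sup>2 \<le> K\<^sup>2 * (norm (ell2_apply f i))\<^sup>2" for i
          unfolding power_mult_distrib[symmetric] by (intro power_mono K(2) norm_ge_zero)
      qed
      also have "\<dots> \<le> K\<^sup>2 * (norm f)\<^sup>2"
        unfolding sum_distrib_left[symmetric] by (intro mult_left_mono ell2_finite_sum_le that) simp
      finally show ?thesis
        by (simp add: power_mult_distrib)
    qed
    moreover have "K * norm f \<ge> 0"
      using K(1) by simp
    ultimately show ?thesis
      by (rule ell2_exists)
  qed
  then have "\<exists>d :: ('i, 'h) ell2 \<Rightarrow> ('i, 'h) ell2. \<forall>f.
      (\<forall>i. ell2_apply (d f) i = x *\<^sub>V ell2_apply f i) \<and> norm (d f) \<le> K * norm f"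
    by (intro choice allI)
  then obtain d :: "('i, 'h) ell2 \<Rightarrow> ('i, 'h) ell2"
    where d: "\<And>f i. ell2_apply (d f) i = x *\<^sub>V ell2_apply f i" "\<And>f. norm (d f) \<le> K * norm f"
    by auto
  have "d (f + g) = d f + d g" for f g
    by (rule ell2_eqI) (simp add: d cblinfun_apply_add)
  moreover have "d (c *\<^sub>C f) = c *\<^sub>C d f" for f c
    by (rule ell2_eqI) (simp add: d cblinfun_apply_scaleC)
  ultimately have "\<exists>X. \<forall>f. X *\<^sub>V f = d f"
    using d(2) by (rule cblinfun_exists)
  then obtain X where "\<forall>f. X *\<^sub>V f = d f" ..
  then have "\<forall>f i. ell2_apply (X *\<^sub>V f) i = x *\<^sub>V ell2_apply f i"
    using d by simp
  then show ?thesis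
    unfolding ell2_diag_def by (rule someI2) simp
qed


section \<open>Kraus families\<close>

text \<open>The iterated Cauchy-Schwarz argument: \<open>\<gamma> (2 ^ k) / \<gamma> 0\<close> is at least \<open>(\<gamma> 1 / \<gamma> 0) ^ (2 ^ k)\<close>.\<close>

lemma iterated_cauchy_schwarz:
  fixes \<gamma> :: "nat \<Rightarrow> real"
  assumes nonneg: "\<And>m. \<gamma> m \<ge> 0" and square: "\<And>m. (\<gamma> m)\<^sup>2 \<le> \<gamma> 0 * \<gamma> (2 * m)"
    and growth: "\<And>m. \<gamma> m \<le> A * B ^ m" and B: "B > 0"
  shows "\<gamma> 1 \<le> B * \<gamma> 0"
proof (cases "\<gamma> 0 = 0")
  case True
  then have "(\<gamma> 1)\<^sup>2 \<le> 0"
    using square[of 1] by simp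
  then show ?thesis
    using True by simp
next
  case False
  then have pos: "\<gamma> 0 > 0"
    using nonneg[of 0] by simp
  define r where "r = \<gamma> 1 / \<gamma> 0"
  have lower: "\<gamma> 0 * r ^ (2 ^ k) \<le> \<gamma> (2 ^ k)" for k
  proof (induction k)
    case 0
    then show ?case using pos by (simp add: r_def)
  next
    case (Suc k)
    have "0 \<le> \<gamma> 0 * r ^ (2 ^ k)"
      using pos nonneg[of 1] by (simp add: r_def)
    then have "(\<gamma> 0 * r ^ (2 ^ k))\<^sup>2 \<le> (\<gamma> (2 ^ k))\<^sup>2"
      using Suc by (intro power_mono)
    also have "\<dots> \<le> \<gamma> 0 * \<gamma> (2 ^ Suc k)"
      using square[of "2 ^ k"] by simp
    also have "(\<gamma> 0 * r ^ (2 ^ k))\<^sup>2 = \<gamma> 0 * (\<gamma> 0 * r ^ (2 ^ Suc k))"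
      by (simp add: power_mult_distrib power2_eq_square power_add[symmetric] mult_2)
    finally show ?case
      using pos by simp
  qed
  \<comment> \<open>Otherwise \<open>(r / B) ^ (2 ^ n)\<close> would be unbounded, although it never
    exceeds \<open>A / \<gamma> 0\<close>; the size of \<open>A\<close> is irrelevant.\<close>
  have "\<not> r / B > 1"
  proof
    assume "r / B > 1"
    then obtain n where n: "A / \<gamma> 0 < (r / B) ^ n"
      using real_arch_pow by blast
    also have "\<dots> \<le> (r / B) ^ (2 ^ n)"
      using \<open>r / B > 1\<close> by (intro power_increasing) (simp_all add: less_imp_le)
    also have "\<dots> \<le> A / \<gamma> 0"
      using lower[of n] growth[of "2 ^ n"] pos B by (simp add: power_divide field_simps)
    finally show False by simp
  qed
  then show ?thesis
    using pos B by (simp add: r_def field_simps)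
qed

lemma commutant_cadjoint:
  assumes "\<And>x. x \<in> N \<Longrightarrow> cadjoint x \<in> N" "y \<in> commutant N"
  shows "cadjoint y \<in> commutant N"
  unfolding commutant_def mem_Collect_eq
proof
  fix x assume "x \<in> N"
  then have "cadjoint x o\<^sub>C y = y o\<^sub>C cadjoint x"
    using assms unfolding commutant_def by simp
  from arg_cong[OF this, of cadjoint] show "x o\<^sub>C cadjoint y = cadjoint y o\<^sub>C x"
    by (simp add: cadjoint_compose)
qed

lemma sum_mult_le_sqrt_bounds:
  fixes a b :: "'i \<Rightarrow> real"
  assumes "(\<Sum>i\<in>F. (a i)\<^sup>2) \<le> A\<^sup>2" "(\<Sum>i\<in>F. (b i)\<^sup>2) \<le> B\<^sup>2" "A \<ge> 0" "B \<ge> 0"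
  shows "(\<Sum>i\<in>F. a i * b i) \<le> A * B"
proof (rule power2_le_imp_le)
  have "(\<Sum>i\<in>F. a i * b i)\<^sup>2 \<le> (\<Sum>i\<in>F. (a i)\<^sup>2) * (\<Sum>i\<in>F. (b i)\<^sup>2)"
    by (rule Cauchy_Schwarz_ineq_sum)
  also have "\<dots> \<le> A\<^sup>2 * B\<^sup>2"
    using assms by (intro mult_mono) (auto intro: sum_nonneg)
  finally show "(\<Sum>i\<in>F. a i * b i)\<^sup>2 \<le> (A * B)\<^sup>2"
    by (simp add: power_mult_distrib)
qed (use assms in simp)

lemma cinner_ell2_diag_left: "cinner (ell2_diag x *\<^sub>V f) g = cinner f (ell2_diag (cadjoint x) *\<^sub>V g)"
  by (simp add: cinner_ell2_def cinner_cadjoint_right)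

text \<open>
  The Kraus decomposition is only needed in the weak form
  \<open>\<langle>\<xi>, \<theta> x \<eta>\<rangle> = (\<Sum>i. \<langle>b i \<xi>, x (b i \<eta>)\<rangle>)\<close>; a family indexed by a set is extended by \<open>0\<close>.
\<close>

locale kraus_family =
  fixes M :: "'m::chilbert_space cbop set"
    and \<theta> :: "'m cbop \<Rightarrow> 'n::chilbert_space cbop"
    and b :: "'i \<Rightarrow> ('n, 'm) cblinfun"
  assumes M_id: "cblinfun_id \<in> M"
    and M_compose: "x \<in> M \<Longrightarrow> y \<in> M \<Longrightarrow> x o\<^sub>C y \<in> M"
    and M_adjoint: "x \<in> M \<Longrightarrow> cadjoint x \<in> M"
    and kraus: "x \<in> M \<Longrightarrow>
      ((\<lambda>i. cinner (b i *\<^sub>V \<xi>) (x *\<^sub>V b i *\<^sub>V \<eta>)) has_sum cinner \<xi> (\<theta> x *\<^sub>V \<eta>)) UNIV"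
begin

section \<open>The dilation of a Kraus family\<close>

text \<open>At the identity of \<open>M\<close> the squared norms sum to
  \<open>cinner \<xi> (\<theta> cblinfun_id *\<^sub>V \<xi>)\<close>, so \<open>K\<close> is the
  square root of a bound for \<open>\<theta> cblinfun_id\<close>.\<close>

lemma kraus_norm_bound:
  obtains K where "K \<ge> 0" "\<And>F \<xi>. finite F \<Longrightarrow> (\<Sum>i\<in>F. (norm (b i *\<^sub>V \<xi>))\<^sup>2) \<le> (K * norm \<xi>)\<^sup>2"
proof -
  obtain K where K: "K > 0" "\<And>\<xi>. norm (\<theta> cblinfun_id *\<^sub>V \<xi>) \<le> K * norm \<xi>"
    using cblinfun_bound[of "\<theta> cblinfun_id"] by metis
  have "(\<Sum>i\<in>F. (norm (b i *\<^sub>V \<xi>))\<^sup>2) \<le> (sqrt K * norm \<xi>)\<^sup>2" if F: "finite F" for F \<xi>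
  proof -
    have "((\<lambda>i. cinner (b i *\<^sub>V \<xi>) (b i *\<^sub>V \<xi>)) has_sum cinner \<xi> (\<theta> cblinfun_id *\<^sub>V \<xi>)) UNIV"
      using kraus[OF M_id, of \<xi> \<xi>] by simp
    from has_sum_Re[OF this]
    have "((\<lambda>i. (norm (b i *\<^sub>V \<xi>))\<^sup>2) has_sum Re (cinner \<xi> (\<theta> cblinfun_id *\<^sub>V \<xi>))) UNIV"
      by (simp add: cinner_self)
    then have "(\<Sum>i\<in>F. (norm (b i *\<^sub>V \<xi>))\<^sup>2) \<le> Re (cinner \<xi> (\<theta> cblinfun_id *\<^sub>V \<xi>))"
      using F by (rule finite_sum_le_has_sum) auto
    also have "\<dots> \<le> cmod (cinner \<xi> (\<theta> cblinfun_id *\<^sub>V \<xi>))"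
      by (rule complex_Re_le_cmod)
    also have "\<dots> \<le> norm \<xi> * norm (\<theta> cblinfun_id *\<^sub>V \<xi>)"
      by (rule cmod_cinner_le)
    also have "\<dots> \<le> norm \<xi> * (K * norm \<xi>)"
      by (intro mult_left_mono K) simp
    also have "\<dots> = (sqrt K * norm \<xi>)\<^sup>2"
      using K(1) by (simp add: power_mult_distrib power2_eq_square)
    finally show ?thesis .
  qed
  then show ?thesis
    using that[of "sqrt K"] K(1) by simp
qed

definition dilation :: "('n, ('i, 'm) ell2) cblinfun" where
  "dilation = (SOME V. \<forall>\<xi> i. ell2_apply (V *\<^sub>V \<xi>) i = b i *\<^sub>V \<xi>)"

lemma dilation_apply [simp]: "ell2_apply (dilation *\<^sub>V \<xi>) i = b i *\<^sub>V \<xi>"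
proof -
  obtain K where K: "K \<ge> 0"
    "\<And>F \<xi>. finite F \<Longrightarrow> (\<Sum>i\<in>F. (norm (b i *\<^sub>V \<xi>))\<^sup>2) \<le> (K * norm \<xi>)\<^sup>2"
    using kraus_norm_bound by metis
  have "\<exists>v. (\<forall>i. ell2_apply v i = b i *\<^sub>V \<xi>) \<and> norm v \<le> K * norm \<xi>" for \<xi>
    by (rule ell2_exists) (use K in auto)
  then have "\<exists>V :: 'n \<Rightarrow> ('i, 'm) ell2. \<forall>\<xi>.
      (\<forall>i. ell2_apply (V \<xi>) i = b i *\<^sub>V \<xi>) \<and> norm (V \<xi>) \<le> K * norm \<xi>"
    by (intro choice allI)
  then obtain V :: "'n \<Rightarrow> ('i, 'm) ell2"
    where V: "\<And>\<xi> i. ell2_apply (V \<xi>) i = b i *\<^sub>V \<xi>" "\<And>\<xi>. norm (V \<xi>) \<le> K * norm \<xi>"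
    by auto
  have "V (\<xi> + \<eta>) = V \<xi> + V \<eta>" for \<xi> \<eta>
    by (rule ell2_eqI) (simp add: V cblinfun_apply_add)
  moreover have "V (c *\<^sub>C \<xi>) = c *\<^sub>C V \<xi>" for c \<xi>
    by (rule ell2_eqI) (simp add: V cblinfun_apply_scaleC)
  ultimately have "\<exists>W. \<forall>\<xi>. W *\<^sub>V \<xi> = V \<xi>"
    using V(2) by (rule cblinfun_exists)
  then obtain W where "\<forall>\<xi>. W *\<^sub>V \<xi> = V \<xi>" ..
  then have "\<forall>\<xi> i. ell2_apply (W *\<^sub>V \<xi>) i = b i *\<^sub>V \<xi>"
    using V by simp
  then show ?thesis
    unfolding dilation_def by (rule someI2) simp
qed

section \<open>Orbit vectors and their Gram form\<close>

text \<open>Lists stand for finite sums of elementary tensors. With first entries in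
  \<open>M\<close>, the values form a dense subspace of the minimal Stinespring space.\<close>

definition orbit :: "('m cbop \<times> 'n) list \<Rightarrow> ('i, 'm) ell2" where
  "orbit ps = (\<Sum>(x, \<xi>)\<leftarrow>ps. ell2_diag x *\<^sub>V dilation *\<^sub>V \<xi>)"

lemma orbit_simps [simp]:
  "orbit [] = 0" "orbit ((x, \<xi>) # ps) = ell2_diag x *\<^sub>V dilation *\<^sub>V \<xi> + orbit ps"
  "orbit (ps @ qs) = orbit ps + orbit qs"
  by (simp_all add: orbit_def)

lemma ell2_apply_orbit: "ell2_apply (orbit ps) i = (\<Sum>(x, \<xi>)\<leftarrow>ps. x *\<^sub>V b i *\<^sub>V \<xi>)"
  by (induction ps) auto

text \<open>The coordinates sum to a Kraus series at \<open>cadjoint x o\<^sub>C y\<close>. The Gram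
  entries therefore see the family only through \<open>\<theta>\<close>, and independence of the
  Kraus family rests on this.\<close>

lemma cinner_orbit_single:
  assumes "x \<in> M" "y \<in> M"
  shows "cinner (ell2_diag x *\<^sub>V dilation *\<^sub>V \<xi>) (ell2_diag y *\<^sub>V dilation *\<^sub>V \<eta>)
    = cinner \<xi> (\<theta> (cadjoint x o\<^sub>C y) *\<^sub>V \<eta>)"
proof (rule has_sum_unique)
  show "((\<lambda>i. cinner (b i *\<^sub>V \<xi>) ((cadjoint x o\<^sub>C y) *\<^sub>V b i *\<^sub>V \<eta>)) has_sum
      cinner (ell2_diag x *\<^sub>V dilation *\<^sub>V \<xi>) (ell2_diag y *\<^sub>V dilation *\<^sub>V \<eta>)) UNIV"
    using ell2_cinner_has_sum[of "ell2_diag x *\<^sub>V dilation *\<^sub>V \<xi>" "ell2_diag y *\<^sub>V dilation *\<^sub>V \<eta>"]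
    by (simp add: cinner_cadjoint_right)
  show "((\<lambda>i. cinner (b i *\<^sub>V \<xi>) ((cadjoint x o\<^sub>C y) *\<^sub>V b i *\<^sub>V \<eta>)) has_sum
      cinner \<xi> (\<theta> (cadjoint x o\<^sub>C y) *\<^sub>V \<eta>)) UNIV"
    by (intro kraus M_compose M_adjoint assms)
qed

lemma cinner_orbit_left:
  assumes "fst ` set ps \<subseteq> M" "x \<in> M"
  shows "cinner (orbit ps) (ell2_diag x *\<^sub>V dilation *\<^sub>V \<xi>)
    = (\<Sum>(y, \<eta>)\<leftarrow>ps. cinner \<eta> (\<theta> (cadjoint y o\<^sub>C x) *\<^sub>V \<xi>))"
  using assms by (induction ps) (auto simp: cinner.zero_left cinner_add_left cinner_orbit_single)

lemma cinner_orbit: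
  assumes "fst ` set ps \<subseteq> M" "fst ` set qs \<subseteq> M"
  shows "cinner (orbit ps) (orbit qs)
    = (\<Sum>(x, \<xi>)\<leftarrow>qs. \<Sum>(y, \<eta>)\<leftarrow>ps. cinner \<eta> (\<theta> (cadjoint y o\<^sub>C x) *\<^sub>V \<xi>))"
  using assms(2)
  by (induction qs) (auto simp: cinner.zero_right cinner_add_right cinner_orbit_left[OF assms(1)])

section \<open>Domination by a Kraus family\<close>

text \<open>For a von Neumann algebra \<open>M\<close> this says, after squaring, that some multiple
  of \<open>\<theta>\<close> exceeds \<open>x \<mapsto> cadjoint c o\<^sub>C x o\<^sub>C c\<close>
  in the order of completely positive maps.\<close>

definition dominated :: "('n, 'm) cblinfun \<Rightarrow> bool" where
  "dominated c \<longleftrightarrow>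
    (\<exists>C. \<forall>ps. fst ` set ps \<subseteq> M \<longrightarrow> norm (\<Sum>(x, \<xi>)\<leftarrow>ps. x *\<^sub>V c *\<^sub>V \<xi>) \<le> C * norm (orbit ps))"

lemma dominatedI:
  "(\<And>ps. fst ` set ps \<subseteq> M \<Longrightarrow> norm (\<Sum>(x, \<xi>)\<leftarrow>ps. x *\<^sub>V c *\<^sub>V \<xi>) \<le> C * norm (orbit ps)) \<Longrightarrow> dominated c"
  unfolding dominated_def by blast

lemma dominated_self: "dominated (b j)"
  by (rule dominatedI[of _ 1]) (simp add: norm_ell2_apply_le flip: ell2_apply_orbit)

text \<open>Formally \<open>1 \<otimes> y\<close>. It acts on lists because it is not known
  beforehand to respect equality of orbit vectors; \<open>y\<close> is a plain function so that
  scalar multiplication and iterates are covered.\<close>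

definition amplify :: "('n \<Rightarrow> 'n) \<Rightarrow> ('m cbop \<times> 'n) list \<Rightarrow> ('m cbop \<times> 'n) list" where
  "amplify y ps = map (\<lambda>(x, \<xi>). (x, y \<xi>)) ps"

lemma amplify_simps [simp]:
  "amplify y [] = []" "amplify y ((x, \<xi>) # ps) = (x, y \<xi>) # amplify y ps"
  "fst ` set (amplify y ps) = fst ` set ps" "amplify y (amplify z ps) = amplify (y \<circ> z) ps"
  by (auto simp: amplify_def image_image case_prod_beta)

text \<open>Since \<open>z\<close> commutes with the values of \<open>\<theta>\<close>, it slides
  through the Gram entries: on orbit vectors \<open>1 \<otimes> z\<close> is a formal adjoint of
  \<open>1 \<otimes> y\<close>.\<close>

lemma cinner_orbit_amplify:
  assumes "\<And>x. x \<in> M \<Longrightarrow> \<theta> x o\<^sub>C z = z o\<^sub>C \<theta> x" "z = cadjoint y"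
    and "fst ` set ps \<subseteq> M" "fst ` set qs \<subseteq> M"
  shows "cinner (orbit (amplify (cblinfun_apply y) ps)) (orbit qs)
    = cinner (orbit ps) (orbit (amplify (cblinfun_apply z) qs))"
proof -
  have single: "cinner (y *\<^sub>V \<eta>) (\<theta> x *\<^sub>V \<xi>) = cinner \<eta> (\<theta> x *\<^sub>V z *\<^sub>V \<xi>)" if "x \<in> M" for x \<xi> \<eta>
  proof -
    have "\<theta> x *\<^sub>V z *\<^sub>V \<xi> = z *\<^sub>V \<theta> x *\<^sub>V \<xi>"
      using arg_cong[OF assms(1)[OF that], of "\<lambda>a. a *\<^sub>V \<xi>"] by simp
    then show ?thesis
      by (simp add: assms(2) cinner_cadjoint_right)
  qed
  have "(\<Sum>(w, \<eta>)\<leftarrow>amplify (cblinfun_apply y) ps. cinner \<eta> (\<theta> (cadjoint w o\<^sub>C x) *\<^sub>V \<xi>))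
      = (\<Sum>(w, \<eta>)\<leftarrow>ps. cinner \<eta> (\<theta> (cadjoint w o\<^sub>C x) *\<^sub>V z *\<^sub>V \<xi>))" if "x \<in> M" for x \<xi>
    using assms(3) that by (induction ps) (auto simp: single M_compose M_adjoint)
  with assms(4) have "(\<Sum>(x, \<xi>)\<leftarrow>qs. \<Sum>(w, \<eta>)\<leftarrow>amplify (cblinfun_apply y) ps.
        cinner \<eta> (\<theta> (cadjoint w o\<^sub>C x) *\<^sub>V \<xi>))
      = (\<Sum>(x, \<xi>)\<leftarrow>amplify (cblinfun_apply z) qs. \<Sum>(w, \<eta>)\<leftarrow>ps.
        cinner \<eta> (\<theta> (cadjoint w o\<^sub>C x) *\<^sub>V \<xi>))"
    by (induction qs) auto
  then show ?thesis
    using assms(3,4) by (simp add: cinner_orbit)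
qed

text \<open>A crude triangle inequality is enough: \<open>A\<close> may depend on the list, because
  only the rate \<open>B\<close> survives in \<open>iterated_cauchy_schwarz\<close>.\<close>

lemma orbit_amplify_growth:
  assumes "B > 0" "\<And>\<xi>. norm (h *\<^sub>V \<xi>) \<le> B * norm \<xi>"
  shows "\<exists>A. \<forall>m. norm (orbit (amplify (cblinfun_apply h ^^ m) ps)) \<le> A * B ^ m"
proof (induction ps)
  case Nil
  then show ?case
    by (intro exI[of _ 0]) simp
next
  case (Cons p ps)
  obtain x \<xi> where p: "p = (x, \<xi>)"
    by force
  obtain A where A: "\<And>m. norm (orbit (amplify (cblinfun_apply h ^^ m) ps)) \<le> A * B ^ m"
    using Cons by auto
  obtain K where K: "K > 0" "\<And>\<eta>. norm ((ell2_diag x o\<^sub>C dilation) *\<^sub>V \<eta>) \<le> K * norm \<eta>"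
    using cblinfun_bound[of "ell2_diag x o\<^sub>C dilation"] by metis
  have pow: "norm ((cblinfun_apply h ^^ m) \<xi>) \<le> B ^ m * norm \<xi>" for m
  proof (induction m)
    case (Suc m)
    have "norm ((cblinfun_apply h ^^ Suc m) \<xi>) \<le> B * norm ((cblinfun_apply h ^^ m) \<xi>)"
      using assms(2) by simp
    also have "\<dots> \<le> B * (B ^ m * norm \<xi>)"
      using Suc assms(1) by (intro mult_left_mono) auto
    finally show ?case by (simp add: mult.assoc)
  qed simp
  have "norm (orbit (amplify (cblinfun_apply h ^^ m) (p # ps))) \<le> (K * norm \<xi> + A) * B ^ m" for m
  proof -
    have "norm (orbit (amplify (cblinfun_apply h ^^ m) (p # ps)))
        \<le> norm ((ell2_diag x o\<^sub>C dilation) *\<^sub>V (cblinfun_apply h ^^ m) \<xi>)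
          + norm (orbit (amplify (cblinfun_apply h ^^ m) ps))"
      by (simp add: p norm_triangle_ineq)
    also have "\<dots> \<le> K * norm ((cblinfun_apply h ^^ m) \<xi>) + A * B ^ m"
      by (intro add_mono K A)
    also have "\<dots> \<le> K * (B ^ m * norm \<xi>) + A * B ^ m"
      using K(1) by (intro add_right_mono mult_left_mono pow) simp
    finally show ?thesis by (simp add: algebra_simps)
  qed
  then show ?case by blast
qed

text \<open>Amplification by \<open>y\<close> turns out to be bounded on orbit vectors: its squared
  norm is a matrix element of the positive operator \<open>h\<close>, whose powers are controlled by
  Cauchy-Schwarz. The claim is the coordinate \<open>j\<close> of this bound.\<close>

lemma dominated_compose:
  assumes "\<And>x. x \<in> M \<Longrightarrow> \<theta> x o\<^sub>C y = y o\<^sub>C \<theta> x"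
    and "\<And>x. x \<in> M \<Longrightarrow> \<theta> x o\<^sub>C cadjoint y = cadjoint y o\<^sub>C \<theta> x"
  shows "dominated (b j o\<^sub>C y)"
proof -
  define h where "h = cadjoint y o\<^sub>C y"
  have h_adj: "h = cadjoint h"
    by (simp add: h_def cadjoint_compose)
  have h_comm: "\<theta> x o\<^sub>C h = h o\<^sub>C \<theta> x" if "x \<in> M" for x
    unfolding h_def using assms[OF that] by (metis cblinfun_compose_assoc)
  obtain B where B: "B > 0" "\<And>\<xi>. norm (h *\<^sub>V \<xi>) \<le> B * norm \<xi>"
    using cblinfun_bound[of h] by metis
  have main: "norm (orbit (amplify (cblinfun_apply y) ps)) \<le> sqrt B * norm (orbit ps)"
    if ps: "fst ` set ps \<subseteq> M" for ps
  proof -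
    \<comment> \<open>As \<open>h\<close> is self-adjoint, \<open>(\<gamma> m)\<^sup>2\<close> is
      the inner product of the orbit vector with its amplification by the power
      \<open>2 * m\<close>; this is the doubling inequality.\<close>
    define \<gamma> where "\<gamma> m = norm (orbit (amplify (cblinfun_apply h ^^ m) ps))" for m
    have \<gamma>0: "\<gamma> 0 = norm (orbit ps)"
      by (simp add: \<gamma>_def amplify_def case_prod_beta)
    have move: "cinner (orbit (amplify (cblinfun_apply h ^^ m) rs)) (orbit qs)
        = cinner (orbit rs) (orbit (amplify (cblinfun_apply h ^^ m) qs))"
      if "fst ` set rs \<subseteq> M" "fst ` set qs \<subseteq> M" for m rs qs
      using that(2)
    proof (induction m arbitrary: qs)
      case 0
      then show ?case by (simp add: amplify_def case_prod_beta)
    next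
      case (Suc m)
      have "amplify (cblinfun_apply h ^^ Suc m) rs
          = amplify (cblinfun_apply h) (amplify (cblinfun_apply h ^^ m) rs)" by simp
      then have "cinner (orbit (amplify (cblinfun_apply h ^^ Suc m) rs)) (orbit qs)
          = cinner (orbit (amplify (cblinfun_apply h ^^ m) rs)) (orbit (amplify (cblinfun_apply h) qs))"
        using cinner_orbit_amplify[OF h_comm h_adj, of "amplify (cblinfun_apply h ^^ m) rs" qs]
          that(1) Suc.prems by simp
      also have "\<dots> = cinner (orbit rs) (orbit (amplify (cblinfun_apply h ^^ m) (amplify (cblinfun_apply h) qs)))"
        using Suc.prems by (intro Suc.IH) simp
      also have "amplify (cblinfun_apply h ^^ m) (amplify (cblinfun_apply h) qs)
          = amplify (cblinfun_apply h ^^ Suc m) qs"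
        by (simp add: funpow_Suc_right del: funpow.simps)
      finally show ?case .
    qed
    have "(\<gamma> m)\<^sup>2 \<le> \<gamma> 0 * \<gamma> (2 * m)" for m
    proof -
      have "complex_of_real ((\<gamma> m)\<^sup>2)
          = cinner (orbit (amplify (cblinfun_apply h ^^ m) ps)) (orbit (amplify (cblinfun_apply h ^^ m) ps))"
        by (simp add: \<gamma>_def cinner_self)
      also have "\<dots> = cinner (orbit ps) (orbit (amplify (cblinfun_apply h ^^ (2 * m)) ps))"
        using move[of ps "amplify (cblinfun_apply h ^^ m) ps" m] ps
        by (simp add: mult_2 funpow_add)
      finally have "(\<gamma> m)\<^sup>2 \<le> cmod (cinner (orbit ps) (orbit (amplify (cblinfun_apply h ^^ (2 * m)) ps)))"
        by (metis norm_of_real abs_ge_self)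
      also have "\<dots> \<le> \<gamma> 0 * \<gamma> (2 * m)"
        unfolding \<gamma>0 unfolding \<gamma>_def by (rule cmod_cinner_le)
      finally show ?thesis .
    qed
    moreover obtain A where "\<And>m. \<gamma> m \<le> A * B ^ m"
      using orbit_amplify_growth[OF B, of ps] unfolding \<gamma>_def by auto
    ultimately have \<gamma>1: "\<gamma> 1 \<le> B * \<gamma> 0"
      using B(1) by (intro iterated_cauchy_schwarz) (simp_all add: \<gamma>_def)
    have h_fun: "cblinfun_apply h = cblinfun_apply (cadjoint y) \<circ> cblinfun_apply y"
      by (simp add: h_def fun_eq_iff)
    \<comment> \<open>One factor \<open>y\<close> crosses the inner product and leaves
      \<open>h\<close>; the bound for \<open>\<gamma> 1\<close> then gives the constant
      \<open>sqrt B\<close>.\<close>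
    have "complex_of_real ((norm (orbit (amplify (cblinfun_apply y) ps)))\<^sup>2)
        = cinner (orbit ps) (orbit (amplify (cblinfun_apply h) ps))"
      using cinner_orbit_amplify[OF assms(2) refl, of ps "amplify (cblinfun_apply y) ps"] ps
      by (simp only: cinner_self[symmetric] h_fun amplify_simps)
    then have "(norm (orbit (amplify (cblinfun_apply y) ps)))\<^sup>2
        \<le> cmod (cinner (orbit ps) (orbit (amplify (cblinfun_apply h) ps)))"
      by (metis norm_of_real abs_ge_self)
    also have "\<dots> \<le> \<gamma> 0 * \<gamma> 1"
      unfolding \<gamma>0 unfolding \<gamma>_def by (simp add: cmod_cinner_le)
    also have "\<dots> \<le> \<gamma> 0 * (B * \<gamma> 0)"
      using \<gamma>1 by (intro mult_left_mono) (simp_all add: \<gamma>0)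
    also have "\<dots> = (sqrt B * norm (orbit ps))\<^sup>2"
      using B(1) by (simp add: \<gamma>0 power_mult_distrib power2_eq_square)
    finally show ?thesis
      by (rule power2_le_imp_le) (use B(1) in simp)
  qed
  show ?thesis
  proof (rule dominatedI)
    fix ps :: "('m cbop \<times> 'n) list"
    assume ps: "fst ` set ps \<subseteq> M"
    have "(\<Sum>(x, \<xi>)\<leftarrow>ps. x *\<^sub>V (b j o\<^sub>C y) *\<^sub>V \<xi>) = ell2_apply (orbit (amplify (cblinfun_apply y) ps)) j"
      by (simp add: ell2_apply_orbit amplify_def case_prod_unfold o_def)
    then show "norm (\<Sum>(x, \<xi>)\<leftarrow>ps. x *\<^sub>V (b j o\<^sub>C y) *\<^sub>V \<xi>) \<le> sqrt B * norm (orbit ps)"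
      using norm_ell2_apply_le main[OF ps] by (metis order_trans)
  qed
qed

section \<open>Coefficients in the commutant of M\<close>

definition shift :: "'m cbop \<Rightarrow> ('m cbop \<times> 'n) list \<Rightarrow> ('m cbop \<times> 'n) list" where
  "shift y ps = map (\<lambda>(x, \<xi>). (y o\<^sub>C x, \<xi>)) ps"

lemma shift_M: "y \<in> M \<Longrightarrow> fst ` set ps \<subseteq> M \<Longrightarrow> fst ` set (shift y ps) \<subseteq> M"
  by (auto simp: shift_def M_compose)

lemma apply_shift: "y *\<^sub>V (\<Sum>(x, \<xi>)\<leftarrow>ps. x *\<^sub>V c *\<^sub>V \<xi>) = (\<Sum>(x, \<xi>)\<leftarrow>shift y ps. x *\<^sub>V c *\<^sub>V \<xi>)"
  by (induction ps) (auto simp: shift_def cblinfun_apply_add)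

lemma ell2_diag_orbit: "ell2_diag y *\<^sub>V orbit ps = orbit (shift y ps)"
  by (rule ell2_eqI) (simp add: ell2_apply_orbit apply_shift)

text \<open>The operators \<open>q i\<close> are the adjoints of the coefficients of \<open>c\<close> with respect to \<open>b\<close>.\<close>

lemma dominated_expansion:
  assumes "dominated c"
  shows "\<exists>q K. (\<forall>i. \<forall>x\<in>M. q i o\<^sub>C x = x o\<^sub>C q i) \<and>
    (\<forall>\<zeta> \<xi>. ((\<lambda>i. cinner (q i *\<^sub>V \<zeta>) (b i *\<^sub>V \<xi>)) has_sum cinner \<zeta> (c *\<^sub>V \<xi>)) UNIV) \<and>
    (\<forall>F \<zeta> \<xi>. cmod (\<Sum>i\<in>F. cinner (q i *\<^sub>V \<zeta>) (b i *\<^sub>V \<xi>)) \<le> K * (norm \<zeta> * norm \<xi>))"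
proof -
  obtain C where C: "\<And>ps. fst ` set ps \<subseteq> M \<Longrightarrow>
      norm (\<Sum>(x, \<xi>)\<leftarrow>ps. x *\<^sub>V c *\<^sub>V \<xi>) \<le> C * norm (orbit ps)"
    using assms unfolding dominated_def by auto
  define target where "target ps = (\<Sum>(x, \<xi>)\<leftarrow>ps. x *\<^sub>V c *\<^sub>V \<xi>)" for ps :: "('m cbop \<times> 'n) list"
  \<comment> \<open>Domination bounds this relation, so it is the graph of an operator on the orbit
    vectors. Working with the graph avoids choosing a list for each orbit vector.\<close>
  define G where "G = {(orbit ps, target ps) | ps. fst ` set ps \<subseteq> M}"
  have GI: "(orbit ps, target ps) \<in> G" if "fst ` set ps \<subseteq> M" for ps
    using that unfolding G_def by auto
  have scale: "c' *\<^sub>C orbit ps = orbit (amplify (\<lambda>\<xi>. c' *\<^sub>C \<xi>) ps)"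
    "c' *\<^sub>C target ps = target (amplify (\<lambda>\<xi>. c' *\<^sub>C \<xi>) ps)" for c' ps
    by (induction ps) (auto simp: target_def scaleC_add_right cblinfun_apply_scaleC)
  obtain Q where Q: "\<And>\<zeta> v w. (v, w) \<in> G \<Longrightarrow> cinner (Q *\<^sub>V \<zeta>) v = cinner \<zeta> w"
    and Q_range: "\<And>\<zeta> y. (\<And>v w. (v, w) \<in> G \<Longrightarrow> cinner y v = 0) \<Longrightarrow> cinner y (Q *\<^sub>V \<zeta>) = 0"
  proof (rule adjoint_of_graph)
    show "(0, 0) \<in> G"
      using GI[of "[]"] by (simp add: target_def)
    show "(v + v', w + w') \<in> G" if "(v, w) \<in> G" "(v', w') \<in> G" for v w v' w'
    proof -
      from that obtain ps qs where "v = orbit ps" "w = target ps" "fst ` set ps \<subseteq> M"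
        "v' = orbit qs" "w' = target qs" "fst ` set qs \<subseteq> M"
        by (auto simp: G_def)
      then show ?thesis
        using GI[of "ps @ qs"] by (simp add: target_def image_Un)
    qed
    show "(c' *\<^sub>C v, c' *\<^sub>C w) \<in> G" if "(v, w) \<in> G" for c' v w
    proof -
      from that obtain ps where "v = orbit ps" "w = target ps" "fst ` set ps \<subseteq> M"
        by (auto simp: G_def)
      then show ?thesis
        using GI[of "amplify (\<lambda>\<xi>. c' *\<^sub>C \<xi>) ps"] by (simp add: scale)
    qed
    show "norm w \<le> C * norm v" if "(v, w) \<in> G" for v w
      using that C by (auto simp: G_def target_def)
  qed metis
  have Q_diag: "Q *\<^sub>V y *\<^sub>V \<zeta> = ell2_diag y *\<^sub>V Q *\<^sub>V \<zeta>" if y: "y \<in> M" for y \<zeta>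
  proof -
    \<comment> \<open>Both terms of \<open>\<delta>\<close> lie in the closure of the orbit vectors,
      the second because they are stable under \<open>ell2_diag y\<close>; as
      \<open>\<delta>\<close> is orthogonal to all orbit vectors, it vanishes.\<close>
    define \<delta> where "\<delta> = Q *\<^sub>V y *\<^sub>V \<zeta> - ell2_diag y *\<^sub>V Q *\<^sub>V \<zeta>"
    have y': "cadjoint y \<in> M"
      using y by (rule M_adjoint)
    have shift_G: "(ell2_diag z *\<^sub>V v, z *\<^sub>V w) \<in> G" if "z \<in> M" "(v, w) \<in> G" for z v w
    proof -
      from that obtain ps where "v = orbit ps" "w = target ps" "fst ` set ps \<subseteq> M"
        by (auto simp: G_def)
      then show ?thesis
        using GI[OF shift_M[OF that(1)]] by (simp add: target_def ell2_diag_orbit apply_shift)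
    qed
    have orth: "cinner \<delta> v = 0" if "(v, w) \<in> G" for v w
      unfolding \<delta>_def cinner.diff_left cinner_ell2_diag_left Q[OF that] Q[OF shift_G[OF y' that]]
      by (simp add: cinner_cadjoint_right)
    have "cinner \<delta> (ell2_diag y *\<^sub>V Q *\<^sub>V \<zeta>) = cinner (ell2_diag (cadjoint y) *\<^sub>V \<delta>) (Q *\<^sub>V \<zeta>)"
      by (simp add: cinner_ell2_diag_left)
    also have "\<dots> = 0"
    proof (rule Q_range)
      show "cinner (ell2_diag (cadjoint y) *\<^sub>V \<delta>) v = 0" if "(v, w) \<in> G" for v w
        using orth[OF shift_G[OF y that]] by (simp add: cinner_ell2_diag_left)
    qed
    finally have "cinner \<delta> (ell2_diag y *\<^sub>V Q *\<^sub>V \<zeta>) = 0" .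
    have "cinner \<delta> \<delta> = 0"
    proof -
      have "cinner \<delta> (Q *\<^sub>V y *\<^sub>V \<zeta>) = 0"
        by (rule Q_range[OF orth])
      with \<open>cinner \<delta> (ell2_diag y *\<^sub>V Q *\<^sub>V \<zeta>) = 0\<close>
      have "cinner \<delta> (Q *\<^sub>V y *\<^sub>V \<zeta> - ell2_diag y *\<^sub>V Q *\<^sub>V \<zeta>) = 0"
        by (simp add: cinner.diff_right)
      then show ?thesis
        by (simp only: \<delta>_def)
    qed
    then show ?thesis
      by (simp add: cinner_self \<delta>_def)
  qed
  define p where "p i = (SOME p. \<forall>f :: ('i, 'm) ell2. p *\<^sub>V f = ell2_apply f i)" for i
  have p: "p i *\<^sub>V f = ell2_apply f i" for i f
  proof -
    obtain r :: "(('i, 'm) ell2, 'm) cblinfun" where "\<forall>f. r *\<^sub>V f = ell2_apply f i"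
      using ell2_apply_cblinfun[of i] by metis
    then show ?thesis
      unfolding p_def by (rule someI2) simp
  qed
  \<comment> \<open>Coordinate maps intertwine \<open>ell2_diag x\<close> with \<open>x\<close>, so
    each coordinate of \<open>Q\<close> commutes with \<open>M\<close>.\<close>
  define q where "q i = p i o\<^sub>C Q" for i
  have q: "q i *\<^sub>V \<zeta> = ell2_apply (Q *\<^sub>V \<zeta>) i" for i \<zeta>
    by (simp add: q_def p)
  have "q i o\<^sub>C x = x o\<^sub>C q i" if "x \<in> M" for i x
    by (rule cblinfun_eqI) (simp add: q Q_diag[OF that])
  moreover have "((\<lambda>i. cinner (q i *\<^sub>V \<zeta>) (b i *\<^sub>V \<xi>)) has_sum cinner \<zeta> (c *\<^sub>V \<xi>)) UNIV" for \<zeta> \<xi>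
  proof -
    have "ell2_diag cblinfun_id *\<^sub>V f = f" for f :: "('i, 'm) ell2"
      by (rule ell2_eqI) simp
    \<comment> \<open>For the one-element list with the identity, the orbit vector is
      \<open>dilation *\<^sub>V \<xi>\<close> and the target is
      \<open>c *\<^sub>V \<xi>\<close>.\<close>
    then have "cinner (Q *\<^sub>V \<zeta>) (dilation *\<^sub>V \<xi>) = cinner \<zeta> (c *\<^sub>V \<xi>)"
      using Q[OF GI[of "[(cblinfun_id, \<xi>)]"]] M_id by (simp add: target_def)
    then show ?thesis
      using ell2_cinner_has_sum[of "Q *\<^sub>V \<zeta>" "dilation *\<^sub>V \<xi>"] by (simp add: q)
  qed
  moreover obtain K where "\<And>F \<zeta> \<xi>. cmod (\<Sum>i\<in>F. cinner (q i *\<^sub>V \<zeta>) (b i *\<^sub>V \<xi>)) \<le> K * (norm \<zeta> * norm \<xi>)"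
  proof -
    obtain K1 where K1: "K1 > 0" "\<And>\<zeta>. norm (Q *\<^sub>V \<zeta>) \<le> K1 * norm \<zeta>"
      using cblinfun_bound[of Q] by metis
    obtain K2 where K2: "K2 \<ge> 0"
      "\<And>F \<xi>. finite F \<Longrightarrow> (\<Sum>i\<in>F. (norm (b i *\<^sub>V \<xi>))\<^sup>2) \<le> (K2 * norm \<xi>)\<^sup>2"
      using kraus_norm_bound by metis
    have "cmod (\<Sum>i\<in>F. cinner (q i *\<^sub>V \<zeta>) (b i *\<^sub>V \<xi>)) \<le> (K1 * K2) * (norm \<zeta> * norm \<xi>)" for F \<zeta> \<xi>
    proof (cases "finite F")
      case True
      have "cmod (\<Sum>i\<in>F. cinner (q i *\<^sub>V \<zeta>) (b i *\<^sub>V \<xi>)) \<le> (\<Sum>i\<in>F. norm (q i *\<^sub>V \<zeta>) * norm (b i *\<^sub>V \<xi>))"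
        by (intro sum_norm_le cmod_cinner_le)
      also have "\<dots> \<le> norm (Q *\<^sub>V \<zeta>) * (K2 * norm \<xi>)"
        using K2 True by (intro sum_mult_le_sqrt_bounds) (simp_all add: q ell2_finite_sum_le)
      also have "\<dots> \<le> (K1 * norm \<zeta>) * (K2 * norm \<xi>)"
        using K1 K2(1) by (intro mult_right_mono) simp_all
      finally show ?thesis by (simp add: mult_ac)
    next
      \<comment> \<open>A sum over an infinite set is 0 by convention.\<close>
      case False
      then show ?thesis using K1(1) K2(1) by simp
    qed
    then show ?thesis
      by (rule that)
  qed
  ultimately show ?thesis
    by (intro exI[of _ q] exI[of _ K]) simp
qed

section \<open>Replacing Kraus operators by dominated ones\<close>

text \<open>Expanding \<open>c\<close> makes \<open>d o\<^sub>C s o\<^sub>C c\<close> a weak* limit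
  of sums of terms \<open>d o\<^sub>C (s o\<^sub>C a) o\<^sub>C b i\<close> with \<open>a\<close> in
  the commutant of \<open>M\<close>, and \<open>s o\<^sub>C a\<close> stays in \<open>S\<close>. The
  left factor \<open>d\<close> is arbitrary, so the result can be used once for each side.\<close>

lemma predual_dominated_zero:
  assumes c: "dominated c" and \<phi>: "\<phi> \<in> predual_functionals"
    and S: "\<And>s y. s \<in> S \<Longrightarrow> y \<in> commutant M \<Longrightarrow> s o\<^sub>C y \<in> S"
    and zero: "\<And>s i. s \<in> S \<Longrightarrow> \<phi> (d o\<^sub>C s o\<^sub>C b i) = 0" and s: "s \<in> S"
  shows "\<phi> (d o\<^sub>C s o\<^sub>C c) = 0"
proof -
  from dominated_expansion[OF c] obtain q K where q: "\<forall>i. \<forall>x\<in>M. q i o\<^sub>C x = x o\<^sub>C q i"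
    and expansion: "\<forall>\<zeta> \<xi>. ((\<lambda>i. cinner (q i *\<^sub>V \<zeta>) (b i *\<^sub>V \<xi>)) has_sum cinner \<zeta> (c *\<^sub>V \<xi>)) UNIV"
    and bound: "\<forall>F \<zeta> \<xi>. cmod (\<Sum>i\<in>F. cinner (q i *\<^sub>V \<zeta>) (b i *\<^sub>V \<xi>)) \<le> K * (norm \<zeta> * norm \<xi>)"
    by (elim exE conjE) (rule that)
  have comm: "cadjoint (q i) \<in> commutant M" for i
    unfolding commutant_def mem_Collect_eq
  proof
    fix x assume "x \<in> M"
    then have "q i o\<^sub>C cadjoint x = cadjoint x o\<^sub>C q i"
      using q M_adjoint by simp
    from arg_cong[OF this, of cadjoint] show "x o\<^sub>C cadjoint (q i) = cadjoint (q i) o\<^sub>C x"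
      by (simp add: cadjoint_compose)
  qed
  \<comment> \<open>Moving \<open>d o\<^sub>C s\<close> onto the left vector reduces matrix elements
    of \<open>X F\<close> to partial sums of the expansion of \<open>c\<close>.\<close>
  define e where "e = cadjoint (d o\<^sub>C s)"
  define X where "X F = (\<Sum>i\<in>F. d o\<^sub>C (s o\<^sub>C cadjoint (q i)) o\<^sub>C b i)" for F
  have X: "cinner \<xi> (X F *\<^sub>V \<eta>) = (\<Sum>i\<in>F. cinner (q i *\<^sub>V e *\<^sub>V \<xi>) (b i *\<^sub>V \<eta>))" for F \<xi> \<eta>
    unfolding X_def e_def
    by (simp add: cblinfun_sum_apply cinner.sum_right cinner_cadjoint_left flip: cinner_cadjoint_right)
  obtain L where L: "L > 0" "\<And>\<xi>. norm (e *\<^sub>V \<xi>) \<le> L * norm \<xi>"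
    using cblinfun_bound[of e] by metis
  have "((\<lambda>F. \<phi> (X F)) \<longlongrightarrow> \<phi> (d o\<^sub>C s o\<^sub>C c)) (finite_subsets_at_top UNIV)"
  proof (rule predual_tendsto[OF \<phi>])
    show "cmod (cinner \<xi> (X F *\<^sub>V \<eta>)) \<le> (\<bar>K\<bar> * L) * (norm \<xi> * norm \<eta>)" for F \<xi> \<eta>
    proof -
      have "cmod (cinner \<xi> (X F *\<^sub>V \<eta>)) \<le> K * (norm (e *\<^sub>V \<xi>) * norm \<eta>)"
        unfolding X using bound by simp
      \<comment> \<open>The expansion records no sign for \<open>K\<close>.\<close>
      also have "\<dots> \<le> \<bar>K\<bar> * (norm (e *\<^sub>V \<xi>) * norm \<eta>)"
        by (intro mult_right_mono) simp_all
      also have "\<dots> \<le> \<bar>K\<bar> * ((L * norm \<xi>) * norm \<eta>)"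
        by (intro mult_left_mono mult_right_mono L) simp_all
      finally show ?thesis by (simp add: mult_ac)
    qed
    show "((\<lambda>F. cinner \<xi> (X F *\<^sub>V \<eta>)) \<longlongrightarrow> cinner \<xi> ((d o\<^sub>C s o\<^sub>C c) *\<^sub>V \<eta>)) (finite_subsets_at_top UNIV)"
      for \<xi> \<eta>
      using expansion[rule_format, of "e *\<^sub>V \<xi>" \<eta>] unfolding X has_sum_def
      by (simp add: e_def cinner_cadjoint_left)
  qed simp
  moreover have "\<phi> (X F) = 0" for F
    unfolding X_def predual_sum[OF \<phi>] by (intro sum.neutral ballI zero S s comm)
  ultimately show ?thesis
    by (simp add: tendsto_const_iff)
qed

text \<open>The right factor is replaced first. For the left one, the functional
  \<open>a \<mapsto> cnj (\<phi> (cadjoint a))\<close> and the set of operators with adjoint in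
  \<open>S\<close> turn it into a right factor.\<close>

lemma dominated_sandwich:
  assumes c: "dominated c" "dominated c'" and S: "quantum_relation M S" and s: "s \<in> S"
  shows "cadjoint c' o\<^sub>C s o\<^sub>C c \<in> weakstar_span {cadjoint (b i) o\<^sub>C x o\<^sub>C b j | i x j. x \<in> S}"
  unfolding weakstar_span_iff
proof (intro ballI impI)
  fix \<phi> :: "'n cbop \<Rightarrow> complex"
  assume \<phi>: "\<phi> \<in> predual_functionals"
    and 0: "\<forall>g\<in>{cadjoint (b i) o\<^sub>C x o\<^sub>C b j | i x j. x \<in> S}. \<phi> g = 0"
  have id: "cblinfun_id \<in> commutant M"
    by (simp add: commutant_def)
  have left: "y o\<^sub>C x \<in> S" and right: "x o\<^sub>C y \<in> S" if "x \<in> S" "y \<in> commutant M" for x y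
    using S that id unfolding quantum_relation_def
    by (metis cblinfun_compose_id(2), metis cblinfun_compose_id(1))
  have half: "\<phi> (cadjoint (b i) o\<^sub>C x o\<^sub>C c) = 0" if "x \<in> S" for i x
  proof (rule predual_dominated_zero[OF c(1) \<phi> right _ that])
    show "\<phi> (cadjoint (b i) o\<^sub>C x o\<^sub>C b j) = 0" if "x \<in> S" for x j
      using 0 that by auto
  qed
  have "cnj (\<phi> (cadjoint (cadjoint c o\<^sub>C cadjoint s o\<^sub>C c'))) = 0"
  proof (rule predual_dominated_zero[OF c(2) predual_cnj_cadjoint[OF \<phi>], where S = "{x. cadjoint x \<in> S}"])
    show "x o\<^sub>C y \<in> {x. cadjoint x \<in> S}" if "x \<in> {x. cadjoint x \<in> S}" "y \<in> commutant M" for x y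
      using that left commutant_cadjoint[OF M_adjoint] by (simp add: cadjoint_compose)
    show "cnj (\<phi> (cadjoint (cadjoint c o\<^sub>C x o\<^sub>C b i))) = 0" if "x \<in> {x. cadjoint x \<in> S}" for x i
      using half[of "cadjoint x" i] that by (simp add: cadjoint_compose cblinfun_compose_assoc)
    show "cadjoint s \<in> {x. cadjoint x \<in> S}"
      using s by simp
  qed
  then show "\<phi> (cadjoint c' o\<^sub>C s o\<^sub>C c) = 0"
    by (simp add: cadjoint_compose cblinfun_compose_assoc)
qed

end

text \<open>Equal Gram entries make the orbit vectors of both families equally long, and
  \<open>b' k\<close> gives a coordinate of the second one; hence the constant 1.\<close>

lemma dominated_other_family:
  fixes M :: "'m::chilbert_space cbop set" and b' :: "'k \<Rightarrow> ('n::chilbert_space, 'm) cblinfun"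
  assumes "kraus_family M \<theta> b" "kraus_family M \<theta> b'"
  shows "kraus_family.dominated M b (b' k)"
proof -
  interpret b: kraus_family M \<theta> b by fact
  interpret b': kraus_family M \<theta> b' by fact
  show ?thesis
  proof (rule b.dominatedI)
    fix ps :: "('m cbop \<times> 'n) list"
    assume ps: "fst ` set ps \<subseteq> M"
    have "complex_of_real ((norm (b'.orbit ps))\<^sup>2) = complex_of_real ((norm (b.orbit ps))\<^sup>2)"
      unfolding cinner_self[symmetric] using ps by (simp add: b.cinner_orbit b'.cinner_orbit)
    then have "norm (b'.orbit ps) = norm (b.orbit ps)"
      by (simp add: power2_eq_iff_nonneg flip: of_real_power)
    then show "norm (\<Sum>(x, \<xi>)\<leftarrow>ps. x *\<^sub>V b' k *\<^sub>V \<xi>) \<le> 1 * norm (b.orbit ps)"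
      by (metis b'.ell2_apply_orbit norm_ell2_apply_le mult_1)
  qed
qed


section \<open>Orthonormal bases and tensor products\<close>

definition orthonormal_basis :: "'a::chilbert_space set \<Rightarrow> bool" where
  "orthonormal_basis B \<longleftrightarrow>
    (\<forall>k\<in>B. \<forall>l\<in>B. cinner k l = (if k = l then 1 else 0)) \<and>
    (\<forall>x. (\<forall>k\<in>B. cinner k x = 0) \<longrightarrow> x = 0)"

text \<open>A maximal orthonormal set: a nonzero vector orthogonal to it could be normalized and
  adjoined.\<close>

lemma orthonormal_basis_exists: "\<exists>B :: 'a::chilbert_space set. orthonormal_basis B"
proof -
  define A where "A = {B :: 'a set. \<forall>k\<in>B. \<forall>l\<in>B. cinner k l = (if k = l then 1 else 0)}"
  have "\<Union>C \<in> A" if C: "subset.chain A C" for C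
    unfolding A_def mem_Collect_eq
  proof (intro ballI)
    fix k l assume "k \<in> \<Union>C" "l \<in> \<Union>C"
    then obtain X Y where XY: "X \<in> C" "k \<in> X" "Y \<in> C" "l \<in> Y"
      by auto
    have "X \<subseteq> Y \<or> Y \<subseteq> X"
      using C XY unfolding subset.chain_def by blast
    then obtain Z where "Z \<in> C" "k \<in> Z" "l \<in> Z"
      using XY by blast
    moreover have "Z \<in> A"
      using C \<open>Z \<in> C\<close> unfolding subset.chain_def by blast
    ultimately show "cinner k l = (if k = l then 1 else 0)"
      unfolding A_def by blast
  qed
  then obtain B where B: "B \<in> A" and max: "\<forall>X\<in>A. B \<subseteq> X \<longrightarrow> X = B"
    using subset_Zorn'[of A] by blast
  have "x = 0" if orth: "\<forall>k\<in>B. cinner k x = 0" for x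
  proof (rule ccontr)
    assume x: "x \<noteq> 0"
    define y where "y = complex_of_real (inverse (norm x)) *\<^sub>C x"
    have "norm y = 1"
      using x by (simp add: y_def norm_scaleC norm_inverse)
    then have yy: "cinner y y = 1"
      by (simp add: cinner_self)
    have ky: "cinner k y = 0" if "k \<in> B" for k
      using orth that by (simp add: y_def cinner_scaleC_right)
    then have yk: "cinner y k = 0" if "k \<in> B" for k
      using that cinner_commute[of y k] by simp
    have "insert y B \<in> A"
      using B yy ky yk unfolding A_def by auto
    then have "y \<in> B"
      using max by blast
    then show False
      using ky yy by force
  qed
  then show ?thesis
    using B unfolding A_def orthonormal_basis_def by blast
qed

section \<open>Coordinates along a basis of the second tensor factor\<close>

locale tensor_basis =
  fixes tens :: "'h::chilbert_space \<Rightarrow> 'l::chilbert_space \<Rightarrow> 't::chilbert_space"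
    and B :: "'l set"
  assumes tensor: "hilbert_tensor tens" and basis: "orthonormal_basis B"
begin

lemma tens_simps:
  "tens (h + h') l = tens h l + tens h' l" "tens h (l + l') = tens h l + tens h l'"
  "tens (c *\<^sub>C h) l = c *\<^sub>C tens h l" "tens h (c *\<^sub>C l) = c *\<^sub>C tens h l"
  "cinner (tens h l) (tens h' l') = cinner h h' * cinner l l'"
  using tensor unfolding hilbert_tensor_def by simp_all

lemma norm_tens: "norm (tens h l) = norm h * norm l"
proof -
  have "complex_of_real ((norm (tens h l))\<^sup>2) = complex_of_real ((norm h * norm l)\<^sup>2)"
    by (simp only: cinner_self[symmetric] tens_simps power_mult_distrib of_real_mult)
  then have "(norm (tens h l))\<^sup>2 = (norm h * norm l)\<^sup>2"
    using of_real_eq_iff by blast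
  then show ?thesis
    by (simp add: power2_eq_iff_nonneg)
qed

lemma tens_total:
  assumes "\<And>h l. cinner (tens h l) v = 0"
  shows "v = 0"
proof -
  let ?Z = "{w. cinner w v = 0}"
  have "chilbert.subspace ?Z"
    by (auto simp: chilbert.subspace_def cinner.zero_left cinner_add_left cinner_scaleC_left)
  then have "cvec_span {tens h l | h l. True} \<subseteq> ?Z"
    using assms by (intro chilbert.span_minimal) auto
  moreover have "closed ?Z"
    by (intro closed_Collect_eq continuous_intros
        bounded_linear.continuous_on[OF cinner.bounded_linear_left])
  ultimately have "closure (cvec_span {tens h l | h l. True}) \<subseteq> ?Z"
    by (rule closure_minimal)
  then have "cinner v v = 0"
    using tensor unfolding hilbert_tensor_def by auto
  then show ?thesis
    by (simp add: cinner_self)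
qed

lemma tens_operator_eqI:
  assumes "\<And>h l. a *\<^sub>V tens h l = b *\<^sub>V tens h l"
  shows "a = b"
proof (rule cblinfun_eqI_cinner)
  fix x y
  have "cadjoint a *\<^sub>V y - cadjoint b *\<^sub>V y = 0"
    by (rule tens_total) (simp add: cinner.diff_right cinner_cadjoint_right assms)
  then show "cinner y (a *\<^sub>V x) = cinner y (b *\<^sub>V x)"
    by (simp flip: cinner_cadjoint_left)
qed

text \<open>For \<open>k\<close> in \<open>B\<close> the isometry
  \<open>h \<mapsto> h \<otimes> k\<close>. The value 0 elsewhere lets sums run over all of
  \<open>'l\<close>, as in \<open>ell2\<close>.\<close>

definition slot :: "'l \<Rightarrow> ('h, 't) cblinfun" where
  "slot k = (if k \<in> B then SOME e. \<forall>h. e *\<^sub>V h = tens h k else 0)"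

lemma slot_apply: "slot k *\<^sub>V h = (if k \<in> B then tens h k else 0)"
proof -
  have "\<exists>e. \<forall>h. e *\<^sub>V h = tens h k"
    by (rule cblinfun_exists[where K = "norm k"]) (simp_all add: tens_simps norm_tens)
  then have "\<forall>h. (SOME e. \<forall>h. e *\<^sub>V h = tens h k) *\<^sub>V h = tens h k"
    by (rule someI_ex)
  then show ?thesis
    by (simp add: slot_def)
qed

lemma slot_outside: "k \<notin> B \<Longrightarrow> slot k = 0"
  by (simp add: slot_def)

lemma slot_adjoint_tens:
  "cadjoint (slot k) *\<^sub>V tens h l = (if k \<in> B then cinner k l *\<^sub>C h else 0)"
  by (rule cinner_right_eqI)
    (simp add: cinner_cadjoint_right slot_apply tens_simps cinner_scaleC_right
      cinner.zero_left cinner.zero_right mult.commute)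

lemma basis_cinner: "k \<in> B \<Longrightarrow> l \<in> B \<Longrightarrow> cinner k l = (if k = l then 1 else 0)"
  using basis unfolding orthonormal_basis_def by blast

lemma slot_adjoint_slot:
  "cadjoint (slot k) *\<^sub>V slot l *\<^sub>V h = (if k = l \<and> k \<in> B then h else 0)"
  by (auto simp: slot_apply slot_adjoint_tens basis_cinner scaleC_one)

text \<open>To test \<open>v\<close> on \<open>tens h l\<close> with arbitrary \<open>l\<close>, it
  is pulled back along \<open>tens h\<close>, and the totality of \<open>B\<close> applies
  there.\<close>

lemma slot_total:
  assumes "\<And>k. cadjoint (slot k) *\<^sub>V v = 0"
  shows "v = 0"
proof (rule tens_total)
  fix h l
  have "\<exists>e. \<forall>l. e *\<^sub>V l = tens h l"
    by (rule cblinfun_exists[where K = "norm h"]) (simp_all add: tens_simps norm_tens mult.commute)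
  then obtain e where e: "\<forall>l. e *\<^sub>V l = tens h l" ..
  have "cinner k (cadjoint e *\<^sub>V v) = 0" if "k \<in> B" for k
  proof -
    have "cinner k (cadjoint e *\<^sub>V v) = cinner h (cadjoint (slot k) *\<^sub>V v)"
      using that e by (simp add: cinner_cadjoint_right slot_apply)
    then show ?thesis
      by (simp add: assms cinner.zero_right)
  qed
  then have "cadjoint e *\<^sub>V v = 0"
    using basis unfolding orthonormal_basis_def by simp
  then have "cinner l (cadjoint e *\<^sub>V v) = 0"
    by (simp add: cinner.zero_right)
  then show "cinner (tens h l) v = 0"
    using e by (simp add: cinner_cadjoint_right)
qed

lemma bessel:
  assumes "finite F"
  shows "(\<Sum>k\<in>F. (norm (cadjoint (slot k) *\<^sub>V v))\<^sup>2) \<le> (norm v)\<^sup>2"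
proof -
  \<comment> \<open>The projection of \<open>v\<close> onto the slots in \<open>F\<close>. Having
    the same coefficients there, \<open>p\<close> and \<open>v\<close> have the same inner product
    with \<open>p\<close>, so \<open>(norm p)\<^sup>2 \<le> norm p * norm v\<close>.\<close>
  define p where "p = (\<Sum>k\<in>F. slot k *\<^sub>V cadjoint (slot k) *\<^sub>V v)"
  have coef: "cadjoint (slot k) *\<^sub>V p = cadjoint (slot k) *\<^sub>V v" if "k \<in> F" for k
  proof -
    have "cadjoint (slot k) *\<^sub>V p = (\<Sum>j\<in>F. cadjoint (slot k) *\<^sub>V slot j *\<^sub>V cadjoint (slot j) *\<^sub>V v)"
      unfolding p_def by (rule linear_sum[OF bounded_linear.linear[OF cblinfun_bounded_linear]])
    also have "\<dots> = (\<Sum>j\<in>F. if k = j then cadjoint (slot k) *\<^sub>V v else 0)"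
      by (intro sum.cong refl) (cases "k \<in> B"; auto simp: slot_adjoint_slot slot_outside)
    also have "\<dots> = cadjoint (slot k) *\<^sub>V v"
      using assms that by simp
    finally show ?thesis .
  qed
  have sq: "cinner p w = complex_of_real (\<Sum>k\<in>F. (norm (cadjoint (slot k) *\<^sub>V v))\<^sup>2)"
    if "\<And>k. k \<in> F \<Longrightarrow> cadjoint (slot k) *\<^sub>V w = cadjoint (slot k) *\<^sub>V v" for w
  proof -
    have "cinner p w = (\<Sum>k\<in>F. cinner (cadjoint (slot k) *\<^sub>V v) (cadjoint (slot k) *\<^sub>V w))"
      unfolding p_def by (simp add: cinner.sum_left cinner_cadjoint_right)
    then show ?thesis
      using that by (simp add: cinner_self)
  qed
  define s where "s = (\<Sum>k\<in>F. (norm (cadjoint (slot k) *\<^sub>V v))\<^sup>2)"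
  have "s \<ge> 0"
    by (simp add: s_def sum_nonneg)
  have "complex_of_real ((norm p)\<^sup>2) = complex_of_real s"
    using sq[OF coef] by (simp only: cinner_self s_def)
  then have p: "(norm p)\<^sup>2 = s"
    using of_real_eq_iff by blast
  have "s = cmod (cinner p v)"
    using sq[of v] \<open>s \<ge> 0\<close> unfolding s_def[symmetric] by simp
  also have "\<dots> \<le> norm p * norm v"
    by (rule cmod_cinner_le)
  finally have "(norm p)\<^sup>2 \<le> norm p * norm v"
    by (simp add: p)
  then have "norm p \<le> norm v"
    by (cases "p = 0") (simp_all add: power2_eq_square)
  then show ?thesis
    unfolding s_def[symmetric] p[symmetric] by (intro power_mono) simp_all
qed

text \<open>The isometry onto the square summable families supported in \<open>B\<close>; Bessel's
  inequality provides its existence, and that it is isometric comes afterwards.\<close>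

definition coords :: "('t, ('l, 'h) ell2) cblinfun" where
  "coords = (SOME J. \<forall>v k. ell2_apply (J *\<^sub>V v) k = cadjoint (slot k) *\<^sub>V v)"

lemma coords_apply: "ell2_apply (coords *\<^sub>V v) k = cadjoint (slot k) *\<^sub>V v"
proof -
  have "\<exists>c. (\<forall>k. ell2_apply c k = cadjoint (slot k) *\<^sub>V v) \<and> norm c \<le> norm v" for v
    by (rule ell2_exists) (simp_all add: bessel)
  then have "\<exists>J :: 't \<Rightarrow> ('l, 'h) ell2. \<forall>v.
      (\<forall>k. ell2_apply (J v) k = cadjoint (slot k) *\<^sub>V v) \<and> norm (J v) \<le> norm v"
    by (intro choice allI)
  then obtain J :: "'t \<Rightarrow> ('l, 'h) ell2"
    where J: "\<And>v k. ell2_apply (J v) k = cadjoint (slot k) *\<^sub>V v" "\<And>v. norm (J v) \<le> norm v"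
    by auto
  have "J (v + w) = J v + J w" for v w
    by (rule ell2_eqI) (simp add: J cblinfun_apply_add)
  moreover have "J (c *\<^sub>C v) = c *\<^sub>C J v" for c v
    by (rule ell2_eqI) (simp add: J cblinfun_apply_scaleC)
  moreover have "norm (J v) \<le> 1 * norm v" for v
    using J(2) by simp
  ultimately have "\<exists>W. \<forall>v. W *\<^sub>V v = J v"
    by (rule cblinfun_exists)
  then obtain W where "\<forall>v. W *\<^sub>V v = J v" ..
  then have "\<forall>v k. ell2_apply (W *\<^sub>V v) k = cadjoint (slot k) *\<^sub>V v"
    using J by simp
  then show ?thesis
    unfolding coords_def by (rule someI2) simp
qed

text \<open>With \<open>J = coords\<close>, \<open>J\<^sup>* J v - v\<close> is orthogonal to all \<open>h \<otimes> k\<close> with \<open>k\<close> in the basis.\<close>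

lemma coords_adjoint_coords: "cadjoint coords *\<^sub>V coords *\<^sub>V v = v"
proof -
  have "cadjoint (slot k) *\<^sub>V (cadjoint coords *\<^sub>V coords *\<^sub>V v - v) = 0" for k
  proof (rule cinner_right_eqI)
    fix h
    have "((\<lambda>j. cinner (cadjoint (slot j) *\<^sub>V slot k *\<^sub>V h) (cadjoint (slot j) *\<^sub>V v))
        has_sum cinner (coords *\<^sub>V slot k *\<^sub>V h) (coords *\<^sub>V v)) UNIV"
      using ell2_cinner_has_sum[of "coords *\<^sub>V slot k *\<^sub>V h" "coords *\<^sub>V v"] by (simp add: coords_apply)
    moreover have "((\<lambda>j. cinner (cadjoint (slot j) *\<^sub>V slot k *\<^sub>V h) (cadjoint (slot j) *\<^sub>V v))
        has_sum cinner h (cadjoint (slot k) *\<^sub>V v)) UNIV"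
    proof (rule has_sum_finite_neutralI[where B = "{k}"])
      show "cinner (cadjoint (slot j) *\<^sub>V slot k *\<^sub>V h) (cadjoint (slot j) *\<^sub>V v) = 0"
        if "j \<in> UNIV - {k}" for j
        using that by (simp add: slot_adjoint_slot cinner.zero_left)
      show "cinner h (cadjoint (slot k) *\<^sub>V v) =
          (\<Sum>j\<in>{k}. cinner (cadjoint (slot j) *\<^sub>V slot k *\<^sub>V h) (cadjoint (slot j) *\<^sub>V v))"
        by (cases "k \<in> B") (simp_all add: slot_adjoint_slot slot_outside cinner.zero_left cinner.zero_right)
    qed simp_all
    ultimately have "cinner (coords *\<^sub>V slot k *\<^sub>V h) (coords *\<^sub>V v) = cinner h (cadjoint (slot k) *\<^sub>V v)"
      by (rule has_sum_unique)
    then show "cinner h (cadjoint (slot k) *\<^sub>V (cadjoint coords *\<^sub>V coords *\<^sub>V v - v)) = cinner h 0"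
      by (simp add: cinner_cadjoint_right cinner.diff_right cinner.zero_right)
  qed
  from slot_total[OF this] show ?thesis
    by simp
qed

lemma parseval:
  "((\<lambda>k. cinner (cadjoint (slot k) *\<^sub>V v) (cadjoint (slot k) *\<^sub>V w)) has_sum cinner v w) UNIV"
  using ell2_cinner_has_sum[of "coords *\<^sub>V v" "coords *\<^sub>V w"]
  by (simp add: coords_apply coords_adjoint_coords flip: cinner_cadjoint_right)

section \<open>Tensor products of operators and their matrix entries\<close>

text \<open>Conjugating the coordinatewise action by \<open>coords\<close> yields a bounded operator
  without estimates on finite sums of elementary tensors.\<close>

lemma tensor_left_exists: "\<exists>X. \<forall>h l. X *\<^sub>V tens h l = tens (x *\<^sub>V h) l"
proof (intro exI allI)
  fix h l
  have "ell2_diag x *\<^sub>V coords *\<^sub>V tens h l = coords *\<^sub>V tens (x *\<^sub>V h) l"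
    by (rule ell2_eqI) (simp add: coords_apply slot_adjoint_tens cblinfun_apply_scaleC)
  then show "(cadjoint coords o\<^sub>C ell2_diag x o\<^sub>C coords) *\<^sub>V tens h l = tens (x *\<^sub>V h) l"
    by (simp add: coords_adjoint_coords)
qed

text \<open>The slot projections sum weakly to the identity, with partial sums of norm at most
  1.\<close>

lemma predual_zero_of_slots:
  assumes \<phi>: "\<phi> \<in> predual_functionals"
    and zero: "\<And>k. \<phi> (slot k o\<^sub>C cadjoint (slot k)) = 0"
  shows "\<phi> cblinfun_id = 0"
proof -
  define P where "P F = (\<Sum>k\<in>F. slot k o\<^sub>C cadjoint (slot k))" for F
  have P: "cinner \<xi> (P F *\<^sub>V \<eta>) = (\<Sum>k\<in>F. cinner (cadjoint (slot k) *\<^sub>V \<xi>) (cadjoint (slot k) *\<^sub>V \<eta>))"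
    for F \<xi> \<eta>
    unfolding P_def by (simp add: cblinfun_sum_apply cinner.sum_right cinner_cadjoint_left)
  have "((\<lambda>F. \<phi> (P F)) \<longlongrightarrow> \<phi> cblinfun_id) (finite_subsets_at_top UNIV)"
  proof (rule predual_tendsto[OF \<phi>])
    show "cmod (cinner \<xi> (P F *\<^sub>V \<eta>)) \<le> 1 * (norm \<xi> * norm \<eta>)" for F \<xi> \<eta>
    proof (cases "finite F")
      case True
      have "cmod (cinner \<xi> (P F *\<^sub>V \<eta>))
          \<le> (\<Sum>k\<in>F. norm (cadjoint (slot k) *\<^sub>V \<xi>) * norm (cadjoint (slot k) *\<^sub>V \<eta>))"
        unfolding P by (intro sum_norm_le cmod_cinner_le)
      also have "\<dots> \<le> norm \<xi> * norm \<eta>"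
        using True by (intro sum_mult_le_sqrt_bounds bessel) simp_all
      finally show ?thesis by simp
    qed (simp add: P)
    show "((\<lambda>F. cinner \<xi> (P F *\<^sub>V \<eta>)) \<longlongrightarrow> cinner \<xi> (cblinfun_id *\<^sub>V \<eta>)) (finite_subsets_at_top UNIV)"
      for \<xi> \<eta>
      using parseval[of \<xi> \<eta>] unfolding P has_sum_def by simp
  qed simp
  moreover have "\<phi> (P F) = 0" for F
    unfolding P_def predual_sum[OF \<phi>] by (simp add: zero)
  ultimately show ?thesis
    by (simp add: tendsto_const_iff)
qed

text \<open>The identity is resolved into slot projections first on the left of \<open>t\<close> and
  then on the right, so each step has a single limit.\<close>

lemma predual_zero_of_compressions:
  assumes \<phi>: "\<phi> \<in> predual_functionals"
    and zero: "\<And>k l. \<phi> (slot k o\<^sub>C (cadjoint (slot k) o\<^sub>C t o\<^sub>C slot l) o\<^sub>C cadjoint (slot l)) = 0"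
  shows "\<phi> t = 0"
proof -
  have "\<phi> (t o\<^sub>C (slot l o\<^sub>C cadjoint (slot l))) = 0" for l
  proof -
    let ?r = "t o\<^sub>C (slot l o\<^sub>C cadjoint (slot l))"
    have "\<phi> (cblinfun_id o\<^sub>C cblinfun_id o\<^sub>C ?r) = 0"
      by (rule predual_zero_of_slots[OF predual_compose[OF \<phi>]])
        (use zero[of _ l] in \<open>simp add: cblinfun_compose_assoc\<close>)
    then show ?thesis by simp
  qed
  then have "\<phi> (t o\<^sub>C cblinfun_id o\<^sub>C cblinfun_id) = 0"
    by (intro predual_zero_of_slots[OF predual_compose[OF \<phi>]]) simp
  then show ?thesis
    by simp
qed

end

text \<open>By symmetry, the construction of \<open>s \<otimes> 1\<close> also yields
  \<open>1 \<otimes> a\<close>.\<close>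

lemma hilbert_tensor_flip:
  assumes "hilbert_tensor tens"
  shows "hilbert_tensor (\<lambda>l h. tens h l)"
proof -
  have "{tens h l | l h. True} = {tens h l | h l. True}"
    by blast
  then show ?thesis
    using assms unfolding hilbert_tensor_def by (simp add: mult.commute)
qed

lemma tensor_op_apply:
  assumes "hilbert_tensor tens"
  shows "tensor_op tens s a *\<^sub>V tens h l = tens (s *\<^sub>V h) (a *\<^sub>V l)"
proof -
  obtain B where "orthonormal_basis (B :: 'b set)"
    using orthonormal_basis_exists by auto
  then interpret left: tensor_basis tens B
    using assms by unfold_locales
  obtain C where "orthonormal_basis (C :: 'a set)"
    using orthonormal_basis_exists by auto
  then interpret right: tensor_basis "\<lambda>l h. tens h l" C
    using hilbert_tensor_flip[OF assms] by unfold_locales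
  obtain X where X: "\<forall>h l. X *\<^sub>V tens h l = tens (s *\<^sub>V h) l"
    using left.tensor_left_exists[of s] by auto
  obtain Y where Y: "\<forall>l h. Y *\<^sub>V tens h l = tens h (a *\<^sub>V l)"
    using right.tensor_left_exists[of a] by auto
  \<comment> \<open>The product of \<open>s \<otimes> 1\<close> and \<open>1 \<otimes> a\<close>; as
    \<open>tensor_op\<close> is a definite description, uniqueness on elementary tensors is added
    below.\<close>
  have XY: "\<forall>h l. (X o\<^sub>C Y) *\<^sub>V tens h l = tens (s *\<^sub>V h) (a *\<^sub>V l)"
    using X Y by simp
  have "tensor_op tens s a = X o\<^sub>C Y"
    unfolding tensor_op_def
  proof (rule the_equality)
    show "\<forall>h l. (X o\<^sub>C Y) *\<^sub>V tens h l = tens (s *\<^sub>V h) (a *\<^sub>V l)"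
      by (rule XY)
    show "t = X o\<^sub>C Y" if "\<forall>h l. t *\<^sub>V tens h l = tens (s *\<^sub>V h) (a *\<^sub>V l)" for t
      by (rule left.tens_operator_eqI) (use that XY in simp)
  qed
  then show ?thesis
    using XY by simp
qed


section \<open>The pullback of a quantum relation\<close>

definition zero_extend :: "'i set \<Rightarrow> ('i \<Rightarrow> 'a::zero) \<Rightarrow> 'i \<Rightarrow> 'a" where
  "zero_extend I b i = (if i \<in> I then b i else 0)"

lemma cisometry_cinner:
  assumes "cisometry u"
  shows "cinner (u *\<^sub>V x) (u *\<^sub>V y) = cinner x y"
proof -
  have norm: "norm (u *\<^sub>V x) = norm x" for x
    using assms by (simp add: cisometry_def)
  have re: "inner (u *\<^sub>V x) (u *\<^sub>V y) = inner x y" for x y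
    unfolding dot_norm[of "u *\<^sub>V x"] dot_norm[of x]
    by (simp only: norm cblinfun_apply_add[symmetric])
  show ?thesis
  proof (rule complex_eqI)
    show "Re (cinner (u *\<^sub>V x) (u *\<^sub>V y)) = Re (cinner x y)"
      using re[of x y] by (simp add: inner_eq_Re_cinner)
    show "Im (cinner (u *\<^sub>V x) (u *\<^sub>V y)) = Im (cinner x y)"
      using re[of "\<i> *\<^sub>C x" y]
      by (simp add: inner_eq_Re_cinner cblinfun_apply_scaleC cinner_scaleC_left)
  qed
qed

text \<open>Padding with zeros contributes only the generator 0, on which every functional
  vanishes.\<close>

lemma weakstar_span_zero_extend:
  fixes b :: "'i \<Rightarrow> ('n::chilbert_space, 'm::chilbert_space) cblinfun"
  assumes "cblinfun_subspace S"
  shows "weakstar_span {cadjoint (zero_extend I b i) o\<^sub>C x o\<^sub>C zero_extend I b j | i x j. x \<in> S}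
    = weakstar_span (pullback_generators I b S)" (is "weakstar_span ?G = weakstar_span ?H")
proof -
  have "(\<forall>g\<in>?G. \<phi> g = 0) \<longleftrightarrow> (\<forall>g\<in>?H. \<phi> g = 0)"
    if \<phi>: "\<phi> \<in> predual_functionals" for \<phi> :: "'n cbop \<Rightarrow> complex"
  proof
    assume 0: "\<forall>g\<in>?G. \<phi> g = 0"
    show "\<forall>g\<in>?H. \<phi> g = 0"
    proof
      fix g assume "g \<in> ?H"
      then obtain i x j where g: "g = cadjoint (b i) o\<^sub>C x o\<^sub>C b j" "i \<in> I" "x \<in> S" "j \<in> I"
        unfolding pullback_generators_def by auto
      then have "g = cadjoint (zero_extend I b i) o\<^sub>C x o\<^sub>C zero_extend I b j"
        by (simp add: zero_extend_def)
      then show "\<phi> g = 0"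
        using 0 g(3) by auto
    qed
  next
    assume 0: "\<forall>g\<in>?H. \<phi> g = 0"
    show "\<forall>g\<in>?G. \<phi> g = 0"
    proof
      fix g assume "g \<in> ?G"
      then obtain i x j where g: "g = cadjoint (zero_extend I b i) o\<^sub>C x o\<^sub>C zero_extend I b j" "x \<in> S"
        by auto
      show "\<phi> g = 0"
      proof (cases "i \<in> I \<and> j \<in> I")
        case True
        then have "g \<in> ?H"
          using g unfolding pullback_generators_def by (auto simp: zero_extend_def)
        then show ?thesis
          using 0 by auto
      next
        case False
        then have "g = 0"
          by (intro cblinfun_eqI) (auto simp: g zero_extend_def)
        then show ?thesis
          by (simp add: predual_zero[OF \<phi>])
      qed
    qed
  qed
  then show ?thesis
    by (auto simp: weakstar_span_iff)
qed

lemma kraus_family_zero_extend: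
  assumes M: "von_neumann_algebra M" and kraus: "kraus_form M \<theta> I b"
  shows "kraus_family M \<theta> (zero_extend I b)"
proof
  show "cblinfun_id \<in> M" "\<And>x y. x \<in> M \<Longrightarrow> y \<in> M \<Longrightarrow> x o\<^sub>C y \<in> M" "\<And>x. x \<in> M \<Longrightarrow> cadjoint x \<in> M"
    using M unfolding von_neumann_algebra_def by auto
next
  fix x \<xi> \<eta> assume "x \<in> M"
  then have "limitin weakstar (\<lambda>F. \<Sum>i\<in>F. cadjoint (b i) o\<^sub>C x o\<^sub>C b i) (\<theta> x) (finite_subsets_at_top I)"
    using kraus unfolding kraus_form_def by simp
  from limitin_weakstar_predual[OF this vector_functional_predual[of \<xi> \<eta>]]
  have "((\<lambda>i. cinner (b i *\<^sub>V \<xi>) (x *\<^sub>V b i *\<^sub>V \<eta>)) has_sum cinner \<xi> (\<theta> x *\<^sub>V \<eta>)) I"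
    unfolding has_sum_def by (simp add: cblinfun_sum_apply cinner.sum_right cinner_cadjoint_right)
  then show "((\<lambda>i. cinner (zero_extend I b i *\<^sub>V \<xi>) (x *\<^sub>V zero_extend I b i *\<^sub>V \<eta>))
      has_sum cinner \<xi> (\<theta> x *\<^sub>V \<eta>)) UNIV"
    by (subst has_sum_cong_neutral[where T = I and g = "\<lambda>i. cinner (b i *\<^sub>V \<xi>) (x *\<^sub>V b i *\<^sub>V \<eta>)"])
      (auto simp: zero_extend_def cinner.zero_left)
qed

section \<open>The bimodule property\<close>

text \<open>A factor from the commutant of \<open>N\<close> is absorbed into an outer Kraus
  operator, which stays dominated: the commutant is closed under adjoints and commutes with the
  values of \<open>\<theta>\<close>.\<close>

lemma operator_bimodule_weakstar_span:
  assumes M: "von_neumann_algebra M" and N: "von_neumann_algebra N"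
    and \<theta>: "\<theta> \<in> M \<rightarrow> N" and kraus: "kraus_form M \<theta> I b" and S: "quantum_relation M S"
  shows "operator_bimodule (commutant N) (weakstar_span (pullback_generators I b S))"
proof -
  interpret kraus_family M \<theta> "zero_extend I b"
    by (rule kraus_family_zero_extend[OF M kraus])
  have sub: "cblinfun_subspace S"
    using S by (simp add: quantum_relation_def)
  have N_adj: "cadjoint x \<in> N" if "x \<in> N" for x
    using N that by (simp add: von_neumann_algebra_def)
  have comm: "\<theta> x o\<^sub>C y = y o\<^sub>C \<theta> x" if "x \<in> M" "y \<in> commutant N" for x y
  proof -
    have "\<theta> x \<in> N"
      using \<theta> that(1) by auto
    then show ?thesis
      using that(2) by (simp add: commutant_def)
  qed
  have dom: "dominated (b j o\<^sub>C y)" if "y \<in> commutant N" "j \<in> I" for y j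
    using dominated_compose[of y j] that comm commutant_cadjoint[OF N_adj that(1)]
    by (simp add: zero_extend_def)
  have dom_self: "dominated (b j)" if "j \<in> I" for j
    using dominated_self[of j] that by (simp add: zero_extend_def)
  let ?T = "weakstar_span (pullback_generators I b S)"
  have sandwich: "cadjoint c' o\<^sub>C x o\<^sub>C c \<in> ?T" if "dominated c" "dominated c'" "x \<in> S" for c c' x
    using dominated_sandwich[OF that(1,2) S that(3)] unfolding weakstar_span_zero_extend[OF sub] .
  have "y o\<^sub>C t \<in> ?T" "t o\<^sub>C y \<in> ?T" if y: "y \<in> commutant N" and t: "t \<in> ?T" for y t
  proof -
    have "y o\<^sub>C t o\<^sub>C cblinfun_id \<in> ?T"
    proof (rule weakstar_span_compose[OF _ t])
      fix g assume "g \<in> pullback_generators I b S"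
      then obtain i x j where g: "g = cadjoint (b i) o\<^sub>C x o\<^sub>C b j" "i \<in> I" "x \<in> S" "j \<in> I"
        unfolding pullback_generators_def by auto
      \<comment> \<open>A left factor \<open>y\<close> is the adjoint of a right factor
        \<open>cadjoint y\<close> on \<open>b i\<close>.\<close>
      have "cadjoint (b i o\<^sub>C cadjoint y) o\<^sub>C x o\<^sub>C b j \<in> ?T"
        using g y commutant_cadjoint[OF N_adj] by (intro sandwich dom dom_self) simp_all
      then show "y o\<^sub>C g o\<^sub>C cblinfun_id \<in> ?T"
        by (simp add: g cadjoint_compose cblinfun_compose_assoc)
    qed
    then show "y o\<^sub>C t \<in> ?T" by simp
    have "cblinfun_id o\<^sub>C t o\<^sub>C y \<in> ?T"
    proof (rule weakstar_span_compose[OF _ t])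
      fix g assume "g \<in> pullback_generators I b S"
      then obtain i x j where g: "g = cadjoint (b i) o\<^sub>C x o\<^sub>C b j" "i \<in> I" "x \<in> S" "j \<in> I"
        unfolding pullback_generators_def by auto
      have "cadjoint (b i) o\<^sub>C x o\<^sub>C (b j o\<^sub>C y) \<in> ?T"
        using g y by (intro sandwich dom dom_self) simp_all
      then show "cblinfun_id o\<^sub>C g o\<^sub>C y \<in> ?T"
        by (simp add: g cblinfun_compose_assoc)
    qed
    then show "t o\<^sub>C y \<in> ?T" by simp
  qed
  then show ?thesis
    unfolding operator_bimodule_def using subspace_weakstar_span by simp
qed

section \<open>Slices of a dilation\<close>

context tensor_basis
begin

definition slices :: "('n::chilbert_space, 't) cblinfun \<Rightarrow> 'l \<Rightarrow> ('n, 'h) cblinfun" where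
  "slices W k = cadjoint (slot k) o\<^sub>C W"

lemma slot_adjoint_tensor_op:
  "cadjoint (slot k) *\<^sub>V tensor_op tens x cblinfun_id *\<^sub>V v = x *\<^sub>V cadjoint (slot k) *\<^sub>V v"
proof -
  have "cadjoint (slot k) o\<^sub>C tensor_op tens x cblinfun_id = x o\<^sub>C cadjoint (slot k)"
    by (rule tens_operator_eqI)
      (simp add: tensor_op_apply[OF tensor] slot_adjoint_tens cblinfun_apply_scaleC)
  then show ?thesis
    by (metis cblinfun_apply_simps(7))
qed

text \<open>Parseval resolves the inner product of \<open>u V \<xi>\<close> and
  \<open>u (\<pi> x) V \<eta>\<close> into slices. The intertwining relation lets \<open>x\<close>
  act on each slice, and the isometry removes \<open>u\<close>.\<close>

lemma kraus_family_slices: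
  assumes M: "von_neumann_algebra M" and dil: "stinespring_dilation M \<theta> \<pi> V"
    and u: "intertwining_isometry M \<pi> tens u"
  shows "kraus_family M \<theta> (slices (u o\<^sub>C V))"
proof
  show "cblinfun_id \<in> M" "\<And>x y. x \<in> M \<Longrightarrow> y \<in> M \<Longrightarrow> x o\<^sub>C y \<in> M" "\<And>x. x \<in> M \<Longrightarrow> cadjoint x \<in> M"
    using M unfolding von_neumann_algebra_def by auto
next
  fix x \<xi> \<eta> assume x: "x \<in> M"
  have "tensor_op tens x cblinfun_id o\<^sub>C u = u o\<^sub>C \<pi> x"
    using u x by (simp add: intertwining_isometry_def)
  from arg_cong[OF this, of "\<lambda>a. a *\<^sub>V V *\<^sub>V \<eta>"]
  have comm: "tensor_op tens x cblinfun_id *\<^sub>V u *\<^sub>V V *\<^sub>V \<eta> = u *\<^sub>V \<pi> x *\<^sub>V V *\<^sub>V \<eta>"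
    by simp
  have \<theta>: "\<theta> x = cadjoint V o\<^sub>C \<pi> x o\<^sub>C V"
    using dil x by (simp add: stinespring_dilation_def)
  have "cinner (u *\<^sub>V V *\<^sub>V \<xi>) (u *\<^sub>V \<pi> x *\<^sub>V V *\<^sub>V \<eta>) = cinner \<xi> (\<theta> x *\<^sub>V \<eta>)"
    using u by (simp add: intertwining_isometry_def cisometry_cinner \<theta> cinner_cadjoint_right)
  then show "((\<lambda>k. cinner (slices (u o\<^sub>C V) k *\<^sub>V \<xi>) (x *\<^sub>V slices (u o\<^sub>C V) k *\<^sub>V \<eta>))
      has_sum cinner \<xi> (\<theta> x *\<^sub>V \<eta>)) UNIV"
    using parseval[of "u *\<^sub>V V *\<^sub>V \<xi>" "u *\<^sub>V \<pi> x *\<^sub>V V *\<^sub>V \<eta>"]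
    by (simp add: slices_def comm flip: slot_adjoint_tensor_op)
qed

text \<open>The scalar is the matrix entry of \<open>a\<close> at \<open>k\<close> and
  \<open>l\<close>, or 0 outside the basis.\<close>

lemma slot_compression:
  "\<exists>c. cadjoint (slot k) o\<^sub>C tensor_op tens s a o\<^sub>C slot l = cblinfun_scale c s"
proof (cases "k \<in> B \<and> l \<in> B")
  case True
  then have "cadjoint (slot k) o\<^sub>C tensor_op tens s a o\<^sub>C slot l = cblinfun_scale (cinner k (a *\<^sub>V l)) s"
    by (intro cblinfun_eqI)
      (simp add: slot_apply tensor_op_apply[OF tensor] slot_adjoint_tens)
  then show ?thesis ..
next
  case False
  then have "cadjoint (slot k) o\<^sub>C tensor_op tens s a o\<^sub>C slot l = cblinfun_scale 0 s"
    by (intro cblinfun_eqI) (auto simp: slot_outside)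
  then show ?thesis ..
qed

text \<open>For basis vectors, \<open>r\<close> is the rank one operator
  \<open>m \<mapsto> cinner l m *\<^sub>C k\<close>. This places the slice generators among
  compressions of elementary tensors.\<close>

lemma slot_expansion: "\<exists>r. slot k o\<^sub>C x o\<^sub>C cadjoint (slot l) = tensor_op tens x r"
proof (cases "k \<in> B \<and> l \<in> B")
  case True
  have "\<exists>r. \<forall>m. r *\<^sub>V m = cinner l m *\<^sub>C k"
  proof (rule cblinfun_exists[where K = "norm l * norm k"])
    show "norm (cinner l m *\<^sub>C k) \<le> norm l * norm k * norm m" for m
      using mult_right_mono[OF cmod_cinner_le[of l m], of "norm k"] by (simp add: norm_scaleC mult_ac)
  qed (simp_all add: cinner_add_right cinner_scaleC_right scaleC_add_left scaleC_scaleC)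
  then obtain r where r: "\<forall>m. r *\<^sub>V m = cinner l m *\<^sub>C k" ..
  have "slot k o\<^sub>C x o\<^sub>C cadjoint (slot l) = tensor_op tens x r"
    by (rule tens_operator_eqI) (use True r in \<open>simp add: tensor_op_apply[OF tensor] slot_adjoint_tens
        slot_apply cblinfun_apply_scaleC tens_simps\<close>)
  then show ?thesis ..
next
  case False
  have "tens h 0 = 0" "tens 0 l = 0" for h l
    using tens_simps(4)[of h 0 0] tens_simps(3)[of 0 0 l] by simp_all
  then have "slot k o\<^sub>C x o\<^sub>C cadjoint (slot l) = tensor_op tens x 0"
    by (intro tens_operator_eqI)
      (use False in \<open>auto simp: tensor_op_apply[OF tensor] slot_adjoint_tens slot_apply\<close>)
  then show ?thesis ..
qed

text \<open>Slice generators are compressed elementary tensors with a rank one second factor.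
  Conversely, a functional on a compressed elementary tensor is determined by matrix entries, which
  are multiples of one \<open>s\<close>.\<close>

lemma closure_compressed_tensor_full:
  fixes W :: "('n::chilbert_space, 't) cblinfun"
  assumes S: "cblinfun_subspace S"
  shows "weakstar closure_of {cadjoint W o\<^sub>C t o\<^sub>C W | t. t \<in> tensor_full tens S}
    = weakstar_span {cadjoint (slices W k) o\<^sub>C x o\<^sub>C slices W l | k x l. x \<in> S}"
    (is "weakstar closure_of ?Y = weakstar_span ?G")
proof
  have T: "cblinfun_subspace (tensor_full tens S)"
    unfolding tensor_full_def by (rule subspace_weakstar_span)
  have "cblinfun_subspace ?Y"
  proof (rule cblinfun.subspaceI)
    have "0 = cadjoint W o\<^sub>C 0 o\<^sub>C W"
      by (rule cblinfun_eqI) simp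
    then show "0 \<in> ?Y"
      using cblinfun.subspace_0[OF T] by blast
  next
    fix x y assume "x \<in> ?Y" "y \<in> ?Y"
    then obtain t t' where "x = cadjoint W o\<^sub>C t o\<^sub>C W" "y = cadjoint W o\<^sub>C t' o\<^sub>C W"
      "t \<in> tensor_full tens S" "t' \<in> tensor_full tens S" by auto
    moreover from this have "x + y = cadjoint W o\<^sub>C (t + t') o\<^sub>C W"
      by (intro cblinfun_eqI) (simp add: cblinfun_apply_add)
    ultimately show "x + y \<in> ?Y"
      using cblinfun.subspace_add[OF T] by auto
  next
    fix c x assume "x \<in> ?Y"
    then obtain t where "x = cadjoint W o\<^sub>C t o\<^sub>C W" "t \<in> tensor_full tens S" by auto
    moreover from this have "cblinfun_scale c x = cadjoint W o\<^sub>C cblinfun_scale c t o\<^sub>C W"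
      by (intro cblinfun_eqI) (simp add: cblinfun_apply_scaleC)
    ultimately show "cblinfun_scale c x \<in> ?Y"
      using cblinfun.subspace_scale[OF T] by auto
  qed
  \<comment> \<open>As a subspace, \<open>?Y\<close> is its own span, so its closure falls under the
    duality criterion.\<close>
  then have Y: "weakstar closure_of ?Y = weakstar_span ?Y"
    by (simp add: weakstar_span_def cblinfun.span_eq_iff[THEN iffD2])
  have "?G \<subseteq> ?Y"
  proof
    fix g assume "g \<in> ?G"
    then obtain k x l where g: "g = cadjoint (slices W k) o\<^sub>C x o\<^sub>C slices W l" "x \<in> S"
      by auto
    obtain r where r: "slot k o\<^sub>C x o\<^sub>C cadjoint (slot l) = tensor_op tens x r"
      using slot_expansion[of k x l] by auto
    have "tensor_op tens x r \<in> tensor_full tens S"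
      unfolding tensor_full_def using g(2) by (intro weakstar_span_base) auto
    moreover have "g = cadjoint W o\<^sub>C tensor_op tens x r o\<^sub>C W"
      by (simp add: g(1) slices_def cadjoint_compose cblinfun_compose_assoc flip: r)
    ultimately show "g \<in> ?Y"
      by auto
  qed
  then show "weakstar_span ?G \<subseteq> weakstar closure_of ?Y"
    unfolding Y using subspace_weakstar_span closedin_weakstar_span weakstar_span_base
    by (intro weakstar_span_minimal) blast+
  have "cadjoint W o\<^sub>C tensor_op tens s a o\<^sub>C W \<in> weakstar_span ?G" if s: "s \<in> S" for s a
    unfolding weakstar_span_iff
  proof (intro ballI impI)
    fix \<phi> :: "'n cbop \<Rightarrow> complex"
    assume \<phi>: "\<phi> \<in> predual_functionals" and 0: "\<forall>g\<in>?G. \<phi> g = 0"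
    show "\<phi> (cadjoint W o\<^sub>C tensor_op tens s a o\<^sub>C W) = 0"
    proof (rule predual_zero_of_compressions[OF predual_compose[OF \<phi>]])
      fix k l
      obtain c where c: "cadjoint (slot k) o\<^sub>C tensor_op tens s a o\<^sub>C slot l = cblinfun_scale c s"
        using slot_compression[of k s a l] by auto
      have "cadjoint W o\<^sub>C (slot k o\<^sub>C cblinfun_scale c s o\<^sub>C cadjoint (slot l)) o\<^sub>C W
          = cadjoint (slices W k) o\<^sub>C cblinfun_scale c s o\<^sub>C slices W l"
        by (simp add: slices_def cadjoint_compose cblinfun_compose_assoc)
      also have "\<dots> \<in> ?G"
        using cblinfun.subspace_scale[OF S s] by auto
      finally show "\<phi> (cadjoint W o\<^sub>C (slot k o\<^sub>C (cadjoint (slot k) o\<^sub>C tensor_op tens s a o\<^sub>C slot l)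
          o\<^sub>C cadjoint (slot l)) o\<^sub>C W) = 0"
        unfolding c using 0 by blast
    qed
  qed
  \<comment> \<open>Weak* limits of elementary tensors pass through the compression by
    \<open>W\<close>.\<close>
  then have "cadjoint W o\<^sub>C t o\<^sub>C W \<in> weakstar_span ?G" if "t \<in> tensor_full tens S" for t
    by (intro weakstar_span_compose[OF _ that[unfolded tensor_full_def]]) auto
  then have "?Y \<subseteq> weakstar_span ?G"
    by auto
  then show "weakstar closure_of ?Y \<subseteq> weakstar_span ?G"
    using closedin_weakstar_span by (rule closure_of_minimal)
qed

end

text \<open>Domination between Kraus families of one map is mutual, so exchanging the roles gives
  equality.\<close>

lemma weakstar_span_kraus_families:
  assumes b: "kraus_family M \<theta> b" and b': "kraus_family M \<theta> b'" and S: "quantum_relation M S"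
  shows "weakstar_span {cadjoint (b' i) o\<^sub>C x o\<^sub>C b' j | i x j. x \<in> S}
    \<subseteq> weakstar_span {cadjoint (b i) o\<^sub>C x o\<^sub>C b j | i x j. x \<in> S}"
proof -
  interpret kraus_family M \<theta> b by fact
  show ?thesis
    using dominated_sandwich[OF dominated_other_family[OF b b'] dominated_other_family[OF b b'] S]
    by (intro weakstar_span_minimal subspace_weakstar_span closedin_weakstar_span) auto
qed

theorem theorem7p5:
  fixes M S :: "'m::chilbert_space cbop set"
    and N :: "'n::chilbert_space cbop set"
    and \<theta> :: "'m cbop \<Rightarrow> 'n cbop"
    and I :: "'i set"
    and b :: "'i \<Rightarrow> ('n, 'm) cblinfun"
  assumes "von_neumann_algebra M"
    and "von_neumann_algebra N"
    and "normal_cp_map M N \<theta>"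
    and "kraus_form M \<theta> I b"
    and "quantum_relation M S"
  shows "operator_bimodule (commutant N) (weakstar_span (pullback_generators I b S)) \<and>
    (\<forall>(\<pi> :: 'm cbop \<Rightarrow> 'k::chilbert_space cbop) (V :: ('n, 'k) cblinfun)
        (tens :: 'm \<Rightarrow> 'l::chilbert_space \<Rightarrow> 't::chilbert_space) (u :: ('k, 't) cblinfun).
      stinespring_dilation M \<theta> \<pi> V \<and> hilbert_tensor tens \<and> intertwining_isometry M \<pi> tens u \<longrightarrow>
      pullback N I b S =
        weakstar closure_of {cadjoint V o\<^sub>C r o\<^sub>C V | r. r \<in> rep_relation tens u S})"
proof (intro conjI allI impI)
  have S: "cblinfun_subspace S"
    using assms(5) by (simp add: quantum_relation_def)
  have kraus: "kraus_family M \<theta> (zero_extend I b)"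
    using assms(1,4) by (rule kraus_family_zero_extend)
  have "\<theta> \<in> M \<rightarrow> N"
    using assms(3) by (simp add: normal_cp_map_def)
  from operator_bimodule_weakstar_span[OF assms(1,2) this assms(4,5)]
  show bimodule: "operator_bimodule (commutant N) (weakstar_span (pullback_generators I b S))" .
  fix \<pi> :: "'m cbop \<Rightarrow> 'k cbop" and V :: "('n, 'k) cblinfun"
    and tens :: "'m \<Rightarrow> 'l \<Rightarrow> 't" and u :: "('k, 't) cblinfun"
  assume "stinespring_dilation M \<theta> \<pi> V \<and> hilbert_tensor tens \<and> intertwining_isometry M \<pi> tens u"
  then have dil: "stinespring_dilation M \<theta> \<pi> V" and tens: "hilbert_tensor tens"
    and u: "intertwining_isometry M \<pi> tens u"
    by auto
  obtain B where "orthonormal_basis (B :: 'l set)"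
    using orthonormal_basis_exists by auto
  with tens interpret tensor_basis tens B
    by unfold_locales
  define W where "W = u o\<^sub>C V"
  have slices: "kraus_family M \<theta> (slices W)"
    unfolding W_def using assms(1) dil u by (rule kraus_family_slices)
  have "cadjoint V o\<^sub>C (cadjoint u o\<^sub>C t o\<^sub>C u) o\<^sub>C V = cadjoint W o\<^sub>C t o\<^sub>C W" for t
    by (simp add: W_def cadjoint_compose cblinfun_compose_assoc)
  moreover have "{cadjoint V o\<^sub>C r o\<^sub>C V | r. r \<in> rep_relation tens u S}
      = {cadjoint V o\<^sub>C (cadjoint u o\<^sub>C t o\<^sub>C u) o\<^sub>C V | t. t \<in> tensor_full tens S}"
    unfolding rep_relation_def by blast
  ultimately have "{cadjoint V o\<^sub>C r o\<^sub>C V | r. r \<in> rep_relation tens u S}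
      = {cadjoint W o\<^sub>C t o\<^sub>C W | t. t \<in> tensor_full tens S}"
    by (simp only:)
  then have "weakstar closure_of {cadjoint V o\<^sub>C r o\<^sub>C V | r. r \<in> rep_relation tens u S}
      = weakstar_span {cadjoint (slices W k) o\<^sub>C x o\<^sub>C slices W l | k x l. x \<in> S}"
    using closure_compressed_tensor_full[OF S] by simp
  also have "\<dots> = weakstar_span {cadjoint (zero_extend I b i) o\<^sub>C x o\<^sub>C zero_extend I b j | i x j. x \<in> S}"
    using weakstar_span_kraus_families[OF kraus slices assms(5)]
      weakstar_span_kraus_families[OF slices kraus assms(5)] by (rule subset_antisym)
  also have "\<dots> = weakstar_span (pullback_generators I b S)"
    using S by (rule weakstar_span_zero_extend)
  \<comment> \<open>Any weak* closed bimodule containing the generators contains their span, which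
    is such a bimodule itself; so it is the hull.\<close>
  also have "\<dots> = pullback N I b S"
    unfolding pullback_def
  proof (rule hull_unique[symmetric])
    show "pullback_generators I b S \<subseteq> weakstar_span (pullback_generators I b S)"
      using weakstar_span_base by auto
    show "operator_bimodule (commutant N) (weakstar_span (pullback_generators I b S)) \<and>
        closedin weakstar (weakstar_span (pullback_generators I b S))"
      using bimodule closedin_weakstar_span by simp
    show "weakstar_span (pullback_generators I b S) \<subseteq> T"
      if "pullback_generators I b S \<subseteq> T" "operator_bimodule (commutant N) T \<and> closedin weakstar T" for T
      using that by (intro weakstar_span_minimal) (simp_all add: operator_bimodule_def)
  qed
  finally show "pullback N I b S =
      weakstar closure_of {cadjoint V o\<^sub>C r o\<^sub>C V | r. r \<in> rep_relation tens u S}" ..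
qed

end
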